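(* Let $\Gamma$ be an infinite finitely generated amenable group and let $\mu$ be an admissible probability measure on $\Gamma$. Let $N_\mu$ be the spectral distribution and $\Lambda_\mu$ the $L^2$-isoperimetric profile of the Laplace operator $\Delta_\mu$. Assume that the function $\Lambda_\mu\circ\exp$ is doubling near infinity. Then, near zero and in the dilatational sense, $$N_\mu(\lambda)\simeq\frac{1}{\Lambda_\mu^{-1}(\lambda)},$$ where $\Lambda_\mu^{-1}$ is the generalized inverse of $\Lambda_\mu$.
   Context: "Decreasing" means non-increasing. Admissible measures: a probability measure $\mu$ on a finitely generated group $\Gamma$ is admissible if it is symmetric ($\mu(\{\gamma\})=\mu(\{\gamma^{-1}\})$ for all $\gamma$), has finite second moment ($\int_\Gamma l(\gamma)^2\,d\mu(\gamma)<\infty$, with $l$ the length function of some word metric on $\Gamma$), and its support contains a finite generating set of $\Gamma$. Operators: $R_\mu:l^2(\Gamma)\to l^2(\Gamma)$, $R_\mu(f)(x)=\sum_{\gamma\in\Gamma}f(x\gamma^{-1})\mu(\gamma)$, and $\Delta_\mu=\mathrm{id}-R_\mu$, a positive bounded operator. For a bounded self-adjoint operator $A$ put $E^A_\lambda=\chi_{(-\infty,\lambda]}(A)$. For a bounded operator $A$ on $l^2(\Gamma)$ commuting with the left $\Gamma$-action, $\mathrm{tr}_\Gamma(A)=\langle A\delta_e,\delta_e\rangle$. The spectral distribution of $\Delta_\mu$ is $N_\mu:[0,\infty)\to[0,\infty)$, $N_\mu(\lambda)=\mathrm{tr}_\Gamma(E^{\Delta_\mu}_\lambda)$. $L^2$-isoperimetric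 profile: $\Lambda_\mu:[1,\infty)\to(0,\infty)$, $\Lambda_\mu(v)=\inf_{1\le|\Omega|\le v}\lambda_1(\Omega)$ over finite subsets $\Omega\subset\Gamma$, where $\lambda_1(\Omega)=\inf_{\emptyset\ne\mathrm{supp}(f)\subset\Omega}\langle\Delta_\mu f,f\rangle/\|f\|_2^2$. Generalized inverse: for a decreasing positive function $L$, $L^{-1}(x)=\inf\{v: L(v)\le x\}$ (infimum over $v$ in the domain of $L$), defined for $x>\inf L$. Doubling near infinity: a decreasing positive function $g$ is doubling near infinity if there is $c>0$ with $g(2x)\ge c\,g(x)$ for all sufficiently large $x$. Asymptotic comparison: for $f,g:[0,\infty)\to[0,\infty)$, $f\preceq g$ near zero in the dilatational sense means that there are $D,\epsilon>0$ with $f(\lambda)\le g(D\lambda)$ for all $\lambda\in[0,\epsilon)$; $f\simeq g$ means $f\preceq g$ and $g\preceq f$. An expression defined only for $\lambda>0$ (such as $1/\Lambda_\mu^{-1}(\lambda)$) is given the value $0$ at $\lambda=0$. *)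

theory Defs
  imports "HOL-Algebra.Generated_Groups" "HOL-Algebra.Coset" "HOL-Probability.Probability"
begin

section \<open>The Hilbert space of square-summable functions on a set\<close>

text \<open>Elements of \<open>\<ell>\<^sup>2(X)\<close> are complex functions on the ambient type that vanish outside \<open>X\<close>.\<close>

definition l2 :: "'a set \<Rightarrow> ('a \<Rightarrow> complex) set" where
  "l2 X = {f. (\<forall>x. x \<notin> X \<longrightarrow> f x = 0) \<and> (\<lambda>x. (cmod (f x))\<^sup>2) summable_on X}"

definition l2_inner :: "'a set \<Rightarrow> ('a \<Rightarrow> complex) \<Rightarrow> ('a \<Rightarrow> complex) \<Rightarrow> complex" where
  "l2_inner X f g = (\<Sum>\<^sub>\<infinity>x\<in>X. f x * cnj (g x))"

definition l2_norm :: "'a set \<Rightarrow> ('a \<Rightarrow> complex) \<Rightarrow> real" where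
  "l2_norm X f = sqrt (\<Sum>\<^sub>\<infinity>x\<in>X. (cmod (f x))\<^sup>2)"

definition delta_fun :: "'a \<Rightarrow> 'a \<Rightarrow> complex" where
  "delta_fun a = (\<lambda>x. if x = a then 1 else 0)"

text \<open>Operators are taken extensional (undefined off \<open>\<ell>\<^sup>2(X)\<close>), so that two operators which
  agree on \<open>\<ell>\<^sup>2(X)\<close> are equal.\<close>

definition l2_bounded_op ::
    "'a set \<Rightarrow> (('a \<Rightarrow> complex) \<Rightarrow> ('a \<Rightarrow> complex)) \<Rightarrow> bool" where
  "l2_bounded_op X A \<longleftrightarrow>
     A \<in> l2 X \<rightarrow>\<^sub>E l2 X \<and>
     (\<forall>f\<in>l2 X. \<forall>g\<in>l2 X. A (\<lambda>x. f x + g x) = (\<lambda>x. A f x + A g x)) \<and>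
     (\<forall>c. \<forall>f\<in>l2 X. A (\<lambda>x. c * f x) = (\<lambda>x. c * A f x)) \<and>
     (\<exists>C. \<forall>f\<in>l2 X. l2_norm X (A f) \<le> C * l2_norm X f)"


section \<open>Borel functional calculus of a bounded self-adjoint operator\<close>

text \<open>The spectral measure of \<open>A\<close> at \<open>f\<close>: the unique finite, compactly supported Borel measure
  \<open>\<nu>\<close> on the real line with \<open>\<integral> p d\<nu> = \<langle>p(A) f, f\<rangle>\<close> for all polynomials \<open>p\<close>; by linearity
  monomials suffice.\<close>

definition spectral_measure ::
    "'a set \<Rightarrow> (('a \<Rightarrow> complex) \<Rightarrow> ('a \<Rightarrow> complex)) \<Rightarrow> ('a \<Rightarrow> complex) \<Rightarrow> real measure" where
  "spectral_measure X A f = (THE \<nu>.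
     sets \<nu> = sets borel \<and> finite_measure \<nu> \<and>
     (\<exists>K. AE t in \<nu>. \<bar>t\<bar> \<le> K) \<and>
     (\<forall>n::nat. complex_of_real (\<integral>t. t ^ n \<partial>\<nu>) = l2_inner X ((A ^^ n) f) f))"

text \<open>\<open>\<phi>(A)\<close> for a bounded Borel function \<open>\<phi>\<close>: the unique bounded operator with
  \<open>\<langle>\<phi>(A) f, f\<rangle> = \<integral> \<phi> d\<nu>\<^sub>f\<close> for all \<open>f\<close>, where \<open>\<nu>\<^sub>f\<close> is the spectral measure of \<open>A\<close> at \<open>f\<close>.\<close>

definition borel_calculus ::
    "'a set \<Rightarrow> (real \<Rightarrow> real) \<Rightarrow> (('a \<Rightarrow> complex) \<Rightarrow> ('a \<Rightarrow> complex))
      \<Rightarrow> (('a \<Rightarrow> complex) \<Rightarrow> ('a \<Rightarrow> complex))" where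
  "borel_calculus X \<phi> A = (THE B. l2_bounded_op X B \<and>
     (\<forall>f\<in>l2 X. l2_inner X (B f) f = complex_of_real (\<integral>t. \<phi> t \<partial>spectral_measure X A f)))"

definition spectral_projection ::
    "'a set \<Rightarrow> (('a \<Rightarrow> complex) \<Rightarrow> ('a \<Rightarrow> complex)) \<Rightarrow> real
      \<Rightarrow> (('a \<Rightarrow> complex) \<Rightarrow> ('a \<Rightarrow> complex))" where
  "spectral_projection X A r = borel_calculus X (indicator {..r}) A"


section \<open>Finitely generated and amenable groups, admissible measures\<close>

definition finite_generating_set :: "('a, 'b) monoid_scheme \<Rightarrow> 'a set \<Rightarrow> bool" where
  "finite_generating_set G S \<longleftrightarrow> finite S \<and> S \<subseteq> carrier G \<and> generate G S = carrier G"

definition finitely_generated_group :: "('a, 'b) monoid_scheme \<Rightarrow> bool" where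
  "finitely_generated_group G \<longleftrightarrow> (\<exists>S. finite_generating_set G S)"

definition word_length :: "('a, 'b) monoid_scheme \<Rightarrow> 'a set \<Rightarrow> 'a \<Rightarrow> nat" where
  "word_length G S x = (LEAST n. \<exists>w. length w = n \<and> set w \<subseteq> S \<union> m_inv G ` S \<and>
     foldr (\<otimes>\<^bsub>G\<^esub>) w \<one>\<^bsub>G\<^esub> = x)"

text \<open>Existence of a left-invariant finitely additive probability measure on all subsets.\<close>

definition amenable_group :: "('a, 'b) monoid_scheme \<Rightarrow> bool" where
  "amenable_group G \<longleftrightarrow> (\<exists>m :: 'a set \<Rightarrow> real.
     (\<forall>A. A \<subseteq> carrier G \<longrightarrow> 0 \<le> m A) \<and> m (carrier G) = 1 \<and>
     (\<forall>A B. A \<subseteq> carrier G \<longrightarrow> B \<subseteq> carrier G \<longrightarrow> A \<inter> B = {} \<longrightarrow> m (A \<union> B) = m A + m B) \<and>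
     (\<forall>g\<in>carrier G. \<forall>A. A \<subseteq> carrier G \<longrightarrow> m (g <#\<^bsub>G\<^esub> A) = m A))"

definition admissible :: "('a, 'b) monoid_scheme \<Rightarrow> 'a pmf \<Rightarrow> bool" where
  "admissible G \<mu> \<longleftrightarrow>
     set_pmf \<mu> \<subseteq> carrier G \<and>
     (\<forall>\<gamma>\<in>carrier G. pmf \<mu> \<gamma> = pmf \<mu> (inv\<^bsub>G\<^esub> \<gamma>)) \<and>
     (\<exists>S. finite_generating_set G S \<and>
        integrable (measure_pmf \<mu>) (\<lambda>\<gamma>. (real (word_length G S \<gamma>))\<^sup>2)) \<and>
     (\<exists>S. finite_generating_set G S \<and> S \<subseteq> set_pmf \<mu>)"


section \<open>Laplace operator, spectral distribution and isoperimetric profile\<close>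

definition markov_op ::
    "('a, 'b) monoid_scheme \<Rightarrow> 'a pmf \<Rightarrow> (('a \<Rightarrow> complex) \<Rightarrow> ('a \<Rightarrow> complex))" where
  "markov_op G \<mu> = (\<lambda>f\<in>l2 (carrier G). \<lambda>x. if x \<in> carrier G
     then (\<Sum>\<^sub>\<infinity>\<gamma>\<in>carrier G. f (x \<otimes>\<^bsub>G\<^esub> inv\<^bsub>G\<^esub> \<gamma>) * complex_of_real (pmf \<mu> \<gamma>)) else 0)"

definition laplace_op ::
    "('a, 'b) monoid_scheme \<Rightarrow> 'a pmf \<Rightarrow> (('a \<Rightarrow> complex) \<Rightarrow> ('a \<Rightarrow> complex))" where
  "laplace_op G \<mu> = (\<lambda>f\<in>l2 (carrier G). \<lambda>x. f x - markov_op G \<mu> f x)"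

definition vn_trace ::
    "('a, 'b) monoid_scheme \<Rightarrow> (('a \<Rightarrow> complex) \<Rightarrow> ('a \<Rightarrow> complex)) \<Rightarrow> complex" where
  "vn_trace G A = l2_inner (carrier G) (A (delta_fun \<one>\<^bsub>G\<^esub>)) (delta_fun \<one>\<^bsub>G\<^esub>)"

text \<open>The trace of a projection and the quadratic form of \<open>\<Delta>\<^sub>\<mu>\<close> are real; \<^const>\<open>Re\<close> below only
  changes the type.\<close>

definition spectral_distribution :: "('a, 'b) monoid_scheme \<Rightarrow> 'a pmf \<Rightarrow> real \<Rightarrow> real" where
  "spectral_distribution G \<mu> r =
     Re (vn_trace G (spectral_projection (carrier G) (laplace_op G \<mu>) r))"

definition first_eigenvalue :: "('a, 'b) monoid_scheme \<Rightarrow> 'a pmf \<Rightarrow> 'a set \<Rightarrow> real" where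
  "first_eigenvalue G \<mu> \<Omega> =
     Inf {Re (l2_inner (carrier G) (laplace_op G \<mu> f) f) / (l2_norm (carrier G) f)\<^sup>2 | f.
            f \<in> l2 (carrier G) \<and> {x. f x \<noteq> 0} \<noteq> {} \<and> {x. f x \<noteq> 0} \<subseteq> \<Omega>}"

text \<open>Meaningful only for \<open>v \<ge> 1\<close>.\<close>

definition l2_isoperimetric_profile :: "('a, 'b) monoid_scheme \<Rightarrow> 'a pmf \<Rightarrow> real \<Rightarrow> real" where
  "l2_isoperimetric_profile G \<mu> v =
     Inf {first_eigenvalue G \<mu> \<Omega> | \<Omega>.
            \<Omega> \<subseteq> carrier G \<and> finite \<Omega> \<and> 1 \<le> card \<Omega> \<and> real (card \<Omega>) \<le> v}"


section \<open>Generalized inverse, doubling, dilatational comparison\<close>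

text \<open>\<open>D\<close> is the domain of the decreasing function \<open>L\<close>; meaningful only for \<open>x > inf L\<close>.\<close>

definition generalized_inverse :: "real set \<Rightarrow> (real \<Rightarrow> real) \<Rightarrow> real \<Rightarrow> real" where
  "generalized_inverse D L x = Inf {v \<in> D. L v \<le> x}"

definition doubling_near_infinity :: "(real \<Rightarrow> real) \<Rightarrow> bool" where
  "doubling_near_infinity g \<longleftrightarrow> (\<exists>c>0. \<exists>x0. \<forall>x\<ge>x0. g (2 * x) \<ge> c * g x)"

definition dil_le :: "(real \<Rightarrow> real) \<Rightarrow> (real \<Rightarrow> real) \<Rightarrow> bool" where
  "dil_le f g \<longleftrightarrow> (\<exists>D>0. \<exists>\<epsilon>>0. \<forall>r\<in>{0..<\<epsilon>}. f r \<le> g (D * r))"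

definition dil_equiv :: "(real \<Rightarrow> real) \<Rightarrow> (real \<Rightarrow> real) \<Rightarrow> bool" where
  "dil_equiv f g \<longleftrightarrow> dil_le f g \<and> dil_le g f"

end

theory Submission
  imports Defs
begin

text \<open>
  Let \<open>\<nu>\<close> be the spectral measure of \<open>\<Delta>\<close> at \<open>\<delta>\<^sub>e\<close>, so that \<open>N r = \<nu> {..r}\<close>, and let \<open>I\<close> be the generalized
  inverse of \<open>\<Lambda>\<close>.

  Lower bound: a test function \<open>f\<close> on at most \<open>2 I(r)\<close> points with Rayleigh quotient below \<open>2 r\<close> has at
  least half of its spectral mass in \<open>{..4 r}\<close>; by invariance of the trace this mass is at most
  \<open>|supp f| \<parallel>f\<parallel>\<^sup>2 N (4 r)\<close>. Hence \<open>N (4 r) \<ge> 1 / (4 I(r))\<close>.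

  Upper bound: truncation turns the Faber-Krahn inequality defining \<open>\<Lambda>\<close> into a Nash inequality, which
  forces \<open>u n = \<parallel>(1 - \<Delta>/2)^n \<delta>\<^sub>e\<parallel>\<^sup>2\<close> to satisfy \<open>u (n + 1) \<le> u n (1 - \<Lambda>(4 / u n) / 4)\<close>. Since
  \<open>N r \<le> exp (2 n r) u n\<close>, the choice \<open>n \<approx> ln V / (8 r)\<close> with \<open>V = I(32 r)\<close> gives \<open>N r \<le> C V powr (-3/4)\<close>.

  Doubling of \<open>\<Lambda> \<circ> exp\<close> gives \<open>I(c r) \<ge> I(r)\<^sup>2\<close> for small \<open>r\<close>, which absorbs the constants and the power.

  Amenability is needed for \<open>inf \<Lambda> = 0\<close>: if every finite set expanded, Hall's theorem would give a
  paradoxical decomposition. Spectral measures are obtained by solving the Hausdorff moment problem with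
  Bernstein weights.
\<close>

section \<open>Hall's marriage theorem for locally finite families\<close>

text \<open>\<open>spectral_measure\<close> and \<open>borel_calculus\<close> are definite
  descriptions, so \<open>spectral_distribution\<close> says nothing until existence and uniqueness
  of the moment measure and of the projection are known. Both are extracted from polynomials in the
  operator: Bernstein positivity gives existence, Weierstrass approximation gives uniqueness and the
  projection. For limits, square-summable functions are packed into a Hilbert space type with a real
  inner product; complex values come back through multiplication by the imaginary unit.

  The exponent 3/4 is a budget. The price exp (2 n r) is V powr (1/4) up to a constant, against the
  decay 4 / V. Any exponent strictly above 1/2 would serve: the excess swallows the constant, and V
  powr (-1/2) is what the squaring property of the inverse compensates.

  The comparison includes the point 0, where the right-hand side is 0 by convention. Hence N 0 = 0
  has to be shown, which needs the inverse to be unbounded near 0, that is, strict positivity of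
  \<Lambda>; infinitude of the group enters there.\<close>

text \<open>Rado's argument: in a minimal subfamily that still satisfies Hall's condition every set is a
  singleton.\<close>

lemma hall_injection:
  fixes N :: "'i \<Rightarrow> 'b set"
  assumes fin: "\<And>i. i \<in> I \<Longrightarrow> finite (N i)"
    and hall: "\<And>F. finite F \<Longrightarrow> F \<subseteq> I \<Longrightarrow> card F \<le> card (\<Union>i\<in>F. N i)"
  shows "\<exists>h. inj_on h I \<and> (\<forall>i\<in>I. h i \<in> N i)"
proof -
  define S where "S = Sigma I N"
  define H where "H R \<longleftrightarrow> (\<forall>F. finite F \<longrightarrow> F \<subseteq> I \<longrightarrow> card F \<le> card (R `` F))" for R :: "('i \<times> 'b) set"
  \<comment> \<open>\<open>C\<close> collects deleted edges. Deletion sets grow along a chain, so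
    Zorn yields a maximal one, whose complement is a minimal relation satisfying Hall's
    condition.\<close>
  define \<A> where "\<A> = {C. C \<subseteq> S \<and> H (S - C)}"
  have SF: "S `` F = (\<Union>i\<in>F. N i)" if "F \<subseteq> I" for F
    using that unfolding S_def by auto
  have finS: "finite (R `` F)" if "finite F" "F \<subseteq> I" "R \<subseteq> S" for R F
  proof (rule finite_subset)
    show "R `` F \<subseteq> (\<Union>i\<in>F. N i)" using that SF[of F] by blast
    show "finite (\<Union>i\<in>F. N i)" using that fin by auto
  qed
  have "\<exists>M\<in>\<A>. \<forall>X\<in>\<A>. M \<subseteq> X \<longrightarrow> X = M"
  proof (rule subset_Zorn)
    fix C assume ch: "subset.chain \<A> C"
    show "\<exists>U\<in>\<A>. \<forall>X\<in>C. X \<subseteq> U"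
    proof (cases "C = {}")
      case True
      have "{} \<in> \<A>" using hall SF by (auto simp: \<A>_def H_def)
      then show ?thesis using True by blast
    next
      case False
      have "\<Union>C \<in> \<A>"
      proof -
        have "card F \<le> card ((S - \<Union>C) `` F)" if F: "finite F" "F \<subseteq> I" for F
        proof -
          \<comment> \<open>Local finiteness enters: only finitely many edges leave
            \<open>F\<close>, so a single member \<open>c\<close> of the chain already contains
            every edge at \<open>F\<close> deleted by the union.\<close>
          have "finite (Sigma F N)" using F fin by auto
          then have "finite (Sigma F N \<inter> \<Union>C)" by simp
          then obtain c where c: "c \<in> C" "Sigma F N \<inter> \<Union>C \<subseteq> c"
            using finite_subset_Union_chain[of "Sigma F N \<inter> \<Union>C" C \<A>] False ch by auto
          have "(S - \<Union>C) `` F = (S - c) `` F"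
            using c F unfolding S_def by blast
          moreover have "H (S - c)" using c ch by (auto simp: subset.chain_def \<A>_def)
          ultimately show ?thesis using F by (simp add: H_def)
        qed
        moreover have "\<Union>C \<subseteq> S" using ch by (auto simp: subset.chain_def \<A>_def)
        ultimately show ?thesis by (simp add: \<A>_def H_def)
      qed
      then show ?thesis by blast
    qed
  qed
  then obtain M where MA: "M \<in> \<A>" and max: "\<forall>X\<in>\<A>. M \<subseteq> X \<longrightarrow> X = M"
    by (rule bexE)
  have M: "M \<subseteq> S" "H (S - M)" using MA by (auto simp: \<A>_def)
  define R where "R = S - M"
  have RS: "R \<subseteq> S" and HR: "\<And>F. finite F \<Longrightarrow> F \<subseteq> I \<Longrightarrow> card F \<le> card (R `` F)"
    using M unfolding R_def H_def by auto
  \<comment> \<open>Minimality makes every edge critical: without (i, a) Hall's condition fails at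
    some finite set, which must contain i; dropping i from that set turns the strict inequality into
    this bound.\<close>
  have remove: "\<exists>F. finite F \<and> F \<subseteq> I - {i} \<and> card (R `` F \<union> (R `` {i} - {a})) \<le> card F"
    if ia: "(i, a) \<in> R" for i a
  proof -
    have "insert (i,a) M \<notin> \<A>"
    proof
      assume "insert (i,a) M \<in> \<A>"
      then have "insert (i,a) M = M" using max[rule_format, OF _ subset_insertI] by simp
      then show False using ia unfolding R_def by blast
    qed
    then have "\<not> H (S - insert (i,a) M)" using ia M RS by (auto simp: \<A>_def)
    then obtain F where F: "finite F" "F \<subseteq> I" "card ((S - insert (i,a) M) `` F) < card F"
      unfolding H_def by (auto simp: not_le)
    have eq: "S - insert (i,a) M = R - {(i,a)}" unfolding R_def by blast
    have iF: "i \<in> F"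
    proof (rule ccontr)
      assume "i \<notin> F"
      then have "(R - {(i,a)}) `` F = R `` F" by blast
      then show False using F HR[of F] eq by simp
    qed
    let ?F = "F - {i}"
    have "R `` ?F \<union> (R `` {i} - {a}) = (R - {(i,a)}) `` F" using iF by blast
    then have "card (R `` ?F \<union> (R `` {i} - {a})) < card F" using F eq by simp
    also have "card F = Suc (card ?F)" using card_Suc_Diff1[OF F(1) iF] by simp
    finally show ?thesis using F by (intro exI[of _ ?F]) auto
  qed
  \<comment> \<open>Submodularity of cardinality. For two edges at i with critical sets F and G, the
    union of the two neighbourhoods has at least |F \<union> G| + 1 points and their intersection at
    least |F \<inter> G|, whereas their sizes add up to at most |F| + |G|.\<close>
  have single: "a = b" if ia: "(i, a) \<in> R" and ib: "(i, b) \<in> R" for i a b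
  proof (rule ccontr)
    assume ne: "a \<noteq> b"
    have iI: "i \<in> I" using ia RS S_def by auto
    obtain F where F: "finite F" "F \<subseteq> I - {i}" "card (R `` F \<union> (R `` {i} - {a})) \<le> card F"
      using remove[OF ia] by blast
    obtain G where G: "finite G" "G \<subseteq> I - {i}" "card (R `` G \<union> (R `` {i} - {b})) \<le> card G"
      using remove[OF ib] by blast
    let ?X = "R `` F \<union> (R `` {i} - {a})" and ?Y = "R `` G \<union> (R `` {i} - {b})"
    have finX: "finite ?X" "finite ?Y"
      using finS[of F R] finS[of G R] finS[of "{i}" R] F G iI RS by auto
    have "?X \<union> ?Y = R `` (insert i (F \<union> G))" using ne by blast
    then have "card (insert i (F \<union> G)) \<le> card (?X \<union> ?Y)"
      using HR[of "insert i (F \<union> G)"] F(1,2) G(1,2) iI by (simp add: subset_Diff_insert)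
    moreover have "card (insert i (F \<union> G)) = Suc (card (F \<union> G))"
      using F G by (subst card_insert_disjoint) auto
    moreover have "card (F \<inter> G) \<le> card (?X \<inter> ?Y)"
    proof -
      have "card (F \<inter> G) \<le> card (R `` (F \<inter> G))" using HR[of "F \<inter> G"] F by auto
      also have "\<dots> \<le> card (?X \<inter> ?Y)" using finX by (intro card_mono) auto
      finally show ?thesis .
    qed
    moreover have "card ?X + card ?Y = card (?X \<union> ?Y) + card (?X \<inter> ?Y)"
      using finX by (rule card_Un_Int)
    moreover have "card F + card G = card (F \<union> G) + card (F \<inter> G)"
      using F G by (intro card_Un_Int) auto
    ultimately show False using F(3) G(3) by linarith
  qed
  have "\<exists>a. (i, a) \<in> R" if "i \<in> I" for i
  proof -
    have "0 < card (R `` {i})" using HR[of "{i}"] that by auto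
    then have "R `` {i} \<noteq> {}" by (metis card.empty less_irrefl)
    then show ?thesis by blast
  qed
  then obtain h where h: "\<And>i. i \<in> I \<Longrightarrow> (i, h i) \<in> R" by metis
  have "inj_on h I"
  proof (rule inj_onI, rule ccontr)
    fix i j assume ij: "i \<in> I" "j \<in> I" "h i = h j" "i \<noteq> j"
    have "R `` {i, j} \<subseteq> {h i}" using single h[OF ij(1)] h[OF ij(2)] ij(3) by auto
    then have "card (R `` {i,j}) \<le> card {h i}" by (intro card_mono) auto
    then show False using HR[of "{i,j}"] ij by simp
  qed
  moreover have "h i \<in> N i" if "i \<in> I" for i using h[OF that] RS unfolding S_def by auto
  ultimately show ?thesis by blast
qed

section \<open>Spectral measures of positive operators\<close>

lemma integral_poly_moments:
  fixes p :: "real poly"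
  assumes "sets \<nu> = sets borel" "finite_measure \<nu>" "AE t in \<nu>. \<bar>t\<bar> \<le> K"
  shows "integrable \<nu> (poly p)"
    and "(\<integral>t. poly p t \<partial>\<nu>) = (\<Sum>i\<le>degree p. coeff p i * (\<integral>t. t ^ i \<partial>\<nu>))"
proof -
  interpret finite_measure \<nu> by fact
  have meas[measurable]: "(\<lambda>t. t ^ n) \<in> borel_measurable \<nu>" for n :: nat
    by (subst measurable_cong_sets[OF assms(1) refl]) simp
  have int: "integrable \<nu> (\<lambda>t. t ^ n)" for n
  proof (rule integrable_const_bound)
    show "AE t in \<nu>. norm (t ^ n) \<le> K ^ n"
      using assms(3) by eventually_elim (auto simp: power_abs intro: power_mono)
  qed simp
  have p: "poly p = (\<lambda>t. \<Sum>i\<le>degree p. coeff p i * t ^ i)" by (auto simp: poly_altdef)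
  show "integrable \<nu> (poly p)" unfolding p using int by (intro Bochner_Integration.integrable_sum) auto
  show "(\<integral>t. poly p t \<partial>\<nu>) = (\<Sum>i\<le>degree p. coeff p i * (\<integral>t. t ^ i \<partial>\<nu>))"
    unfolding p using int by (subst Bochner_Integration.integral_sum) auto
qed

text \<open>Horner's scheme, matched to \<open>pCons\<close> so that the algebra below runs by
  induction on polynomials.\<close>

definition poly_op :: "('h::real_vector \<Rightarrow> 'h) \<Rightarrow> real poly \<Rightarrow> 'h \<Rightarrow> 'h" where
  "poly_op A p = fold_coeffs (\<lambda>a T x. a *\<^sub>R x + A (T x)) p (\<lambda>x. 0)"

lemma poly_op_0 [simp]: "poly_op A 0 x = 0"
  by (simp add: poly_op_def)

locale symmetric_op =
  fixes A :: "'h::real_inner \<Rightarrow> 'h"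
  assumes bounded_linear: "bounded_linear A"
    and symmetric: "inner (A x) y = inner x (A y)"
begin

lemma linear: "linear A"
  using bounded_linear by (rule bounded_linear.linear)

lemmas lin_simps = linear_add[OF linear] linear_scale[OF linear] linear_0[OF linear]
  linear_diff[OF linear]

lemma poly_op_pCons [simp]: "poly_op A (pCons a p) x = a *\<^sub>R x + A (poly_op A p x)"
  by (cases "p = 0 \<and> a = 0") (auto simp: poly_op_def lin_simps)

lemma poly_op_add: "poly_op A (p + q) x = poly_op A p x + poly_op A q x"
  by (induction p q rule: poly_induct2) (auto simp: lin_simps scaleR_add_left)

lemma poly_op_smult: "poly_op A (smult c p) x = c *\<^sub>R poly_op A p x"
  by (induction p) (auto simp: lin_simps scaleR_add_right)

lemma poly_op_diff: "poly_op A (p - q) x = poly_op A p x - poly_op A q x"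
  using poly_op_add[of p "smult (-1) q" x] unfolding poly_op_smult by simp

lemma poly_op_sum: "poly_op A (sum f I) x = (\<Sum>i\<in>I. poly_op A (f i) x)"
  by (induction I rule: infinite_finite_induct) (auto simp: poly_op_add)

lemma poly_op_mult: "poly_op A (p * q) x = poly_op A p (poly_op A q x)"
  by (induction p) (auto simp: poly_op_add poly_op_smult)

lemma poly_op_1 [simp]: "poly_op A 1 x = x"
  using poly_op_pCons[of 1 0 x] by (simp add: lin_simps one_pCons)

lemma poly_op_commute:
  assumes "linear C" "\<And>y. A (C y) = C (A y)"
  shows "poly_op A p (C x) = C (poly_op A p x)"
  by (induction p) (auto simp: linear_0[OF assms(1)] linear_add[OF assms(1)]
     linear_scale[OF assms(1)] assms(2))

lemma poly_op_power: "poly_op A ([:a, b:] ^ n) x = ((\<lambda>y. a *\<^sub>R y + b *\<^sub>R A y) ^^ n) x"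
  by (induction n arbitrary: x) (auto simp: poly_op_mult lin_simps scaleR_add_right algebra_simps
       simp del: mult_pCons_left)

lemma poly_op_monom: "poly_op A (monom 1 n) x = (A ^^ n) x"
  using poly_op_power[of 0 1 n x] by (simp add: monom_altdef)

lemma bounded_linear_poly_op: "bounded_linear (poly_op A p)"
proof (induction p)
  case 0
  then show ?case by (simp add: bounded_linear_zero)
next
  case (pCons a p)
  have "bounded_linear (\<lambda>x. a *\<^sub>R x + A (poly_op A p x))"
    by (intro bounded_linear_add bounded_linear_scaleR_right bounded_linear_compose[OF bounded_linear] pCons)
  moreover have "poly_op A (pCons a p) = (\<lambda>x. a *\<^sub>R x + A (poly_op A p x))" by auto
  ultimately show ?case by simp
qed

lemma poly_op_symmetric: "inner (poly_op A p x) y = inner x (poly_op A p y)"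
proof (induction p arbitrary: x y)
  case (pCons a p)
  have "A (poly_op A p y) = poly_op A p (A y)" for y
    using poly_op_commute[OF linear, of p y] by simp
  then show ?case using pCons by (simp add: inner_add_left inner_add_right symmetric)
qed simp

lemma inner_poly_op_square: "inner (poly_op A (p * p) x) x = (norm (poly_op A p x))\<^sup>2"
  by (simp add: poly_op_mult poly_op_symmetric power2_norm_eq_inner)

text \<open>A predicate rather than the definite description: it is usable before existence and
  uniqueness are settled, and it records support in [0, K], where the description has only an
  unspecified bound.\<close>

definition spectral_at :: "real \<Rightarrow> 'h \<Rightarrow> real measure \<Rightarrow> bool" where
  "spectral_at K x \<nu> \<longleftrightarrow> sets \<nu> = sets borel \<and> finite_measure \<nu> \<and> (AE t in \<nu>. 0 \<le> t \<and> t \<le> K) \<and>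
     (\<forall>n::nat. (\<integral>t. t ^ n \<partial>\<nu>) = inner ((A ^^ n) x) x)"

lemma spectral_at_bounded: "spectral_at K x \<nu> \<Longrightarrow> AE t in \<nu>. \<bar>t\<bar> \<le> K"
  by (auto simp: spectral_at_def)

lemma integral_poly_spectral:
  assumes "spectral_at K x \<nu>"
  shows "(\<integral>t. poly p t \<partial>\<nu>) = inner (poly_op A p x) x"
proof -
  have "(\<integral>t. poly p t \<partial>\<nu>) = (\<Sum>i\<le>degree p. coeff p i * (\<integral>t. t ^ i \<partial>\<nu>))"
    using integral_poly_moments(2)[OF _ _ spectral_at_bounded[OF assms]] assms
    by (simp add: spectral_at_def)
  also have "\<dots> = (\<Sum>i\<le>degree p. inner (poly_op A (smult (coeff p i) (monom 1 i)) x) x)"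
    using assms by (simp add: spectral_at_def poly_op_smult poly_op_monom)
  also have "\<dots> = inner (poly_op A (\<Sum>i\<le>degree p. smult (coeff p i) (monom 1 i)) x) x"
    by (simp add: poly_op_sum inner_sum_left)
  also have "(\<Sum>i\<le>degree p. smult (coeff p i) (monom 1 i)) = p"
    by (simp add: smult_monom poly_as_sum_of_monoms)
  finally show ?thesis .
qed

end

text \<open>This is the d-th factorial moment of a binomial distribution with success probability
  \<open>Y\<close>: after (N choose k)(k choose d) = (N choose d)(N - d choose k - d) only the
  binomial theorem for Y + (1 - Y) = 1 remains. It is stated over a ring because \<open>Y\<close>
  will be a polynomial.\<close>

lemma bernstein_factorial_moment:
  fixes Y :: "'a::comm_ring_1"
  assumes "d \<le> N"
  shows "(\<Sum>k\<le>N. of_nat (N choose k) * of_nat (k choose d) * (Y ^ k * (1 - Y) ^ (N - k)))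
    = of_nat (N choose d) * Y ^ d"
proof -
  have "(\<Sum>k\<le>N. of_nat (N choose k) * of_nat (k choose d) * (Y ^ k * (1 - Y) ^ (N - k)))
    = (\<Sum>k\<in>{d..N}. of_nat (N choose k) * of_nat (k choose d) * (Y ^ k * (1 - Y) ^ (N - k)))"
    by (rule sum.mono_neutral_right) (auto simp: binomial_eq_0)
  also have "\<dots> = (\<Sum>j\<le>N - d. of_nat (N choose d) * Y ^ d * (of_nat ((N - d) choose j) * Y ^ j * (1 - Y) ^ (N - d - j)))"
  proof (rule sum.reindex_bij_witness[of _ "\<lambda>j. j + d" "\<lambda>k. k - d"])
    fix k assume k: "k \<in> {d..N}"
    have "(N choose k) * (k choose d) = (N choose d) * ((N - d) choose (k - d))"
      using k by (intro choose_mult) auto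
    then have e: "of_nat (N choose k) * of_nat (k choose d)
       = (of_nat (N choose d) * of_nat ((N - d) choose (k - d)) :: 'a)"
      by (metis of_nat_mult)
    have "Y ^ k = Y ^ d * Y ^ (k - d)" using k by (simp flip: power_add)
    then show "of_nat (N choose d) * Y ^ d * (of_nat (N - d choose (k - d)) * Y ^ (k - d) * (1 - Y) ^ (N - d - (k - d)))
       = of_nat (N choose k) * of_nat (k choose d) * (Y ^ k * (1 - Y) ^ (N - k))"
      unfolding e using k by (simp add: mult_ac)
  qed (use assms in auto)
  also have "\<dots> = of_nat (N choose d) * Y ^ d * (Y + (1 - Y)) ^ (N - d)"
    unfolding binomial_ring sum_distrib_left by simp
  finally show ?thesis by simp
qed

text \<open>Turns factorial moments into power moments: both terms are products of d factors of
  modulus at most 1, so their difference is bounded by the sum of the d differences of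
  factors.\<close>

lemma binomial_ratio_approx:
  assumes "k \<le> N" "2 * d < N"
  shows "\<bar>real (k choose d) / real (N choose d) - (real k / real N) ^ d\<bar> \<le> real d * (real d / real (N - d))"
proof -
  have eq: "real (k choose d) / real (N choose d) = (\<Prod>i<d. (real k - real i) / (real N - real i))"
    by (simp add: binomial_gbinomial gbinomial_prod_rev prod_dividef atLeast0LessThan)
  have "norm ((\<Prod>i<d. (real k - real i) / (real N - real i)) - (\<Prod>i<d. real k / real N))
     \<le> (\<Sum>i<d. norm ((real k - real i) / (real N - real i) - real k / real N))"
  proof (rule norm_prod_diff)
    fix i assume "i \<in> {..<d}"
    then have i: "i < d" by simp
    \<comment> \<open>The numerator may be negative when k < i; \<open>2 * d < N\<close> still
      bounds its modulus by N - i.\<close>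
    have "\<bar>real k - real i\<bar> \<le> real N - real i" using assms i by linarith
    moreover have "real N - real i > 0" using assms i by linarith
    ultimately show "norm ((real k - real i) / (real N - real i)) \<le> 1" by (simp add: divide_le_eq)
    show "norm (real k / real N) \<le> 1" using assms by (simp add: divide_le_eq)
  qed
  also have "\<dots> \<le> (\<Sum>i<d. real d / real (N - d))"
  proof (rule sum_mono)
    fix i assume "i \<in> {..<d}"
    then have i: "i < d" by simp
    have pos: "real N > 0" "real N - real i > 0" "real (N - d) > 0" using assms i by auto
    have "(real k - real i) / (real N - real i) - real k / real N
       = - (real i * ((real N - real k) / real N) / (real N - real i))"
      using pos by (simp add: field_simps)
    then have "norm ((real k - real i) / (real N - real i) - real k / real N)
       = real i * ((real N - real k) / real N) / (real N - real i)"
      using pos assms by simp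
    also have "\<dots> \<le> real d * 1 / real (N - d)"
      using pos assms i by (intro frac_le mult_mono) auto
    finally show "norm ((real k - real i) / (real N - real i) - real k / real N) \<le> real d / real (N - d)" by simp
  qed
  finally show ?thesis unfolding eq by simp
qed

section \<open>The moment measure of an operator between 0 and K\<close>

locale positive_op = symmetric_op A for A :: "'h::real_inner \<Rightarrow> 'h" +
  fixes K :: real
  assumes K_pos: "0 < K"
    and nonneg: "0 \<le> inner (A x) x"
    and upper: "inner (A x) x \<le> K * inner x x"
begin

definition Y :: "real poly" where "Y = [:0, 1 / K:]"

lemma poly_Y: "poly_op A Y x = (1 / K) *\<^sub>R A x"
  by (simp add: Y_def lin_simps)

text \<open>By parity of the exponents the polynomial is a square times 1, Y, 1 - Y or Y (1 - Y).
  The bounds 0 \<le> A \<le> K handle Y and 1 - Y, and Y (1 - Y) = Y (1 - Y)^2 + (1 - Y) Y^2 handles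
  the last case, so a product of commuting positive operators is seen to be positive without square
  roots.\<close>

lemma bernstein_nonneg: "0 \<le> inner (poly_op A (Y ^ k * (1 - Y) ^ j) x) x"
proof -
  have comm: "inner (poly_op A (q * (p * p)) x) x = inner (poly_op A q (poly_op A p x)) (poly_op A p x)" for p q
  proof -
    have "q * (p * p) = p * (q * p)" by (simp add: mult_ac)
    then have "poly_op A (q * (p * p)) x = poly_op A p (poly_op A q (poly_op A p x))"
      by (simp only: poly_op_mult)
    then show ?thesis by (simp only: poly_op_symmetric[of p])
  qed
  have Y: "0 \<le> inner (poly_op A (Y * (p * p)) x) x" for p
    unfolding comm using K_pos nonneg by (simp add: poly_Y)
  have Z: "0 \<le> inner (poly_op A ((1 - Y) * (p * p)) x) x" for p
    unfolding comm using K_pos upper[of "poly_op A p x"]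
    by (simp add: poly_op_diff poly_Y inner_diff_left field_simps)
  have E: "0 \<le> inner (poly_op A (p * p) x) x" for p
    by (simp add: inner_poly_op_square)
  have YZ: "0 \<le> inner (poly_op A (Y * (1 - Y) * (p * p)) x) x" for p
  proof -
    have "Y * (1 - Y) * (p * p) = Y * (((1 - Y) * p) * ((1 - Y) * p)) + (1 - Y) * ((Y * p) * (Y * p))"
      by (simp add: algebra_simps)
    then show ?thesis using Y Z by (simp add: poly_op_add inner_add_left)
  qed
  define p where "p = Y ^ (k div 2) * (1 - Y) ^ (j div 2)"
  have k: "Y ^ k = Y ^ (k mod 2) * (Y ^ (k div 2) * Y ^ (k div 2))"
    by (simp flip: power_add) (metis mod_mult_div_eq mult_2)
  have j: "(1 - Y) ^ j = (1 - Y) ^ (j mod 2) * ((1 - Y) ^ (j div 2) * (1 - Y) ^ (j div 2))"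
    by (simp flip: power_add) (metis mod_mult_div_eq mult_2)
  have "Y ^ k * (1 - Y) ^ j = (Y ^ (k mod 2) * (1 - Y) ^ (j mod 2)) * (p * p)"
    unfolding k j p_def by (simp add: mult_ac)
  moreover have "k mod 2 = 0 \<or> k mod 2 = 1" "j mod 2 = 0 \<or> j mod 2 = 1" by auto
  ultimately show ?thesis using E[of p] Y[of p] Z[of p] YZ[of p] by auto
qed

end

context positive_op
begin

text \<open>The Bernstein weights of \<open>x\<close> on the grid \<open>K k / N\<close> have exactly the right factorial moments; Helly's
  theorem extracts a limit measure with the right moments.\<close>

lemma moment_measure_normalized:
  assumes x: "inner x x = 1"
  shows "\<exists>\<nu>. real_distribution \<nu> \<and> (AE t in \<nu>. 0 \<le> t \<and> t \<le> K) \<and>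
     (\<forall>n::nat. (\<integral>t. t ^ n \<partial>\<nu>) = inner ((A ^^ n) x) x)"
proof -
  note [simp del] = sum.atMost_Suc
  define w where "w N k = real (N choose k) * inner (poly_op A (Y ^ k * (1 - Y) ^ (N - k)) x) x" for N k
  have w0: "0 \<le> w N k" for N k using bernstein_nonneg by (simp add: w_def)
  have wmom: "(\<Sum>k\<le>N. w N k * real (k choose d)) = real (N choose d) * inner (poly_op A (Y ^ d) x) x"
    if "d \<le> N" for N d
  proof -
    have scal: "of_nat n * p = smult (real n) p" for n and p :: "real poly"
      by (simp add: of_nat_poly)
    have "(\<Sum>k\<le>N. w N k * real (k choose d))
      = inner (poly_op A (\<Sum>k\<le>N. of_nat (N choose k) * of_nat (k choose d) * (Y ^ k * (1 - Y) ^ (N - k))) x) x"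
      unfolding poly_op_sum inner_sum_left
      by (rule sum.cong) (simp_all add: w_def mult.assoc scal poly_op_smult)
    also have "\<dots> = real (N choose d) * inner (poly_op A (Y ^ d) x) x"
      unfolding bernstein_factorial_moment[OF that] by (simp add: scal poly_op_smult)
    finally show ?thesis .
  qed
  have wsum: "(\<Sum>k\<le>N. w N k) = 1" for N using wmom[of 0 N] x by simp
  define P where "P N = embed_pmf (\<lambda>k. if k \<le> N then w N k else 0)" for N
  have pmfP: "pmf (P N) k = (if k \<le> N then w N k else 0)" for N k
    unfolding P_def
  proof (rule pmf_embed_pmf)
    have "(\<integral>\<^sup>+ k. ennreal (if k \<le> N then w N k else 0) \<partial>count_space UNIV)
       = (\<Sum>k\<in>{..N}. ennreal (if k \<le> N then w N k else 0))"
      by (rule nn_integral_count_space') auto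
    also have "\<dots> = ennreal (\<Sum>k\<le>N. w N k)" using w0 by (subst sum_ennreal[symmetric]) auto
    finally show "(\<integral>\<^sup>+ k. ennreal (if k \<le> N then w N k else 0) \<partial>count_space UNIV) = 1"
      by (simp add: wsum)
  qed (use w0 in auto)
  define g where "g N k = K * (real k / real N)" for N k :: nat
  \<comment> \<open>The index is shifted to \<open>Suc N\<close> so that the grid
    \<open>K * (k / N)\<close> never divides by zero.\<close>
  define M where "M N = distr (measure_pmf (P (Suc N))) borel (g (Suc N))" for N
  have rdM: "real_distribution (M N)" for N
    unfolding M_def by (rule prob_space.real_distribution_distr[OF measure_pmf.prob_space_axioms]) simp
  have intM: "(\<integral>t. f t \<partial>M N) = (\<Sum>k\<le>Suc N. w (Suc N) k * f (g (Suc N) k))"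
    if "f \<in> borel_measurable borel" for f :: "real \<Rightarrow> real" and N
  proof -
    have "(\<integral>t. f t \<partial>M N) = (\<integral>k. f (g (Suc N) k) \<partial>measure_pmf (P (Suc N)))"
      unfolding M_def by (subst integral_distr) (use that in auto)
    also have "\<dots> = (\<Sum>k\<in>{..Suc N}. f (g (Suc N) k) * pmf (P (Suc N)) k)"
      by (rule integral_measure_pmf_real) (auto simp: set_pmf_iff pmfP split: if_splits)
    also have "\<dots> = (\<Sum>k\<le>Suc N. w (Suc N) k * f (g (Suc N) k))"
      by (rule sum.cong) (auto simp: pmfP)
    finally show ?thesis .
  qed
  have g: "0 \<le> g (Suc N) k" "g (Suc N) k \<le> K" if "k \<le> Suc N" for N k
    unfolding g_def using K_pos that mult_left_mono[of "real k / real (Suc N)" 1 K]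
    by (auto simp: divide_le_eq)
  have tight: "tight M"
    unfolding tight_def
  proof (intro conjI allI impI rdM)
    fix \<epsilon> :: real assume "0 < \<epsilon>"
    \<comment> \<open>The left end -1 lies strictly below the grid point 0, as the interval in
      \<open>tight\<close> is open on the left.\<close>
    have "measure (M N) {-1<..K} = 1" for N
    proof -
      interpret real_distribution "M N" by (rule rdM)
      have "measure (M N) {-1<..K} = (\<integral>t. indicator {-1<..K} t \<partial>M N)" by simp
      also have "\<dots> = (\<Sum>k\<le>Suc N. w (Suc N) k * indicator {-1<..K} (g (Suc N) k))"
        by (rule intM) simp
      also have "\<dots> = (\<Sum>k\<le>Suc N. w (Suc N) k)"
      proof (rule sum.cong)
        fix k assume "k \<in> {..Suc N}"
        then show "w (Suc N) k * indicator {-1<..K} (g (Suc N) k) = w (Suc N) k"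
          using g[of k N] by (auto simp: indicator_def)
      qed simp
      finally show ?thesis using wsum by simp
    qed
    then show "\<exists>a b. a < b \<and> (\<forall>n. 1 - \<epsilon> < measure (M n) {a<..b})"
      using \<open>0 < \<epsilon>\<close> K_pos by (intro exI[of _ "-1"] exI[of _ K]) auto
  qed
  obtain r \<nu> where r: "strict_mono r" and rd: "real_distribution \<nu>" and wc: "weak_conv_m (M \<circ> id \<circ> r) \<nu>"
    using tight_imp_convergent_subsubsequence[OF tight, of id] by (auto simp: strict_mono_def)
  interpret \<nu>: real_distribution \<nu> by fact
  have conv: "(\<lambda>n. \<integral>t. f t \<partial>M (r n)) \<longlonglongrightarrow> (\<integral>t. f t \<partial>\<nu>)"
    if "\<And>t. isCont f t" "\<And>t. \<bar>f t\<bar> \<le> B" for f :: "real \<Rightarrow> real" and B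
    using weak_conv_imp_integral_bdd_continuous_conv[OF _ rd wc, of f B] rdM that by simp
  \<comment> \<open>Distance to [0, K] cut off at 1: bounded and continuous, hence its vanishing
    integral survives the weak limit and pins down the support.\<close>
  define dist0 where "dist0 t = min 1 \<bar>t - max 0 (min K t)\<bar>" for t
  have AE: "AE t in \<nu>. 0 \<le> t \<and> t \<le> K"
  proof -
    have meas[measurable]: "dist0 \<in> borel_measurable borel" unfolding dist0_def by simp
    have "(\<lambda>n. \<integral>t. dist0 t \<partial>M (r n)) \<longlonglongrightarrow> (\<integral>t. dist0 t \<partial>\<nu>)"
      by (rule conv[of _ 1]) (auto simp: dist0_def intro!: continuous_intros)
    moreover have "(\<integral>t. dist0 t \<partial>M N) = 0" for N
      unfolding intM[OF meas] using g by (intro sum.neutral) (auto simp: dist0_def)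
    ultimately have "(\<lambda>n. 0) \<longlonglongrightarrow> (\<integral>t. dist0 t \<partial>\<nu>)" by simp
    then have "(\<integral>t. dist0 t \<partial>\<nu>) = 0" by (simp add: tendsto_const_iff)
    moreover have "integrable \<nu> dist0"
      by (rule \<nu>.integrable_const_bound[of _ 1]) (auto simp: dist0_def)
    ultimately have "AE t in \<nu>. dist0 t = 0"
      by (subst (asm) integral_nonneg_eq_0_iff_AE) (auto simp: dist0_def)
    then show ?thesis by eventually_elim (use K_pos in \<open>auto simp: dist0_def min_def max_def split: if_splits\<close>)
  qed
  have mom: "(\<integral>t. t ^ d \<partial>\<nu>) = inner ((A ^^ d) x) x" for d
  proof -
    \<comment> \<open>Powers are unbounded on the line, so weak convergence is applied to the power
      of the argument clamped to [0, K]; all measures involved live there.\<close>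
    have meas: "(\<lambda>t::real. (max 0 (min K t)) ^ d) \<in> borel_measurable borel" by simp
    have "(\<lambda>n. \<integral>t. (max 0 (min K t)) ^ d \<partial>M (r n)) \<longlonglongrightarrow> (\<integral>t. (max 0 (min K t)) ^ d \<partial>\<nu>)"
      using K_pos by (intro conv[of _ "K ^ d"]) (auto intro!: continuous_intros power_mono simp: power_abs)
    moreover have "(\<integral>t. (max 0 (min K t)) ^ d \<partial>\<nu>) = (\<integral>t. t ^ d \<partial>\<nu>)"
      using AE by (intro integral_cong_AE) auto
    moreover have "(\<lambda>N. \<integral>t. (max 0 (min K t)) ^ d \<partial>M N) \<longlonglongrightarrow> inner ((A ^^ d) x) x"
    proof (rule Lim_transform_eventually)
      define m where "m = inner (poly_op A (Y ^ d) x) x"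
      define e where "e N = (\<integral>t. (max 0 (min K t)) ^ d \<partial>M N) - K ^ d * m" for N
      have m: "K ^ d * m = inner ((A ^^ d) x) x"
      proof -
        have "smult (K ^ d) (Y ^ d) = monom 1 d"
          using K_pos by (simp add: Y_def monom_altdef flip: smult_power)
        then have "K ^ d *\<^sub>R poly_op A (Y ^ d) x = (A ^^ d) x"
          by (metis poly_op_smult poly_op_monom)
        then show ?thesis unfolding m_def by (metis inner_scaleR_left)
      qed
      \<comment> \<open>The discrete integral carries (k / N)^d where the exact identity has (k
        choose d) / (N choose d). The weights are nonnegative with sum 1, so the pointwise estimate
        of the ratio bounds the error.\<close>
      have e: "\<bar>e N\<bar> \<le> K ^ d * (real d * (real d / real (Suc N - d)))" if N: "2 * d < Suc N" for N
      proof -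
        let ?N = "Suc N"
        have pos: "real (?N choose d) > 0" using N by simp
        have "(\<integral>t. (max 0 (min K t)) ^ d \<partial>M N) = (\<Sum>k\<le>?N. w ?N k * (max 0 (min K (g ?N k))) ^ d)"
          by (rule intM[OF meas])
        also have "\<dots> = (\<Sum>k\<le>?N. w ?N k * (K ^ d * (real k / real ?N) ^ d))"
        proof (rule sum.cong)
          fix k assume "k \<in> {..?N}"
          then have "max 0 (min K (g ?N k)) = g ?N k" using g[of k N] by simp
          then show "w ?N k * (max 0 (min K (g ?N k))) ^ d = w ?N k * (K ^ d * (real k / real ?N) ^ d)"
            by (simp only: g_def power_mult_distrib)
        qed simp
        finally have 1: "(\<integral>t. (max 0 (min K t)) ^ d \<partial>M N) = \<dots>" .
        have "m = (\<Sum>k\<le>?N. w ?N k * real (k choose d)) / real (?N choose d)"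
          using wmom[of d ?N] N pos unfolding m_def by (simp add: field_simps)
        then have 2: "K ^ d * m = (\<Sum>k\<le>?N. w ?N k * (K ^ d * (real (k choose d) / real (?N choose d))))"
          by (simp add: sum_divide_distrib sum_distrib_left mult_ac)
        have "e N = (\<Sum>k\<le>?N. w ?N k * (K ^ d * ((real k / real ?N) ^ d - real (k choose d) / real (?N choose d))))"
          unfolding e_def 1 2 by (simp add: sum_subtractf right_diff_distrib del: of_nat_Suc)
        also have "\<bar>\<dots>\<bar> \<le> (\<Sum>k\<le>?N. w ?N k * (K ^ d * (real d * (real d / real (Suc N - d)))))"
        proof (rule order_trans[OF sum_abs], rule sum_mono)
          fix k assume "k \<in> {..?N}"
          then have "\<bar>(real k / real ?N) ^ d - real (k choose d) / real (?N choose d)\<bar> \<le> real d * (real d / real (Suc N - d))"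
            using binomial_ratio_approx[of k ?N d] N by (simp add: abs_minus_commute)
          then show "\<bar>w ?N k * (K ^ d * ((real k / real ?N) ^ d - real (k choose d) / real (?N choose d)))\<bar>
            \<le> w ?N k * (K ^ d * (real d * (real d / real (Suc N - d))))"
            unfolding abs_mult using w0 K_pos by (intro mult_mono) (auto simp del: of_nat_Suc)
        qed
        also have "\<dots> = K ^ d * (real d * (real d / real (Suc N - d)))"
          unfolding sum_distrib_right[symmetric] wsum by simp
        finally show ?thesis .
      qed
      have "e \<longlonglongrightarrow> 0"
      proof (rule tendsto_rabs_zero_cancel, rule tendsto_sandwich[OF _ _ tendsto_const])
        show "\<forall>\<^sub>F N in sequentially. \<bar>e N\<bar> \<le> K ^ d * (real d * (real d / real (Suc N - d)))"
          using eventually_gt_at_top[of "2 * d"] by eventually_elim (use e in auto)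
        have "filterlim (\<lambda>N. Suc N - d) at_top sequentially"
          unfolding filterlim_at_top
        proof
          fix Z show "\<forall>\<^sub>F N in sequentially. Z \<le> Suc N - d"
            using eventually_ge_at_top[of "Z + d"] by eventually_elim auto
        qed
        then have "filterlim (\<lambda>N. real (Suc N - d)) at_top sequentially"
          by (rule filterlim_compose[OF filterlim_real_sequentially])
        then have "(\<lambda>N. real d / real (Suc N - d)) \<longlonglongrightarrow> 0"
          by (intro tendsto_divide_0[OF tendsto_const] filterlim_at_top_imp_at_infinity)
        then show "(\<lambda>N. K ^ d * (real d * (real d / real (Suc N - d)))) \<longlonglongrightarrow> 0"
          by (intro tendsto_mult_right_zero)
      qed auto
      then have "(\<lambda>N. e N + K ^ d * m) \<longlonglongrightarrow> 0 + K ^ d * m" by (intro tendsto_add tendsto_const)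
      then show "(\<lambda>N. e N + K ^ d * m) \<longlonglongrightarrow> inner ((A ^^ d) x) x" by (simp add: m)
      show "\<forall>\<^sub>F N in sequentially. e N + K ^ d * m = (\<integral>t. (max 0 (min K t)) ^ d \<partial>M N)"
        by (simp add: e_def)
    qed
    then have "(\<lambda>n. \<integral>t. (max 0 (min K t)) ^ d \<partial>M (r n)) \<longlonglongrightarrow> inner ((A ^^ d) x) x"
      using r by (rule LIMSEQ_subseq_LIMSEQ[unfolded comp_def])
    ultimately show ?thesis using LIMSEQ_unique by metis
  qed
  show ?thesis using rd AE mom by blast
qed

text \<open>Normalise to a unit vector, whose weights form a probability distribution, and rescale
  the measure by \<open>(norm x)\<^sup>2\<close>; the zero vector gets the null measure.\<close>

lemma spectral_at_exists: "\<exists>\<nu>. spectral_at K x \<nu>"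
proof (cases "x = 0")
  case True
  have "(A ^^ n) 0 = 0" for n by (induction n) (auto simp: lin_simps)
  then show ?thesis using True
    by (intro exI[of _ "null_measure borel"])
       (auto intro!: finite_measureI simp: AE_iff_null null_sets_def spectral_at_def)
next
  case False
  define y where "y = (1 / norm x) *\<^sub>R x"
  have "inner y y = 1" using False by (simp add: y_def dot_square_norm power2_eq_square)
  then obtain \<nu> where \<nu>: "real_distribution \<nu>" "AE t in \<nu>. 0 \<le> t \<and> t \<le> K"
     "\<And>n::nat. (\<integral>t. t ^ n \<partial>\<nu>) = inner ((A ^^ n) y) y"
    using moment_measure_normalized by blast
  interpret real_distribution \<nu> by fact
  let ?c = "(norm x)\<^sup>2"
  define \<nu>' where "\<nu>' = density \<nu> (\<lambda>_. ennreal ?c)"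
  have fin: "finite_measure \<nu>'" unfolding \<nu>'_def
    by (rule finite_measureI) (simp add: emeasure_density nn_integral_cmult ennreal_mult_eq_top_iff emeasure_eq_measure)
  have ae: "AE t in \<nu>'. 0 \<le> t \<and> t \<le> K"
    unfolding \<nu>'_def by (subst AE_density) (use \<nu>(2) in auto)
  have An: "(A ^^ n) x = norm x *\<^sub>R (A ^^ n) y" for n
    by (induction n) (use False in \<open>auto simp: y_def lin_simps\<close>)
  have "(\<integral>t. t ^ n \<partial>\<nu>') = inner ((A ^^ n) x) x" for n
  proof -
    have "(\<integral>t. t ^ n \<partial>\<nu>') = ?c * (\<integral>t. t ^ n \<partial>\<nu>)"
      unfolding \<nu>'_def by (subst integral_density) auto
    also have "\<dots> = inner ((A ^^ n) x) x"
      unfolding \<nu>(3) An[of n] using False by (simp add: y_def power2_eq_square)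
    finally show ?thesis .
  qed
  moreover have "sets \<nu>' = sets borel" by (simp add: \<nu>'_def)
  ultimately show ?thesis using fin ae by (auto simp: spectral_at_def)
qed

end

section \<open>Polynomial approximation of spectral projections\<close>

text \<open>Ramps that equal 1 up to r and fall to 0 over the width 1 / (k + 1) converge to the
  indicator at every point, r included; Weierstrass approximates the k-th ramp within that width.
  The bound 2 serves dominated convergence.\<close>

lemma poly_approx_indicator:
  fixes K r :: real
  shows "\<exists>p :: nat \<Rightarrow> real poly. (\<forall>k t. \<bar>t\<bar> \<le> K \<longrightarrow> \<bar>poly (p k) t\<bar> \<le> 2) \<and>
     (\<forall>t. \<bar>t\<bar> \<le> K \<longrightarrow> (\<lambda>k. poly (p k) t) \<longlonglongrightarrow> indicator {..r} t)"
proof -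
  define e where "e k = 1 / real (Suc k)" for k
  have e: "0 < e k" "e k \<le> 1" for k by (auto simp: e_def)
  have elim: "e \<longlonglongrightarrow> 0" unfolding e_def using LIMSEQ_inverse_real_of_nat by (simp add: inverse_eq_divide)
  define \<phi> where "\<phi> k = cts_step r (r + e k)" for k
  have "\<exists>p :: real poly. \<forall>t. \<bar>t\<bar> \<le> K \<longrightarrow> \<bar>\<phi> k t - poly p t\<bar> < e k" for k
  proof -
    have "continuous_on {-K..K} (\<phi> k)"
      unfolding \<phi>_def using cts_step_uniformly_continuous[of r "r + e k"] e
      by (meson uniformly_continuous_imp_continuous continuous_on_subset subset_UNIV less_add_same_cancel1)
    then obtain g where g: "real_polynomial_function g" "\<And>t. t \<in> {-K..K} \<Longrightarrow> \<bar>\<phi> k t - g t\<bar> < e k"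
      using Stone_Weierstrass_real_polynomial_function[of "{-K..K}" "\<phi> k" "e k"] e by auto
    obtain a n where "g = (\<lambda>x. \<Sum>i\<le>n. a i * x ^ i)"
      using g(1) real_polynomial_function_iff_sum by auto
    then have "g t = poly (\<Sum>i\<le>n. monom (a i) i) t" for t by (simp add: poly_sum poly_monom)
    then show ?thesis using g(2) by (intro exI[of _ "\<Sum>i\<le>n. monom (a i) i"]) (auto simp: abs_le_iff)
  qed
  then obtain p where p: "\<And>k t. \<bar>t\<bar> \<le> K \<Longrightarrow> \<bar>\<phi> k t - poly (p k) t\<bar> < e k" by metis
  have \<phi>01: "0 \<le> \<phi> k t" "\<phi> k t \<le> 1" for k t
    using e[of k] by (auto simp: \<phi>_def cts_step_def divide_le_eq)
  have "\<bar>poly (p k) t\<bar> \<le> 2" if "\<bar>t\<bar> \<le> K" for k t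
    using p[OF that, of k] \<phi>01[of k t] e[of k] by linarith
  moreover have "(\<lambda>k. poly (p k) t) \<longlonglongrightarrow> indicator {..r} t" if t: "\<bar>t\<bar> \<le> K" for t
  proof -
    have "\<forall>\<^sub>F k in sequentially. \<phi> k t = indicator {..r} t"
    proof (cases "t \<le> r")
      case True
      then show ?thesis by (simp add: \<phi>_def cts_step_def)
    next
      case False
      then have "\<forall>\<^sub>F k in sequentially. e k < t - r" using order_tendstoD(2)[OF elim, of "t - r"] by simp
      then show ?thesis by eventually_elim (use False in \<open>auto simp: \<phi>_def cts_step_def\<close>)
    qed
    then have "(\<lambda>k. \<phi> k t) \<longlonglongrightarrow> indicator {..r} t" by (rule tendsto_eventually)
    moreover have "(\<lambda>k. \<phi> k t - poly (p k) t) \<longlonglongrightarrow> 0"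
      by (rule Lim_null_comparison[OF _ elim]) (use p[OF t] in \<open>auto intro!: always_eventually less_imp_le\<close>)
    ultimately show ?thesis using tendsto_diff[of "\<lambda>k. \<phi> k t" _ _ "\<lambda>k. \<phi> k t - poly (p k) t" 0] by fastforce
  qed
  ultimately show ?thesis by blast
qed

lemma integral_approx_indicator:
  fixes f :: "nat \<Rightarrow> real \<Rightarrow> real"
  assumes "sets \<nu> = sets borel" "finite_measure \<nu>" "AE t in \<nu>. \<bar>t\<bar> \<le> K"
    and [measurable]: "\<And>k. f k \<in> borel_measurable borel"
    and bd: "\<And>k t. \<bar>t\<bar> \<le> K \<Longrightarrow> \<bar>f k t\<bar> \<le> C"
    and lim: "\<And>t. \<bar>t\<bar> \<le> K \<Longrightarrow> (\<lambda>k. f k t) \<longlonglongrightarrow> indicator S t"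
    and S: "S \<in> sets borel"
  shows "(\<lambda>k. \<integral>t. f k t \<partial>\<nu>) \<longlonglongrightarrow> measure \<nu> S"
proof -
  interpret finite_measure \<nu> by fact
  have [measurable_cong]: "sets \<nu> = sets borel" by fact
  have [measurable]: "S \<in> sets borel" by fact
  have "(\<lambda>k. \<integral>t. f k t \<partial>\<nu>) \<longlonglongrightarrow> (\<integral>t. indicator S t \<partial>\<nu>)"
  proof (rule integral_dominated_convergence[where w="\<lambda>_. C"])
    show "AE t in \<nu>. (\<lambda>k. f k t) \<longlonglongrightarrow> indicator S t"
      using assms(3) by eventually_elim (rule lim)
    show "AE t in \<nu>. norm (f k t) \<le> C" for k
      using assms(3) by eventually_elim (use bd in auto)
  qed auto
  moreover have "space \<nu> = UNIV" using assms(1) by (metis sets_eq_imp_space_eq space_borel)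
  ultimately show ?thesis by simp
qed

text \<open>Measures with equal moments integrate polynomials equally, and polynomial approximation
  of half-line indicators equates the distribution functions. The two bounds may differ because
  \<open>spectral_measure\<close> only asks for some bound.\<close>

lemma moment_measure_unique:
  fixes \<alpha> \<beta> :: "real measure"
  assumes m1: "sets \<alpha> = sets borel" "finite_measure \<alpha>" "AE t in \<alpha>. \<bar>t\<bar> \<le> K1"
    and m2: "sets \<beta> = sets borel" "finite_measure \<beta>" "AE t in \<beta>. \<bar>t\<bar> \<le> K2"
    and eq: "\<And>n::nat. (\<integral>t. t ^ n \<partial>\<alpha>) = (\<integral>t. t ^ n \<partial>\<beta>)"
  shows "\<alpha> = \<beta>"
proof -
  define K where "K = max K1 K2"
  have n1: "AE t in \<alpha>. \<bar>t\<bar> \<le> K" using m1(3) by eventually_elim (simp add: K_def le_max_iff_disj)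
  have n2: "AE t in \<beta>. \<bar>t\<bar> \<le> K" using m2(3) by eventually_elim (simp add: K_def le_max_iff_disj)
  have "cdf \<alpha> = cdf \<beta>"
  proof
    fix r
    obtain p :: "nat \<Rightarrow> real poly" where p: "\<And>k t. \<bar>t\<bar> \<le> K \<Longrightarrow> \<bar>poly (p k) t\<bar> \<le> 2"
      "\<And>t. \<bar>t\<bar> \<le> K \<Longrightarrow> (\<lambda>k. poly (p k) t) \<longlonglongrightarrow> indicator {..r} t"
      using poly_approx_indicator by metis
    have [measurable]: "poly (p k) \<in> borel_measurable borel" for k
      by (intro borel_measurable_continuous_onI continuous_intros)
    have l1: "(\<lambda>k. \<integral>t. poly (p k) t \<partial>\<alpha>) \<longlonglongrightarrow> measure \<alpha> {..r}"
      by (rule integral_approx_indicator[OF m1(1,2) n1, where C=2]) (use p in auto)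
    have l2: "(\<lambda>k. \<integral>t. poly (p k) t \<partial>\<beta>) \<longlonglongrightarrow> measure \<beta> {..r}"
      by (rule integral_approx_indicator[OF m2(1,2) n2, where C=2]) (use p in auto)
    have "(\<integral>t. poly (p k) t \<partial>\<alpha>) = (\<integral>t. poly (p k) t \<partial>\<beta>)" for k
      by (simp add: integral_poly_moments(2)[OF m1(1,2) n1] integral_poly_moments(2)[OF m2(1,2) n2] eq)
    then show "cdf \<alpha> r = cdf \<beta> r"
      unfolding cdf_def using LIMSEQ_unique[OF l1] l2 by simp
  qed
  moreover have "finite_borel_measure \<alpha>" "finite_borel_measure \<beta>"
    using m1 m2 by (auto simp: finite_borel_measure_def finite_borel_measure_axioms_def)
  ultimately show ?thesis by (intro cdf_unique') auto
qed

section \<open>One polynomial sequence for the spectral projections of all vectors\<close>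

context symmetric_op
begin

lemma spectral_at_mass:
  assumes "spectral_at K x \<nu>"
  shows "measure \<nu> UNIV = (norm x)\<^sup>2"
proof -
  have "space \<nu> = UNIV" using assms unfolding spectral_at_def by (metis sets_eq_imp_space_eq space_borel)
  moreover have "(\<integral>t. t ^ 0 \<partial>\<nu>) = inner ((A ^^ 0) x) x" using assms unfolding spectral_at_def by blast
  ultimately show ?thesis by (simp add: power2_norm_eq_inner)
qed

text \<open>The sequence is chosen before the vector, so that different vectors can be compared and
  the limit is linear in them. The norms converge because the squares of the polynomials approximate
  the same indicator.\<close>

lemma poly_op_approx_projection:
  "\<exists>p. \<forall>x \<nu>. spectral_at K x \<nu> \<longrightarrow>
     (\<lambda>k. inner (poly_op A (p k) x) x) \<longlonglongrightarrow> measure \<nu> {..r} \<and>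
     (\<lambda>k. norm (poly_op A (p k) x)) \<longlonglongrightarrow> sqrt (measure \<nu> {..r}) \<and>
     Cauchy (\<lambda>k. poly_op A (p k) x) \<and>
     (\<forall>k. norm (poly_op A (p k) x) \<le> 2 * norm x)"
proof -
  obtain p :: "nat \<Rightarrow> real poly" where p: "\<And>k t. \<bar>t\<bar> \<le> K \<Longrightarrow> \<bar>poly (p k) t\<bar> \<le> 2"
    "\<And>t. \<bar>t\<bar> \<le> K \<Longrightarrow> (\<lambda>k. poly (p k) t) \<longlonglongrightarrow> indicator {..r} t"
    using poly_approx_indicator by metis
  have meas[measurable]: "poly q \<in> borel_measurable borel" for q :: "real poly"
    by (intro borel_measurable_continuous_onI continuous_intros)
  have p2: "\<bar>poly (p k * p k) t\<bar> \<le> 4" if "\<bar>t\<bar> \<le> K" for k t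
    using mult_mono[OF p(1)[OF that, of k] p(1)[OF that, of k]] by (simp add: abs_mult)
  have main: "(\<lambda>k. inner (poly_op A (p k) x) x) \<longlonglongrightarrow> measure \<nu> {..r} \<and>
     (\<lambda>k. norm (poly_op A (p k) x)) \<longlonglongrightarrow> sqrt (measure \<nu> {..r}) \<and>
     Cauchy (\<lambda>k. poly_op A (p k) x) \<and>
     (\<forall>k. norm (poly_op A (p k) x) \<le> 2 * norm x)" if s: "spectral_at K x \<nu>" for x \<nu>
  proof -
    have \<nu>: "sets \<nu> = sets borel" "finite_measure \<nu>" "AE t in \<nu>. \<bar>t\<bar> \<le> K"
      using s spectral_at_bounded[OF s] by (auto simp: spectral_at_def)
    interpret finite_measure \<nu> by fact
    have [measurable_cong]: "sets \<nu> = sets borel" by fact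
    have sp: "space \<nu> = UNIV" using \<nu>(1) by (metis sets_eq_imp_space_eq space_borel)
    note int = integral_poly_moments(1)[OF \<nu>]
    note ip = integral_poly_spectral[OF s, symmetric]
    have sq: "(norm (poly_op A q x))\<^sup>2 = (\<integral>t. poly (q * q) t \<partial>\<nu>)" for q
      by (simp add: inner_poly_op_square[symmetric] ip del: poly_mult)
    have l1: "(\<lambda>k. inner (poly_op A (p k) x) x) \<longlonglongrightarrow> measure \<nu> {..r}"
      unfolding ip by (rule integral_approx_indicator[OF \<nu>, where C=2]) (use p in auto)
    have l2: "(\<lambda>k. (norm (poly_op A (p k) x))\<^sup>2) \<longlonglongrightarrow> measure \<nu> {..r}"
      unfolding sq
    proof (rule integral_approx_indicator[OF \<nu>, where C=4])
      fix t assume t: "\<bar>t\<bar> \<le> K"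
      have "(\<lambda>k. poly (p k) t * poly (p k) t) \<longlonglongrightarrow> indicator {..r} t * indicator {..r} t"
        by (intro tendsto_mult p(2) t)
      then show "(\<lambda>k. poly (p k * p k) t) \<longlonglongrightarrow> indicator {..r} t"
        by (cases "t \<le> r") simp_all
    qed (use p2 in auto)
    have l2': "(\<lambda>k. norm (poly_op A (p k) x)) \<longlonglongrightarrow> sqrt (measure \<nu> {..r})"
      using tendsto_real_sqrt[OF l2] by simp
    have bound: "norm (poly_op A (p k) x) \<le> 2 * norm x" for k
    proof -
      have "(norm (poly_op A (p k) x))\<^sup>2 \<le> (\<integral>t. 4 \<partial>\<nu>)"
        unfolding sq
      proof (rule integral_mono_AE[OF int])
        show "AE t in \<nu>. poly (p k * p k) t \<le> 4"
          using \<nu>(3) by eventually_elim (use p2 in \<open>fastforce simp: abs_le_iff\<close>)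
      qed simp
      also have "\<dots> = (2 * norm x)\<^sup>2" using spectral_at_mass[OF s] sp by (simp add: power_mult_distrib)
      finally show ?thesis by (rule power2_le_imp_le) simp
    qed
    have cau: "Cauchy (\<lambda>k. poly_op A (p k) x)"
    proof -
      define d where "d k = (\<integral>t. (poly (p k) t - indicator {..r} t)\<^sup>2 \<partial>\<nu>)" for k
      have bd: "(poly (p k) t - indicator {..r} t)\<^sup>2 \<le> 9" if "\<bar>t\<bar> \<le> K" for k t
      proof -
        have "\<bar>poly (p k) t - indicator {..r} t\<bar> \<le> 3"
          using p(1)[OF that, of k] by (auto simp: indicator_def)
        then show ?thesis using power_mono[of "\<bar>poly (p k) t - indicator {..r} t\<bar>" 3 2] by simp
      qed
      have di: "integrable \<nu> (\<lambda>t. (poly (p k) t - indicator {..r} t)\<^sup>2)" for k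
      proof (rule integrable_const_bound)
        show "AE t in \<nu>. norm ((poly (p k) t - indicator {..r} t)\<^sup>2) \<le> 9"
          using \<nu>(3) by eventually_elim (use bd in auto)
      qed simp
      \<comment> \<open>The limit 0 is phrased as the measure of the empty set so that the same
        dominated convergence lemma applies.\<close>
      have "d \<longlonglongrightarrow> measure \<nu> {}"
        unfolding d_def
      proof (rule integral_approx_indicator[OF \<nu>, where C=9])
        fix t assume t: "\<bar>t\<bar> \<le> K"
        have "(\<lambda>k. (poly (p k) t - indicator {..r} t)\<^sup>2) \<longlonglongrightarrow> (indicator {..r} t - indicator {..r} t)\<^sup>2"
          by (intro tendsto_intros p(2) t)
        then show "(\<lambda>k. (poly (p k) t - indicator {..r} t)\<^sup>2) \<longlonglongrightarrow> indicator {} t" by simp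
      qed (use bd in auto)
      then have d0: "d \<longlonglongrightarrow> 0" by simp
      have diff: "(norm (poly_op A (p k) x - poly_op A (p l) x))\<^sup>2 \<le> 2 * d k + 2 * d l" for k l
      proof -
        have "(norm (poly_op A (p k) x - poly_op A (p l) x))\<^sup>2 = (\<integral>t. poly ((p k - p l) * (p k - p l)) t \<partial>\<nu>)"
          by (simp add: sq[symmetric] poly_op_diff del: poly_mult)
        also have "\<dots> \<le> (\<integral>t. 2 * (poly (p k) t - indicator {..r} t)\<^sup>2 + 2 * (poly (p l) t - indicator {..r} t)\<^sup>2 \<partial>\<nu>)"
        proof (rule integral_mono[OF int])
          fix t
          have "(a - b)\<^sup>2 \<le> 2 * (a - i)\<^sup>2 + 2 * (b - i)\<^sup>2" for a b i :: real
            using sum_squares_ge_zero[of "a + b - 2 * i" 0] by (simp add: power2_eq_square algebra_simps)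
          then show "poly ((p k - p l) * (p k - p l)) t \<le> 2 * (poly (p k) t - indicator {..r} t)\<^sup>2 + 2 * (poly (p l) t - indicator {..r} t)\<^sup>2"
            by (simp add: power2_eq_square)
        qed (use di in auto)
        also have "\<dots> = 2 * d k + 2 * d l" unfolding d_def using di by simp
        finally show ?thesis .
      qed
      show ?thesis
      proof (rule CauchyI)
        fix e :: real assume "0 < e"
        then have "\<forall>\<^sub>F k in sequentially. d k < e\<^sup>2 / 4" using order_tendstoD(2)[OF d0, of "e\<^sup>2 / 4"] by simp
        then obtain M where M: "\<And>k. k \<ge> M \<Longrightarrow> d k < e\<^sup>2 / 4" by (auto simp: eventually_sequentially)
        have "norm (poly_op A (p k) x - poly_op A (p l) x) < e" if "k \<ge> M" "l \<ge> M" for k l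
        proof -
          have "(norm (poly_op A (p k) x - poly_op A (p l) x))\<^sup>2 < e\<^sup>2"
            using diff[of k l] M[OF that(1)] M[OF that(2)] by linarith
          then show ?thesis using \<open>0 < e\<close> by (simp add: power2_less_imp_less)
        qed
        then show "\<exists>M. \<forall>m\<ge>M. \<forall>n\<ge>M. norm (poly_op A (p m) x - poly_op A (p n) x) < e" by blast
      qed
    qed
    show ?thesis using l1 l2' cau bound by blast
  qed
  show ?thesis by (rule exI[of _ p]) (intro allI impI main)
qed

text \<open>The square root of the spectral mass stands for the norm of the spectral projection of a
  vector; this is its triangle inequality, obtained as the limit of the one for polynomials. No
  projection has to exist for it, so completeness is not involved.\<close>

lemma sqrt_spectral_sum_le:
  assumes "spectral_at K (\<Sum>i\<in>I. y i) \<nu>" and s: "\<And>i. i \<in> I \<Longrightarrow> spectral_at K (y i) (\<nu>' i)"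
  shows "sqrt (measure \<nu> {..r}) \<le> (\<Sum>i\<in>I. sqrt (measure (\<nu>' i) {..r}))"
proof -
  obtain p where P: "\<forall>x \<nu>. spectral_at K x \<nu> \<longrightarrow>
     (\<lambda>k. inner (poly_op A (p k) x) x) \<longlonglongrightarrow> measure \<nu> {..r} \<and>
     (\<lambda>k. norm (poly_op A (p k) x)) \<longlonglongrightarrow> sqrt (measure \<nu> {..r}) \<and>
     Cauchy (\<lambda>k. poly_op A (p k) x) \<and>
     (\<forall>k. norm (poly_op A (p k) x) \<le> 2 * norm x)"
    using poly_op_approx_projection[of K r] by (rule exE)
  note p = P[rule_format, THEN conjunct2, THEN conjunct1]
  show ?thesis
  proof (rule LIMSEQ_le[OF p[OF assms(1)] tendsto_sum[OF p[OF s]]])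
    have "norm (poly_op A (p k) (\<Sum>i\<in>I. y i)) \<le> (\<Sum>i\<in>I. norm (poly_op A (p k) (y i)))" for k
      using norm_sum[of "\<lambda>i. poly_op A (p k) (y i)" I]
      by (simp add: linear_sum[OF bounded_linear.linear[OF bounded_linear_poly_op]])
    then show "\<exists>N. \<forall>k\<ge>N. norm (poly_op A (p k) (\<Sum>i\<in>I. y i)) \<le> (\<Sum>i\<in>I. norm (poly_op A (p k) (y i)))"
      by blast
  qed
qed

end

text \<open>Completeness gives the pointwise limit of the polynomials. The commutation clause is
  what later makes the limit respect complex scalars and restriction to a set of points, neither of
  which is visible in the abstract real space.\<close>

lemma spectral_projection_exists:
  fixes A :: "'h::{real_inner, complete_space} \<Rightarrow> 'h"
  assumes "symmetric_op A" and s: "\<And>x. symmetric_op.spectral_at A K x (\<nu> x)"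
  shows "\<exists>B. bounded_linear B \<and> (\<forall>x. inner (B x) x = measure (\<nu> x) {..r}) \<and>
    (\<forall>x y. inner (B x) y = inner x (B y)) \<and>
    (\<forall>C. bounded_linear C \<longrightarrow> (\<forall>y. A (C y) = C (A y)) \<longrightarrow> (\<forall>y. B (C y) = C (B y)))"
proof -
  interpret symmetric_op A by fact
  obtain p where P: "\<forall>x \<nu>. spectral_at K x \<nu> \<longrightarrow>
     (\<lambda>k. inner (poly_op A (p k) x) x) \<longlonglongrightarrow> measure \<nu> {..r} \<and>
     (\<lambda>k. norm (poly_op A (p k) x)) \<longlonglongrightarrow> sqrt (measure \<nu> {..r}) \<and>
     Cauchy (\<lambda>k. poly_op A (p k) x) \<and>
     (\<forall>k. norm (poly_op A (p k) x) \<le> 2 * norm x)"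
    using poly_op_approx_projection[of K r] by (rule exE)
  note Q = P[rule_format, OF s]
  note p = Q[THEN conjunct1] Q[THEN conjunct2, THEN conjunct2, THEN conjunct1]
    Q[THEN conjunct2, THEN conjunct2, THEN conjunct2, THEN spec]
  define B where "B x = lim (\<lambda>k. poly_op A (p k) x)" for x
  have B: "(\<lambda>k. poly_op A (p k) x) \<longlonglongrightarrow> B x" for x
    unfolding B_def using p(2) by (simp add: Cauchy_convergent_iff convergent_LIMSEQ_iff)
  note blp = bounded_linear_poly_op
  have "bounded_linear B"
  proof (rule bounded_linear_intro[where K=2])
    show "B (x + y) = B x + B y" for x y
    proof (rule LIMSEQ_unique[OF B])
      show "(\<lambda>k. poly_op A (p k) (x + y)) \<longlonglongrightarrow> B x + B y"
        unfolding linear_add[OF bounded_linear.linear[OF blp]] by (intro tendsto_add B)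
    qed
    show "B (c *\<^sub>R x) = c *\<^sub>R B x" for c x
    proof (rule LIMSEQ_unique[OF B])
      show "(\<lambda>k. poly_op A (p k) (c *\<^sub>R x)) \<longlonglongrightarrow> c *\<^sub>R B x"
        unfolding linear_scale[OF bounded_linear.linear[OF blp]] by (intro tendsto_scaleR tendsto_const B)
    qed
    show "norm (B x) \<le> norm x * 2" for x
      by (rule LIMSEQ_le_const2[OF tendsto_norm[OF B]]) (use p(3) in \<open>auto simp: mult.commute\<close>)
  qed
  moreover have "inner (B x) x = measure (\<nu> x) {..r}" for x
    by (rule LIMSEQ_unique[OF tendsto_inner[OF B tendsto_const] p(1)])
  moreover have "inner (B x) y = inner x (B y)" for x y
    by (rule LIMSEQ_unique[OF tendsto_inner[OF B tendsto_const]])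
       (unfold poly_op_symmetric, intro tendsto_inner[OF tendsto_const B])
  moreover have "B (C y) = C (B y)" if C: "bounded_linear C" "\<And>y. A (C y) = C (A y)" for C y
  proof (rule LIMSEQ_unique[OF B])
    show "(\<lambda>k. poly_op A (p k) (C y)) \<longlonglongrightarrow> C (B y)"
      unfolding poly_op_commute[OF bounded_linear.linear[OF C(1)] C(2)]
      by (intro bounded_linear.tendsto[OF C(1)] B)
  qed
  ultimately show ?thesis by blast
qed

section \<open>Square-summable functions as a Hilbert space type\<close>

typedef 'a ell2 = "{f :: 'a \<Rightarrow> complex. (\<lambda>x. (cmod (f x))\<^sup>2) summable_on UNIV}"
  by (rule exI[of _ "\<lambda>_. 0"]) simp

setup_lifting type_definition_ell2

abbreviation fn :: "'a ell2 \<Rightarrow> 'a \<Rightarrow> complex" where "fn \<equiv> Rep_ell2"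

lemma fn_square_summable: "(\<lambda>x. (cmod (fn f x))\<^sup>2) summable_on UNIV"
  using Rep_ell2 by auto

lemma square_summable_add:
  fixes f g :: "'a \<Rightarrow> complex"
  assumes "(\<lambda>x. (cmod (f x))\<^sup>2) summable_on UNIV" "(\<lambda>x. (cmod (g x))\<^sup>2) summable_on UNIV"
  shows "(\<lambda>x. (cmod (f x + g x))\<^sup>2) summable_on UNIV"
proof (rule summable_on_comparison_test)
  show "(\<lambda>x. 2 * (cmod (f x))\<^sup>2 + 2 * (cmod (g x))\<^sup>2) summable_on UNIV"
    using assms by (intro summable_on_add summable_on_cmult_right)
  fix x
  have "(cmod (f x + g x))\<^sup>2 \<le> (cmod (f x) + cmod (g x))\<^sup>2"
    by (intro power_mono norm_triangle_ineq) auto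
  also have "\<dots> \<le> 2 * (cmod (f x))\<^sup>2 + 2 * (cmod (g x))\<^sup>2"
    using sum_squares_bound[of "cmod (f x)" "cmod (g x)"] by (simp add: power2_sum)
  finally show "(cmod (f x + g x))\<^sup>2 \<le> 2 * (cmod (f x))\<^sup>2 + 2 * (cmod (g x))\<^sup>2" .
qed auto

lemma square_summable_mult:
  fixes f :: "'a \<Rightarrow> complex"
  assumes "(\<lambda>x. (cmod (f x))\<^sup>2) summable_on UNIV"
  shows "(\<lambda>x. (cmod (c * f x))\<^sup>2) summable_on UNIV"
  using assms by (simp add: norm_mult power_mult_distrib summable_on_cmult_right)

lemma square_summable_prod:
  fixes f g :: "'a \<Rightarrow> complex"
  assumes "(\<lambda>x. (cmod (f x))\<^sup>2) summable_on UNIV" "(\<lambda>x. (cmod (g x))\<^sup>2) summable_on UNIV"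
  shows "(\<lambda>x. f x * cnj (g x)) summable_on UNIV"
proof (rule Infinite_Sum.abs_summable_summable, rule Infinite_Sum.abs_summable_on_comparison_test')
  show "(\<lambda>x. (cmod (f x))\<^sup>2 + (cmod (g x))\<^sup>2) summable_on UNIV"
    using assms by (intro summable_on_add)
  fix x
  have "norm (f x * cnj (g x)) = cmod (f x) * cmod (g x)" by (simp add: norm_mult)
  also have "\<dots> \<le> (cmod (f x))\<^sup>2 + (cmod (g x))\<^sup>2"
    using sum_squares_bound[of "cmod (f x)" "cmod (g x)"]
      mult_nonneg_nonneg[OF norm_ge_zero norm_ge_zero, of "f x" "g x"] by linarith
  finally show "norm (f x * cnj (g x)) \<le> (cmod (f x))\<^sup>2 + (cmod (g x))\<^sup>2" .
qed

lemma Re_infsum_mult_cnj: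
  fixes f :: "'a \<Rightarrow> complex"
  assumes "(\<lambda>x. (cmod (f x))\<^sup>2) summable_on X"
  shows "Re (\<Sum>\<^sub>\<infinity>x\<in>X. f x * cnj (f x)) = (\<Sum>\<^sub>\<infinity>x\<in>X. (cmod (f x))\<^sup>2)"
proof -
  have "(\<Sum>\<^sub>\<infinity>x\<in>X. f x * cnj (f x)) = (\<Sum>\<^sub>\<infinity>x\<in>X. complex_of_real ((cmod (f x))\<^sup>2))"
    by (simp only: complex_norm_square)
  also have "\<dots> = complex_of_real (\<Sum>\<^sub>\<infinity>x\<in>X. (cmod (f x))\<^sup>2)"
    using has_sum_of_real[OF has_sum_infsum[OF assms]] by (intro infsumI) simp
  finally show ?thesis by simp
qed

instantiation ell2 :: (type) real_inner
begin

lift_definition zero_ell2 :: "'a ell2" is "\<lambda>_. 0" by simp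
lift_definition plus_ell2 :: "'a ell2 \<Rightarrow> 'a ell2 \<Rightarrow> 'a ell2" is "\<lambda>f g x. f x + g x"
  by (rule square_summable_add)
lift_definition uminus_ell2 :: "'a ell2 \<Rightarrow> 'a ell2" is "\<lambda>f x. - f x" by simp
lift_definition minus_ell2 :: "'a ell2 \<Rightarrow> 'a ell2 \<Rightarrow> 'a ell2" is "\<lambda>f g x. f x - g x"
  subgoal for f g using square_summable_add[of f "\<lambda>x. - g x"] by simp
  done
lift_definition scaleR_ell2 :: "real \<Rightarrow> 'a ell2 \<Rightarrow> 'a ell2" is "\<lambda>c f x. complex_of_real c * f x"
  by (rule square_summable_mult)
text \<open>Only the real part, as the class \<open>real_inner\<close> demands; the imaginary part
  of the complex product is recovered by putting \<open>cscale (-\<i>) f\<close> in the first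
  place.\<close>

lift_definition inner_ell2 :: "'a ell2 \<Rightarrow> 'a ell2 \<Rightarrow> real" is
  "\<lambda>f g. Re (\<Sum>\<^sub>\<infinity>x. f x * cnj (g x))" .
definition norm_ell2 :: "'a ell2 \<Rightarrow> real" where "norm_ell2 f = sqrt (inner f f)"
definition dist_ell2 :: "'a ell2 \<Rightarrow> 'a ell2 \<Rightarrow> real" where "dist_ell2 f g = norm (f - g)"
definition sgn_ell2 :: "'a ell2 \<Rightarrow> 'a ell2" where "sgn_ell2 f = scaleR (inverse (norm f)) f"
definition uniformity_ell2 :: "('a ell2 \<times> 'a ell2) filter"
  where "uniformity_ell2 = (INF e\<in>{0<..}. principal {(x, y). dist x y < e})"
definition open_ell2 :: "'a ell2 set \<Rightarrow> bool"
  where "open_ell2 U \<longleftrightarrow> (\<forall>x\<in>U. eventually (\<lambda>(x', y). x' = x \<longrightarrow> y \<in> U) uniformity)"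

instance
proof
  fix f g h :: "'a ell2" and a b c :: real
  show "f + g + h = f + (g + h)" "f + g = g + f" "0 + f = f" "- f + f = 0" "f - g = f + - g"
    "a *\<^sub>R (f + g) = a *\<^sub>R f + a *\<^sub>R g" "(a + b) *\<^sub>R f = a *\<^sub>R f + b *\<^sub>R f"
    "a *\<^sub>R b *\<^sub>R f = (a * b) *\<^sub>R f" "1 *\<^sub>R f = f"
    by (transfer; simp add: algebra_simps)+
  show "sgn f = scaleR (inverse (norm f)) f" by (simp add: sgn_ell2_def)
  show "dist f g = norm (f - g)" by (simp add: dist_ell2_def)
  show "uniformity = (INF e\<in>{0<..}. principal {(x, y::'a ell2). dist x y < e})"
    by (simp add: uniformity_ell2_def)
  show "open U \<longleftrightarrow> (\<forall>x\<in>U. eventually (\<lambda>(x', y). x' = x \<longrightarrow> y \<in> U) uniformity)" for U :: "'a ell2 set"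
    by (simp add: open_ell2_def)
  show "inner f g = inner g f"
  proof transfer
    fix f g :: "'a \<Rightarrow> complex"
    have "(\<lambda>x. f x * cnj (g x)) = (\<lambda>x. cnj (g x * cnj (f x)))" by (simp add: mult.commute)
    then have "(\<Sum>\<^sub>\<infinity>x. f x * cnj (g x)) = cnj (\<Sum>\<^sub>\<infinity>x. g x * cnj (f x))" by (simp only: infsum_cnj)
    then show "Re (\<Sum>\<^sub>\<infinity>x. f x * cnj (g x)) = Re (\<Sum>\<^sub>\<infinity>x. g x * cnj (f x))" by simp
  qed
  show "inner (f + g) h = inner f h + inner g h"
  proof transfer
    fix f g h :: "'a \<Rightarrow> complex"
    assume "(\<lambda>x. (cmod (f x))\<^sup>2) summable_on UNIV" "(\<lambda>x. (cmod (g x))\<^sup>2) summable_on UNIV"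
      "(\<lambda>x. (cmod (h x))\<^sup>2) summable_on UNIV"
    then show "Re (\<Sum>\<^sub>\<infinity>x. (f x + g x) * cnj (h x)) = Re (\<Sum>\<^sub>\<infinity>x. f x * cnj (h x)) + Re (\<Sum>\<^sub>\<infinity>x. g x * cnj (h x))"
      by (simp add: ring_distribs infsum_add square_summable_prod)
  qed
  show "inner (c *\<^sub>R f) g = c * inner f g"
    by transfer (simp add: mult.assoc infsum_cmult_right')
  have inner_self: "inner f f = (\<Sum>\<^sub>\<infinity>x. (cmod (fn f x))\<^sup>2)" for f :: "'a ell2"
    unfolding inner_ell2.rep_eq by (rule Re_infsum_mult_cnj[OF fn_square_summable])
  show "0 \<le> inner f f" unfolding inner_self by (rule infsum_nonneg) simp
  show "(inner f f = 0) = (f = 0)"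
  proof
    assume "inner f f = 0"
    then have "(\<Sum>\<^sub>\<infinity>x. (cmod (fn f x))\<^sup>2) \<le> 0" by (simp add: inner_self)
    then have "(cmod (fn f x))\<^sup>2 = 0" for x
      using nonneg_infsum_le_0D[OF _ fn_square_summable, of f x] by simp
    then show "f = 0" by (simp add: Rep_ell2_inject[symmetric] zero_ell2.rep_eq fun_eq_iff)
  next
    assume "f = 0" then show "inner f f = 0" by (simp add: inner_self zero_ell2.rep_eq)
  qed
  show "norm f = sqrt (inner f f)" by (simp add: norm_ell2_def)
qed

end

lemma norm_square_ell2: "(norm f)\<^sup>2 = (\<Sum>\<^sub>\<infinity>x. (cmod (fn f x))\<^sup>2)"
  using Re_infsum_mult_cnj[OF fn_square_summable[of f]] power2_norm_eq_inner[of f] by (simp add: inner_ell2.rep_eq)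

lemma sum_square_le_norm_square:
  assumes "finite F"
  shows "(\<Sum>x\<in>F. (cmod (fn f x))\<^sup>2) \<le> (norm f)\<^sup>2"
  unfolding norm_square_ell2 by (rule finite_sum_le_infsum) (use assms fn_square_summable in auto)

lemma norm_fn_le: "cmod (fn f x) \<le> norm f"
  using sum_square_le_norm_square[of "{x}" f] by (simp add: power2_le_iff_abs_le)

lemma norm_square_ell2_leI:
  assumes "\<And>F. finite F \<Longrightarrow> (\<Sum>x\<in>F. (cmod (fn f x))\<^sup>2) \<le> C"
  shows "(norm f)\<^sup>2 \<le> C"
  unfolding norm_square_ell2 by (rule infsum_le_finite_sums) (use assms fn_square_summable in auto)

lemma bounded_linear_fn: "bounded_linear (\<lambda>f. fn f x)"
  by (rule bounded_linear_intro[where K=1])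
     (auto simp: plus_ell2.rep_eq scaleR_ell2.rep_eq scaleR_conv_of_real norm_fn_le)

text \<open>Evaluations are bounded, so a Cauchy sequence has a pointwise limit; the Cauchy estimate
  holds on finite sets with a constant independent of the set, so it passes to the limit and then to
  the norm.\<close>

instance ell2 :: (type) complete_space
proof
  fix X :: "nat \<Rightarrow> 'a ell2"
  assume X: "Cauchy X"
  have "Cauchy (\<lambda>n. fn (X n) x)" for x
    using bounded_linear.Cauchy[OF bounded_linear_fn X] .
  then have conv: "\<exists>l. (\<lambda>n. fn (X n) x) \<longlonglongrightarrow> l" for x
    by (simp add: Cauchy_convergent convergentD)
  then obtain l where l: "\<And>x. (\<lambda>n. fn (X n) x) \<longlonglongrightarrow> l x" by metis
  have bound: "(\<Sum>x\<in>F. (cmod (fn (X m) x - l x))\<^sup>2) \<le> e\<^sup>2"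
    if "finite F" "\<And>n. n \<ge> N \<Longrightarrow> norm (X m - X n) \<le> e" for F m N e
  proof (rule LIMSEQ_le_const2)
    show "(\<lambda>n. \<Sum>x\<in>F. (cmod (fn (X m) x - fn (X n) x))\<^sup>2) \<longlonglongrightarrow> (\<Sum>x\<in>F. (cmod (fn (X m) x - l x))\<^sup>2)"
      by (intro tendsto_intros l)
    have "(\<Sum>x\<in>F. (cmod (fn (X m) x - fn (X n) x))\<^sup>2) \<le> e\<^sup>2" if "n \<ge> N" for n
    proof -
      have "(\<Sum>x\<in>F. (cmod (fn (X m) x - fn (X n) x))\<^sup>2) \<le> (norm (X m - X n))\<^sup>2"
        using sum_square_le_norm_square[OF \<open>finite F\<close>, of "X m - X n"] by (simp add: minus_ell2.rep_eq)
      also have "\<dots> \<le> e\<^sup>2" using that \<open>\<And>n. n \<ge> N \<Longrightarrow> norm (X m - X n) \<le> e\<close> by (intro power_mono) auto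
      finally show ?thesis .
    qed
    then show "\<exists>N. \<forall>n\<ge>N. (\<Sum>x\<in>F. (cmod (fn (X m) x - fn (X n) x))\<^sup>2) \<le> e\<^sup>2" by blast
  qed
  have cau: "\<exists>N. \<forall>m\<ge>N. \<forall>n\<ge>N. norm (X m - X n) \<le> e" if "e > 0" for e
    using X that unfolding Cauchy_def dist_norm by (meson less_imp_le)
  have diff: "(\<lambda>x. (cmod (fn (X m) x - l x))\<^sup>2) summable_on UNIV" if "\<And>n. n \<ge> N \<Longrightarrow> norm (X m - X n) \<le> e" for m N e
    by (rule nonneg_bdd_above_summable_on) (auto intro!: bdd_aboveI[of _ "e\<^sup>2"] bound that)
  obtain N1 where N1: "\<And>m n. m \<ge> N1 \<Longrightarrow> n \<ge> N1 \<Longrightarrow> norm (X m - X n) \<le> 1" using cau[of 1] by auto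
  \<comment> \<open>The limit is written as X N1 - (X N1 - l), a combination of square-summable
    functions.\<close>
  have "(\<lambda>x. (cmod (fn (X N1) x + - 1 * (fn (X N1) x - l x)))\<^sup>2) summable_on UNIV"
    by (intro square_summable_add square_summable_mult fn_square_summable diff[of N1 _ 1] N1) auto
  then have lsum: "(\<lambda>x. (cmod (l x))\<^sup>2) summable_on UNIV" by simp
  define L where "L = Abs_ell2 l"
  have L: "fn L = l" unfolding L_def using lsum by (simp add: Abs_ell2_inverse)
  have "X \<longlonglongrightarrow> L"
  proof (rule LIMSEQ_I)
    fix r :: real assume "0 < r"
    then obtain N where N: "\<And>m n. m \<ge> N \<Longrightarrow> n \<ge> N \<Longrightarrow> norm (X m - X n) \<le> r / 2" using cau[of "r / 2"] by auto
    have "norm (X m - L) < r" if "m \<ge> N" for m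
    proof -
      have "(norm (X m - L))\<^sup>2 \<le> (r / 2)\<^sup>2"
        by (rule norm_square_ell2_leI) (simp only: minus_ell2.rep_eq L, rule bound[of _ N], use N that in auto)
      then have "norm (X m - L) \<le> r / 2" using \<open>0 < r\<close> by (simp add: power2_le_iff_abs_le)
      then show ?thesis using \<open>0 < r\<close> by simp
    qed
    then show "\<exists>no. \<forall>n\<ge>no. norm (X n - L) < r" by blast
  qed
  then show "convergent X" by (rule convergentI)
qed

instance ell2 :: (type) banach ..

lemma norm_square_ell2_mono:
  assumes "\<And>x. cmod (fn f x) \<le> cmod (fn g x)"
  shows "norm f \<le> norm g"
proof -
  have "(norm f)\<^sup>2 \<le> (norm g)\<^sup>2"
    unfolding norm_square_ell2
    by (intro infsum_mono fn_square_summable power_mono assms norm_ge_zero)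
  then show ?thesis by (simp add: power2_le_iff_abs_le)
qed

section \<open>Complex scaling, restriction, and the dictionary between \<open>l2 X\<close> and the
  type\<close>

lift_definition cscale :: "complex \<Rightarrow> 'a ell2 \<Rightarrow> 'a ell2" is "\<lambda>c f x. c * f x"
  by (rule square_summable_mult)

lift_definition restr :: "'a set \<Rightarrow> 'a ell2 \<Rightarrow> 'a ell2" is "\<lambda>X f x. if x \<in> X then f x else 0"
proof -
  fix X and f :: "'a \<Rightarrow> complex"
  assume "(\<lambda>x. (cmod (f x))\<^sup>2) summable_on UNIV"
  then show "(\<lambda>x. (cmod (if x \<in> X then f x else 0))\<^sup>2) summable_on UNIV"
    by (rule summable_on_comparison_test) auto
qed

lemma ell2_eqI: "(\<And>x. fn f x = fn g x) \<Longrightarrow> f = g"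
  by (simp add: Rep_ell2_inject[symmetric] fun_eq_iff)

lemma restr_eq_iff: "restr X f = f \<longleftrightarrow> (\<forall>x. x \<notin> X \<longrightarrow> fn f x = 0)"
  by (simp add: Rep_ell2_inject[symmetric] fun_eq_iff restr.rep_eq)

lemma norm_cscale: "norm (cscale c f) = cmod c * norm f"
proof -
  have "(norm (cscale c f))\<^sup>2 = (cmod c * norm f)\<^sup>2"
    by (simp add: norm_square_ell2 power_mult_distrib cscale.rep_eq norm_mult infsum_cmult_right')
  then show ?thesis by (simp add: power2_eq_iff_nonneg)
qed

lemma bounded_linear_cscale: "bounded_linear (cscale c)"
  by (rule bounded_linear_intro[where K="cmod c"])
     (auto intro!: ell2_eqI simp: cscale.rep_eq plus_ell2.rep_eq scaleR_ell2.rep_eq algebra_simps norm_cscale)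

lemma bounded_linear_restr: "bounded_linear (restr X)"
  by (rule bounded_linear_intro[where K=1])
     (auto intro!: ell2_eqI norm_square_ell2_mono simp: restr.rep_eq plus_ell2.rep_eq scaleR_ell2.rep_eq)

lemma inner_cscale: "inner (cscale c f) g = inner f (cscale (cnj c) g)"
  by (simp add: inner_ell2.rep_eq cscale.rep_eq algebra_simps)

text \<open>Moving the imaginary unit across the product shows that the imaginary part of the
  quadratic form equals its own negative.\<close>

lemma inner_imaginary_eq_0:
  assumes sym: "\<And>g h. inner (S g) h = inner g (S h)" and com: "\<And>c g. S (cscale c g) = cscale c (S g)"
  shows "inner (cscale (-\<i>) (S f)) f = 0"
proof -
  have "inner (cscale (-\<i>) (S f)) f = inner (S f) (cscale \<i> f)" by (simp add: inner_cscale)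
  also have "\<dots> = inner f (cscale \<i> (S f))" by (simp add: sym com)
  also have "cscale \<i> (S f) = - cscale (-\<i>) (S f)"
    by (rule ell2_eqI) (simp add: cscale.rep_eq uminus_ell2.rep_eq)
  finally show ?thesis by (simp add: inner_commute)
qed

lemma fn_in_l2: "restr X f = f \<Longrightarrow> fn f \<in> l2 X"
  unfolding l2_def restr_eq_iff
  using summable_on_subset[OF fn_square_summable[of f], of X] by auto

lemma l2_square_summable:
  assumes "f \<in> l2 X"
  shows "(\<lambda>x. (cmod (f x))\<^sup>2) summable_on UNIV"
proof -
  have "(\<lambda>x. (cmod (f x))\<^sup>2) summable_on X" using assms by (simp add: l2_def)
  then show ?thesis
    by (rule summable_on_cong_neutral[THEN iffD1, rotated -1]) (use assms in \<open>auto simp: l2_def\<close>)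
qed

lemma Abs_ell2_l2:
  assumes "f \<in> l2 X"
  shows "fn (Abs_ell2 f) = f" "restr X (Abs_ell2 f) = Abs_ell2 f"
proof -
  show 1: "fn (Abs_ell2 f) = f" using l2_square_summable[OF assms] by (simp add: Abs_ell2_inverse)
  show "restr X (Abs_ell2 f) = Abs_ell2 f"
    unfolding restr_eq_iff 1 using assms by (auto simp: l2_def)
qed

lemma l2_inner_fn:
  assumes "restr X f = f"
  shows "l2_inner X (fn f) (fn g) = Complex (inner f g) (inner (cscale (-\<i>) f) g)"
proof -
  have "l2_inner X (fn f) (fn g) = (\<Sum>\<^sub>\<infinity>x. fn f x * cnj (fn g x))"
    unfolding l2_inner_def by (rule infsum_cong_neutral) (use assms in \<open>auto simp: restr_eq_iff\<close>)
  moreover have "(\<Sum>\<^sub>\<infinity>x. - \<i> * fn f x * cnj (fn g x)) = - \<i> * (\<Sum>\<^sub>\<infinity>x. fn f x * cnj (fn g x))"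
    unfolding mult.assoc by (rule infsum_cmult_right')
  ultimately show ?thesis
    by (simp add: complex_eq_iff inner_ell2.rep_eq cscale.rep_eq)
qed

lemma l2_norm_fn:
  assumes "restr X f = f"
  shows "l2_norm X (fn f) = norm f"
proof -
  have "(\<Sum>\<^sub>\<infinity>x\<in>X. (cmod (fn f x))\<^sup>2) = (\<Sum>\<^sub>\<infinity>x. (cmod (fn f x))\<^sup>2)"
    by (rule infsum_cong_neutral) (use assms in \<open>auto simp: restr_eq_iff\<close>)
  then show ?thesis by (simp add: l2_norm_def norm_square_ell2[symmetric])
qed

lemma l2_prod_summable:
  assumes "f \<in> l2 X" "g \<in> l2 X"
  shows "(\<lambda>x. f x * cnj (g x)) summable_on X"
  using summable_on_subset[OF square_summable_prod[OF l2_square_summable[OF assms(1)] l2_square_summable[OF assms(2)]]]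
  by blast

lemma l2_inner_add_left:
  assumes "f \<in> l2 X" "g \<in> l2 X" "h \<in> l2 X"
  shows "l2_inner X (\<lambda>x. f x + g x) h = l2_inner X f h + l2_inner X g h"
  unfolding l2_inner_def using assms by (simp add: distrib_right infsum_add l2_prod_summable)

lemma l2_inner_add_right:
  assumes "f \<in> l2 X" "g \<in> l2 X" "h \<in> l2 X"
  shows "l2_inner X h (\<lambda>x. f x + g x) = l2_inner X h f + l2_inner X h g"
  unfolding l2_inner_def using assms by (simp add: distrib_left infsum_add l2_prod_summable)

lemma l2_inner_scale: "l2_inner X (\<lambda>x. c * f x) h = c * l2_inner X f h"
    "l2_inner X f (\<lambda>x. c * h x) = cnj c * l2_inner X f h"
  unfolding l2_inner_def by (simp_all add: mult.assoc mult.left_commute[of _ "cnj c"] infsum_cmult_right')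

lemma l2_closed:
  assumes "f \<in> l2 X" "g \<in> l2 X"
  shows "(\<lambda>x. f x + g x) \<in> l2 X" "(\<lambda>x. c * f x) \<in> l2 X"
proof -
  let ?f = "Abs_ell2 f" and ?g = "Abs_ell2 g"
  have "restr X (?f + ?g) = ?f + ?g" "restr X (cscale c ?f) = cscale c ?f"
    using Abs_ell2_l2[OF assms(1)] Abs_ell2_l2[OF assms(2)]
    by (auto simp: restr_eq_iff plus_ell2.rep_eq cscale.rep_eq)
  from this[THEN fn_in_l2] show "(\<lambda>x. f x + g x) \<in> l2 X" "(\<lambda>x. c * f x) \<in> l2 X"
    by (simp_all add: plus_ell2.rep_eq cscale.rep_eq Abs_ell2_l2[OF assms(1)] Abs_ell2_l2[OF assms(2)])
qed

lemma delta_fun_in_l2: "a \<in> X \<Longrightarrow> delta_fun a \<in> l2 X"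
  unfolding l2_def delta_fun_def
  by (auto intro!: finite_nonzero_values_imp_summable_on finite_subset[of _ "{a}"] split: if_splits)

text \<open>Uniqueness for \<open>borel_calculus\<close>, by polarization: a sesquilinear form that
  vanishes on the diagonal is antisymmetric, and inserting the factor i makes it symmetric as well.
  Delta functions then read off the values; extensionality settles arguments outside
  \<open>l2 X\<close>.\<close>

lemma l2_bounded_op_eqI:
  assumes B: "l2_bounded_op X B" and C: "l2_bounded_op X C"
    and eq: "\<And>f. f \<in> l2 X \<Longrightarrow> l2_inner X (B f) f = l2_inner X (C f) f"
  shows "B = C"
proof (rule extensionalityI[of _ "l2 X"])
  show "B \<in> extensional (l2 X)" "C \<in> extensional (l2 X)"
    using B C by (auto simp: l2_bounded_op_def PiE_def)
  fix f assume f: "f \<in> l2 X"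
  have Bcl: "B h \<in> l2 X" "C h \<in> l2 X" if "h \<in> l2 X" for h
    using B C that by (auto simp: l2_bounded_op_def)
  have add: "A (\<lambda>x. h x + k x) = (\<lambda>x. A h x + A k x)" if "l2_bounded_op X A" "h \<in> l2 X" "k \<in> l2 X" for A h k
    using that by (auto simp: l2_bounded_op_def)
  have scl: "A (\<lambda>x. c * h x) = (\<lambda>x. c * A h x)" if "l2_bounded_op X A" "h \<in> l2 X" for A h c
    using that by (auto simp: l2_bounded_op_def)
  define D where "D h k = l2_inner X (B h) k - l2_inner X (C h) k" for h k
  have D0: "D h h = 0" if "h \<in> l2 X" for h using eq[OF that] by (simp add: D_def)
  have Dadd: "D h k + D k h = 0" if hk: "h \<in> l2 X" "k \<in> l2 X" for h k
  proof -
    have "D (\<lambda>x. h x + k x) (\<lambda>x. h x + k x) = 0" using hk by (intro D0 l2_closed)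
    moreover have "D (\<lambda>x. h x + k x) (\<lambda>x. h x + k x) = D h h + D h k + D k h + D k k"
      using hk by (simp add: D_def add[OF B] add[OF C] l2_inner_add_left l2_inner_add_right Bcl l2_closed algebra_simps)
    ultimately show ?thesis using D0 hk by simp
  qed
  have "D h k = 0" if hk: "h \<in> l2 X" "k \<in> l2 X" for h k
  proof -
    have "D h (\<lambda>x. \<i> * k x) + D (\<lambda>x. \<i> * k x) h = 0" using hk by (intro Dadd l2_closed)
    moreover have "D h (\<lambda>x. \<i> * k x) = - \<i> * D h k" by (simp add: D_def l2_inner_scale algebra_simps)
    moreover have "D (\<lambda>x. \<i> * k x) h = \<i> * D k h"
      using hk by (simp add: D_def scl[OF B] scl[OF C] l2_inner_scale algebra_simps)
    ultimately have "\<i> * (D k h - D h k) = 0" by (simp add: algebra_simps)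
    then show ?thesis using Dadd[OF hk] by simp
  qed
  then have D: "D f (delta_fun x) = 0" if "x \<in> X" for x using f delta_fun_in_l2[OF that] by blast
  have fn: "l2_inner X h (delta_fun x) = h x" if "x \<in> X" for h x
  proof -
    have "l2_inner X h (delta_fun x) = (\<Sum>\<^sub>\<infinity>y\<in>{x}. h y)"
      unfolding l2_inner_def by (rule infsum_cong_neutral) (use that in \<open>auto simp: delta_fun_def\<close>)
    then show ?thesis by simp
  qed
  show "B f = C f"
  proof
    fix x
    show "B f x = C f x"
    proof (cases "x \<in> X")
      case True
      then show ?thesis using D[OF True] by (simp add: D_def fn)
    next
      case False
      then show ?thesis using Bcl[OF f] by (simp add: l2_def)
    qed
  qed
qed

text \<open>Bridge from the Hilbert space type to an operator on functions: commuting with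
  \<open>restr X\<close> makes the functions on \<open>X\<close> an invariant subspace, commuting
  with \<open>cscale\<close> makes the moments real.\<close>

locale l2_operator = positive_op T K for T :: "'a ell2 \<Rightarrow> 'a ell2" and K +
  fixes X :: "'a set" and A :: "('a \<Rightarrow> complex) \<Rightarrow> 'a \<Rightarrow> complex"
  assumes T_cscale: "T (cscale c f) = cscale c (T f)"
    and T_restr: "T (restr X f) = restr X (T f)"
    and A_eq: "restr X f = f \<Longrightarrow> A (fn f) = fn (T f)"
begin

lemma A_power: 
  assumes "restr X f = f"
  shows "(A ^^ n) (fn f) = fn ((T ^^ n) f)" "restr X ((T ^^ n) f) = (T ^^ n) f"
proof -
  have "(A ^^ n) (fn f) = fn ((T ^^ n) f) \<and> restr X ((T ^^ n) f) = (T ^^ n) f"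
    by (induction n) (use assms in \<open>auto simp: A_eq T_restr[symmetric]\<close>)
  then show "(A ^^ n) (fn f) = fn ((T ^^ n) f)" "restr X ((T ^^ n) f) = (T ^^ n) f" by auto
qed

lemma l2_inner_power:
  assumes "restr X f = f"
  shows "l2_inner X ((A ^^ n) (fn f)) (fn f) = complex_of_real (inner ((T ^^ n) f) f)"
proof -
  have sym: "inner ((T ^^ n) g) h = inner g ((T ^^ n) h)" for g h
    using poly_op_symmetric[of "monom 1 n" g h] by (simp add: poly_op_monom)
  have com: "(T ^^ n) (cscale c g) = cscale c ((T ^^ n) g)" for c g
    by (induction n) (auto simp: T_cscale)
  have "inner (cscale (-\<i>) ((T ^^ n) f)) f = 0" by (rule inner_imaginary_eq_0[OF sym com])
  then show ?thesis
    using A_power[OF assms, of n] by (simp add: l2_inner_fn complex_eq_iff)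
qed

text \<open>The moment measure satisfies the description and uniqueness identifies the two; as a
  gain, the described measure is known to live on [0, K].\<close>

lemma spectral_measure_spectral_at:
  assumes f: "restr X f = f"
  shows "spectral_at K f (spectral_measure X A (fn f))"
proof -
  obtain \<nu> where \<nu>: "spectral_at K f \<nu>" using spectral_at_exists by blast
  have "spectral_measure X A (fn f) = \<nu>"
    unfolding spectral_measure_def l2_inner_power[OF f] of_real_eq_iff
  proof (rule the_equality)
    show "sets \<nu> = sets borel \<and> finite_measure \<nu> \<and> (\<exists>K. AE t in \<nu>. \<bar>t\<bar> \<le> K) \<and>
      (\<forall>n::nat. (\<integral>t. t ^ n \<partial>\<nu>) = inner ((T ^^ n) f) f)"
      using \<nu> spectral_at_bounded[OF \<nu>] by (auto simp: spectral_at_def)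
    fix \<nu>' :: "real measure" assume \<nu>': "sets \<nu>' = sets borel \<and> finite_measure \<nu>' \<and> (\<exists>K. AE t in \<nu>'. \<bar>t\<bar> \<le> K) \<and>
      (\<forall>n::nat. (\<integral>t. t ^ n \<partial>\<nu>') = inner ((T ^^ n) f) f)"
    then obtain K' where K': "AE t in \<nu>'. \<bar>t\<bar> \<le> K'" by blast
    show "\<nu>' = \<nu>"
      by (rule moment_measure_unique[OF _ _ K' _ _ spectral_at_bounded[OF \<nu>]])
         (use \<nu> \<nu>' in \<open>auto simp: spectral_at_def\<close>)
  qed
  then show ?thesis using \<nu> by simp
qed

lemma integral_indicator_spectral:
  assumes "spectral_at K f \<nu>"
  shows "(\<integral>t. indicator S t \<partial>\<nu>) = measure \<nu> S"
proof -
  have "space \<nu> = UNIV" using assms unfolding spectral_at_def by (metis sets_eq_imp_space_eq space_borel)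
  then show ?thesis by simp
qed

lemma spectral_projection_inner:
  assumes f: "restr X f = f"
  shows "l2_inner X (spectral_projection X A r (fn f)) (fn f)
    = complex_of_real (measure (spectral_measure X A (fn f)) {..r})"
proof -
  \<comment> \<open>A measure is needed for every vector of the type, including those not supported
    in \<open>X\<close>, where \<open>spectral_measure X A\<close> is not controlled; hence an
    arbitrary choice.\<close>
  define \<nu> where "\<nu> g = (SOME \<nu>. spectral_at K g \<nu>)" for g
  have \<nu>: "spectral_at K g (\<nu> g)" for g
    unfolding \<nu>_def by (rule someI_ex) (rule spectral_at_exists)
  obtain B where B: "bounded_linear B" "\<And>g. inner (B g) g = measure (\<nu> g) {..r}"
      "\<And>g h. inner (B g) h = inner g (B h)"
      "\<And>C y. bounded_linear C \<Longrightarrow> (\<And>y. T (C y) = C (T y)) \<Longrightarrow> B (C y) = C (B y)"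
    using spectral_projection_exists[OF symmetric_op_axioms \<nu>, of r] by blast
  have Bc: "B (cscale c g) = cscale c (B g)" for c g
    by (rule B(4)[OF bounded_linear_cscale T_cscale])
  have Br: "restr X (B g) = B g" if "restr X g = g" for g
    using B(4)[OF bounded_linear_restr[of X] T_restr, of g] that by simp
  have meas: "measure (\<nu> g) {..r} = measure (spectral_measure X A (fn g)) {..r}" if "restr X g = g" for g
  proof -
    have "\<nu> g = spectral_measure X A (fn g)"
      using \<nu>[of g] spectral_measure_spectral_at[OF that]
        moment_measure_unique[OF _ _ spectral_at_bounded[OF \<nu>[of g]] _ _
          spectral_at_bounded[OF spectral_measure_spectral_at[OF that]]]
      by (auto simp: spectral_at_def)
    then show ?thesis by simp
  qed
  \<comment> \<open>Extensional on \<open>l2 X\<close>, so that it is a candidate for the definite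
    description.\<close>
  define P where "P = (\<lambda>h\<in>l2 X. fn (B (Abs_ell2 h)))"
  have P: "P (fn g) = fn (B g)" if "restr X g = g" for g
    using fn_in_l2[OF that] by (simp add: P_def Rep_ell2_inverse)
  obtain M where M: "\<And>g. norm (B g) \<le> norm g * M" using bounded_linear.bounded[OF B(1)] by blast
  have Pin: "P h \<in> l2 X" if "h \<in> l2 X" for h
    using that Br Abs_ell2_l2[OF that] by (simp add: P_def fn_in_l2)
  have "l2_bounded_op X P"
    unfolding l2_bounded_op_def
  proof (intro conjI ballI allI)
    show "P \<in> l2 X \<rightarrow>\<^sub>E l2 X" using Pin by (auto simp: P_def)
    fix h assume h: "h \<in> l2 X"
    note hA = Abs_ell2_l2[OF h]
    show "P (\<lambda>x. c * h x) = (\<lambda>x. c * P h x)" for c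
    proof -
      have 1: "(\<lambda>x. c * h x) = fn (cscale c (Abs_ell2 h))" by (simp add: cscale.rep_eq hA)
      have 2: "restr X (cscale c (Abs_ell2 h)) = cscale c (Abs_ell2 h)"
        using hA by (auto simp: restr_eq_iff cscale.rep_eq)
      show ?thesis unfolding 1 P[OF 2] using P[OF hA(2)] hA by (simp add: Bc cscale.rep_eq)
    qed
    show "P (\<lambda>x. h x + k x) = (\<lambda>x. P h x + P k x)" if k: "k \<in> l2 X" for k
    proof -
      note kA = Abs_ell2_l2[OF k]
      have 1: "(\<lambda>x. h x + k x) = fn (Abs_ell2 h + Abs_ell2 k)" by (simp add: plus_ell2.rep_eq hA kA)
      have 2: "restr X (Abs_ell2 h + Abs_ell2 k) = Abs_ell2 h + Abs_ell2 k"
        using hA kA by (auto simp: restr_eq_iff plus_ell2.rep_eq)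
      show ?thesis unfolding 1 P[OF 2] using P[OF hA(2)] hA P[OF kA(2)] kA
        by (simp add: linear_add[OF bounded_linear.linear[OF B(1)]] plus_ell2.rep_eq)
    qed
  next
    have "l2_norm X (P h) \<le> M * l2_norm X h" if h: "h \<in> l2 X" for h
    proof -
      note hA = Abs_ell2_l2[OF h]
      have "l2_norm X (P (fn (Abs_ell2 h))) \<le> M * l2_norm X (fn (Abs_ell2 h))"
        using M[of "Abs_ell2 h"] by (simp add: P[OF hA(2)] l2_norm_fn[OF hA(2)] l2_norm_fn[OF Br[OF hA(2)]] mult.commute)
      then show ?thesis by (simp add: hA)
    qed
    then show "\<exists>C. \<forall>f\<in>l2 X. l2_norm X (P f) \<le> C * l2_norm X f" by blast
  qed
  moreover have quad: "l2_inner X (P h) h = complex_of_real (measure (spectral_measure X A h) {..r})" if h: "h \<in> l2 X" for h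
  proof -
    define g where "g = Abs_ell2 h"
    have g: "fn g = h" "restr X g = g" using Abs_ell2_l2[OF h] by (auto simp: g_def)
    have "inner (cscale (-\<i>) (B g)) g = 0" by (rule inner_imaginary_eq_0[OF B(3) Bc])
    then have "l2_inner X (P (fn g)) (fn g) = complex_of_real (measure (spectral_measure X A (fn g)) {..r})"
      by (simp add: P[OF g(2)] l2_inner_fn[OF Br[OF g(2)]] B(2) meas[OF g(2)] complex_eq_iff)
    then show ?thesis by (simp add: g(1))
  qed
  moreover have ind: "(\<integral>t. indicator {..r} t \<partial>spectral_measure X A h) = measure (spectral_measure X A h) {..r}"
    if h: "h \<in> l2 X" for h
    using integral_indicator_spectral[OF spectral_measure_spectral_at[OF Abs_ell2_l2(2)[OF h]]]
    by (simp add: Abs_ell2_l2(1)[OF h])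
  ultimately have "spectral_projection X A r = P"
    unfolding spectral_projection_def borel_calculus_def
    by (intro the_equality) (auto intro!: l2_bounded_op_eqI)
  then show ?thesis using quad[OF fn_in_l2[OF f]] by simp
qed

end

section \<open>The Laplace operator\<close>

text \<open>Non-bijective maps get the identity operator, only to make the lift total.\<close>

lift_definition pull :: "('a \<Rightarrow> 'a) \<Rightarrow> 'a ell2 \<Rightarrow> 'a ell2" is "\<lambda>\<pi> f. if bij \<pi> then f \<circ> \<pi> else f"
proof -
  fix \<pi> :: "'a \<Rightarrow> 'a" and f :: "'a \<Rightarrow> complex"
  assume f: "(\<lambda>x. (cmod (f x))\<^sup>2) summable_on UNIV"
  then show "(\<lambda>x. (cmod ((if bij \<pi> then f \<circ> \<pi> else f) x))\<^sup>2) summable_on UNIV"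
    using summable_on_reindex_bij_betw[of \<pi> UNIV UNIV "\<lambda>x. (cmod (f x))\<^sup>2"] by simp
qed

lemma fn_pull: "bij \<pi> \<Longrightarrow> fn (pull \<pi> f) x = fn f (\<pi> x)"
  by (simp add: pull.rep_eq)

lemma inner_pull:
  assumes "bij \<pi>"
  shows "inner (pull \<pi> f) (pull \<pi> g) = inner f g"
  using infsum_reindex_bij_betw[of \<pi> UNIV UNIV "\<lambda>x. fn f x * cnj (fn g x)"] assms
  by (simp add: inner_ell2.rep_eq fn_pull)

lemma norm_pull: "bij \<pi> \<Longrightarrow> norm (pull \<pi> f) = norm f"
  by (simp add: norm_eq_sqrt_inner inner_pull)

lemma bounded_linear_pull: "bij \<pi> \<Longrightarrow> bounded_linear (pull \<pi>)"
  by (rule bounded_linear_intro[where K=1])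
     (auto intro!: ell2_eqI simp: fn_pull plus_ell2.rep_eq scaleR_ell2.rep_eq norm_pull)

definition ell2_delta :: "'a \<Rightarrow> 'a ell2" where "ell2_delta a = Abs_ell2 (delta_fun a)"

lemma fn_delta: "fn (ell2_delta a) x = (if x = a then 1 else 0)"
  using Abs_ell2_l2(1)[OF delta_fun_in_l2[of a UNIV]] by (simp add: ell2_delta_def delta_fun_def)

lemma pmf_has_sum:
  assumes "set_pmf \<mu> \<subseteq> X"
  shows "(pmf \<mu> has_sum 1) X"
proof -
  have "Infinite_Sum.abs_summable_on (pmf \<mu>) X"
    using pmf_abs_summable abs_summable_equivalent by blast
  moreover have "infsum (pmf \<mu>) X = 1"
    using infsetsum_pmf_eq_1[OF assms] infsetsum_infsum[OF pmf_abs_summable[of \<mu> X]] by simp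
  ultimately show ?thesis by (simp add: has_sum_iff)
qed

section \<open>Translations, the Markov operator and the Dirichlet form\<close>

locale random_walk = group G for G (structure) +
  fixes \<mu> :: "'a pmf"
  assumes set_pmf_subset: "set_pmf \<mu> \<subseteq> carrier G"
    and pmf_inv: "\<gamma> \<in> carrier G \<Longrightarrow> pmf \<mu> (inv \<gamma>) = pmf \<mu> \<gamma>"
begin

text \<open>All maps fix the points outside the carrier, so that they act unitarily on the functions on
  the whole type.\<close>

definition rshift :: "'a \<Rightarrow> 'a \<Rightarrow> 'a" where
  "rshift \<gamma> x = (if x \<in> carrier G then x \<otimes> inv \<gamma> else x)"

definition lshift :: "'a \<Rightarrow> 'a \<Rightarrow> 'a" where
  "lshift \<gamma> x = (if x \<in> carrier G then \<gamma> \<otimes> x else x)"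

abbreviation rtrans :: "'a \<Rightarrow> 'a ell2 \<Rightarrow> 'a ell2" where "rtrans \<gamma> \<equiv> pull (rshift \<gamma>)"

lemma rshift_inv: "\<gamma> \<in> carrier G \<Longrightarrow> rshift \<gamma> (rshift (inv \<gamma>) x) = x"
  by (simp add: rshift_def m_assoc)

lemma bij_rshift: "\<gamma> \<in> carrier G \<Longrightarrow> bij (rshift \<gamma>)"
  using rshift_inv[of \<gamma>] rshift_inv[of "inv \<gamma>"] by (intro o_bij[of "rshift (inv \<gamma>)"]) auto

lemma bij_lshift: "\<gamma> \<in> carrier G \<Longrightarrow> bij (lshift \<gamma>)"
  by (intro o_bij[of "lshift (inv \<gamma>)"]) (auto simp: lshift_def m_assoc[symmetric])

lemma rtrans_inv: "\<gamma> \<in> carrier G \<Longrightarrow> rtrans \<gamma> (rtrans (inv \<gamma>) f) = f"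
  using rshift_inv[of "inv \<gamma>"] by (intro ell2_eqI) (simp add: fn_pull bij_rshift)

lemma inner_rtrans:
  assumes "\<gamma> \<in> carrier G"
  shows "inner (rtrans \<gamma> f) g = inner f (rtrans (inv \<gamma>) g)"
proof -
  have "inner (rtrans \<gamma> f) (rtrans \<gamma> (rtrans (inv \<gamma>) g)) = inner f (rtrans (inv \<gamma>) g)"
    using assms by (intro inner_pull bij_rshift)
  then show ?thesis using assms by (simp add: rtrans_inv)
qed

text \<open>A norm-convergent sum of vectors, where \<open>markov_op\<close> sums pointwise; norm
  convergence lets bounded maps pass through the sum, and evaluation at a point is one of
  them.\<close>

definition markov :: "'a ell2 \<Rightarrow> 'a ell2" where
  "markov f = (\<Sum>\<^sub>\<infinity>\<gamma>\<in>carrier G. pmf \<mu> \<gamma> *\<^sub>R rtrans \<gamma> f)"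

definition laplace :: "'a ell2 \<Rightarrow> 'a ell2" where
  "laplace f = f - markov f"

lemma pmf_sum: "(pmf \<mu> has_sum 1) (carrier G)"
  by (rule pmf_has_sum[OF set_pmf_subset])

lemma pmf_norm_sum: "((\<lambda>\<gamma>. norm (pmf \<mu> \<gamma> *\<^sub>R rtrans \<gamma> f)) has_sum norm f) (carrier G)"
proof -
  have "((\<lambda>\<gamma>. pmf \<mu> \<gamma> * norm f) has_sum 1 * norm f) (carrier G)"
    by (intro has_sum_cmult_left pmf_sum)
  then show ?thesis by (subst has_sum_cong) (auto simp: norm_pull bij_rshift)
qed

lemma markov_has_sum: "((\<lambda>\<gamma>. pmf \<mu> \<gamma> *\<^sub>R rtrans \<gamma> f) has_sum markov f) (carrier G)"
  unfolding markov_def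
  by (rule has_sum_infsum[OF Infinite_Sum.abs_summable_summable[OF has_sum_imp_summable[OF pmf_norm_sum]]])

lemma norm_markov_le: "norm (markov f) \<le> norm f"
  using norm_infsum_bound[OF has_sum_imp_summable[OF pmf_norm_sum[of f]]] infsumI[OF pmf_norm_sum[of f]]
  by (simp add: markov_def)

lemma bounded_linear_markov: "bounded_linear markov"
proof (rule bounded_linear_intro[where K=1])
  note lin = bounded_linear.linear[OF bounded_linear_pull[OF bij_rshift]]
  show "markov (f + g) = markov f + markov g" for f g
  proof (rule has_sum_unique[OF markov_has_sum])
    show "((\<lambda>\<gamma>. pmf \<mu> \<gamma> *\<^sub>R rtrans \<gamma> (f + g)) has_sum markov f + markov g) (carrier G)"
      using has_sum_add[OF markov_has_sum[of f] markov_has_sum[of g]]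
      by (subst has_sum_cong) (auto simp: linear_add[OF lin] scaleR_add_right)
  qed
  show "markov (c *\<^sub>R f) = c *\<^sub>R markov f" for c f
  proof (rule has_sum_unique[OF markov_has_sum])
    show "((\<lambda>\<gamma>. pmf \<mu> \<gamma> *\<^sub>R rtrans \<gamma> (c *\<^sub>R f)) has_sum c *\<^sub>R markov f) (carrier G)"
      using has_sum_bounded_linear[OF bounded_linear_scaleR_right[of c] markov_has_sum[of f]]
      by (subst has_sum_cong) (auto simp: linear_scale[OF lin] comp_def)
  qed
qed (use norm_markov_le in auto)

lemma markov_commute:
  assumes "bounded_linear C" "\<And>\<gamma> f. \<gamma> \<in> carrier G \<Longrightarrow> rtrans \<gamma> (C f) = C (rtrans \<gamma> f)"
  shows "markov (C f) = C (markov f)"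
proof (rule has_sum_unique[OF markov_has_sum])
  show "((\<lambda>\<gamma>. pmf \<mu> \<gamma> *\<^sub>R rtrans \<gamma> (C f)) has_sum C (markov f)) (carrier G)"
    using has_sum_bounded_linear[OF assms(1) markov_has_sum[of f]]
    by (subst has_sum_cong) (auto simp: assms(2) linear_scale[OF bounded_linear.linear[OF assms(1)]] comp_def)
qed

lemma laplace_commute:
  assumes "bounded_linear C" "\<And>\<gamma> f. \<gamma> \<in> carrier G \<Longrightarrow> rtrans \<gamma> (C f) = C (rtrans \<gamma> f)"
  shows "laplace (C f) = C (laplace f)"
  by (simp add: laplace_def markov_commute[OF assms] linear_diff[OF bounded_linear.linear[OF assms(1)]])

lemma fn_markov: "((\<lambda>\<gamma>. complex_of_real (pmf \<mu> \<gamma>) * fn f (rshift \<gamma> x)) has_sum fn (markov f) x) (carrier G)"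
  using has_sum_bounded_linear[OF bounded_linear_fn markov_has_sum[of f], of x]
  by (subst has_sum_cong) (auto simp: comp_def scaleR_ell2.rep_eq fn_pull bij_rshift)

lemma inner_markov: "((\<lambda>\<gamma>. pmf \<mu> \<gamma> * inner (rtrans \<gamma> f) g) has_sum inner (markov f) g) (carrier G)"
  using has_sum_bounded_linear[OF bounded_linear_inner_left markov_has_sum[of f], of g]
  by (simp add: comp_def)

text \<open>Replace \<gamma> by its inverse in the sum: the adjoint of a translation is the inverse
  translation, and \<mu> is symmetric.\<close>

lemma markov_symmetric: "inner (markov f) g = inner f (markov g)"
proof (rule has_sum_unique[OF inner_markov])
  have eq: "pmf \<mu> \<gamma> * inner (rtrans \<gamma> f) g = pmf \<mu> (inv \<gamma>) * inner (rtrans (inv \<gamma>) g) f"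
    if "\<gamma> \<in> carrier G" for \<gamma>
    unfolding pmf_inv[OF that] inner_rtrans[OF that, of f g] inner_commute[of f] by simp
  have "((\<lambda>\<gamma>. pmf \<mu> \<gamma> * inner (rtrans \<gamma> g) f) has_sum inner (markov g) f) (carrier G)"
    by (rule inner_markov)
  then have "((\<lambda>\<gamma>. pmf \<mu> (inv \<gamma>) * inner (rtrans (inv \<gamma>) g) f) has_sum inner (markov g) f) (carrier G)"
    by (subst has_sum_reindex_bij_witness[of _ "m_inv G" "m_inv G", where T="carrier G"]) auto
  then show "((\<lambda>\<gamma>. pmf \<mu> \<gamma> * inner (rtrans \<gamma> f) g) has_sum inner f (markov g)) (carrier G)"
    unfolding inner_commute[of f "markov g"]
    by (rule has_sum_cong[OF eq, THEN iffD2, rotated])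
qed

text \<open>Translations are isometric, so for R the translation by \<gamma> half the squared
  difference equals \<langle>f, f\<rangle> - \<langle>R f, f\<rangle>. Each summand can be estimated
  separately, which the energy comparisons below exploit.\<close>

lemma dirichlet_form:
  "((\<lambda>\<gamma>. pmf \<mu> \<gamma> * ((norm (f - rtrans \<gamma> f))\<^sup>2 / 2)) has_sum inner (laplace f) f) (carrier G)"
proof -
  have a: "((\<lambda>\<gamma>. pmf \<mu> \<gamma> * inner f f + - (pmf \<mu> \<gamma> * inner (rtrans \<gamma> f) f)) has_sum
      1 * inner f f + - inner (markov f) f) (carrier G)"
    by (intro has_sum_add has_sum_uminusI has_sum_cmult_left pmf_sum inner_markov)
  have b: "pmf \<mu> \<gamma> * ((norm (f - rtrans \<gamma> f))\<^sup>2 / 2) = pmf \<mu> \<gamma> * inner f f + - (pmf \<mu> \<gamma> * inner (rtrans \<gamma> f) f)"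
    if "\<gamma> \<in> carrier G" for \<gamma>
  proof -
    have n: "(norm (f - rtrans \<gamma> f))\<^sup>2 = 2 * inner f f - 2 * inner (rtrans \<gamma> f) f"
      using that by (simp add: power2_norm_eq_inner inner_diff_left inner_diff_right inner_pull bij_rshift inner_commute)
    show ?thesis unfolding n by (simp add: right_diff_distrib diff_divide_distrib)
  qed
  show ?thesis
    using has_sum_cong[of "carrier G", OF b, THEN iffD2, OF _ a] by (simp add: laplace_def inner_diff_left)
qed

text \<open>The constant 2 arises because the Markov operator is a contraction.\<close>

sublocale laplace: positive_op laplace 2
proof (intro positive_op.intro symmetric_op.intro positive_op_axioms.intro)
  show "bounded_linear laplace"
    unfolding laplace_def by (intro bounded_linear_sub bounded_linear_ident bounded_linear_markov)
  show "inner (laplace f) g = inner f (laplace g)" for f g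
    by (simp add: laplace_def inner_diff_left inner_diff_right markov_symmetric)
  show "0 \<le> inner (laplace f) f" for f
    by (rule has_sum_nonneg[OF dirichlet_form]) auto
  have "\<bar>inner (markov f) f\<bar> \<le> inner f f" for f
    using Cauchy_Schwarz_ineq2[of "markov f" f] norm_markov_le[of f]
      mult_right_mono[OF norm_markov_le[of f] norm_ge_zero[of f]]
    by (simp add: power2_norm_eq_inner[symmetric] power2_eq_square)
  then show "inner (laplace f) f \<le> 2 * inner f f" for f
    using abs_le_D2[of "inner (markov f) f" "inner f f"] by (simp add: laplace_def inner_diff_left)
qed simp

lemma rshift_carrier: "\<gamma> \<in> carrier G \<Longrightarrow> rshift \<gamma> x \<in> carrier G \<longleftrightarrow> x \<in> carrier G"
  by (simp add: rshift_def)

lemma laplace_restr: "laplace (restr (carrier G) f) = restr (carrier G) (laplace f)"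
  by (rule laplace_commute[OF bounded_linear_restr])
     (auto intro!: ell2_eqI simp: fn_pull bij_rshift restr.rep_eq rshift_carrier)

lemma laplace_lshift: "g \<in> carrier G \<Longrightarrow> laplace (pull (lshift g) f) = pull (lshift g) (laplace f)"
  by (rule laplace_commute[OF bounded_linear_pull[OF bij_lshift]])
     (auto intro!: ell2_eqI simp: fn_pull bij_rshift bij_lshift rshift_def lshift_def m_assoc)

sublocale laplace: l2_operator laplace 2 "carrier G" "laplace_op G \<mu>"
proof (intro l2_operator.intro l2_operator_axioms.intro laplace.positive_op_axioms)
  show "laplace (cscale c f) = cscale c (laplace f)" for c f
    by (rule laplace_commute[OF bounded_linear_cscale])
       (auto intro!: ell2_eqI simp: fn_pull bij_rshift cscale.rep_eq)
  show "laplace (restr (carrier G) f) = restr (carrier G) (laplace f)" for f by (rule laplace_restr)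
  fix f assume f: "restr (carrier G) f = f"
  have m: "markov_op G \<mu> (fn f) x = fn (markov f) x" for x
  proof (cases "x \<in> carrier G")
    case True
    then show ?thesis using fn_in_l2[OF f] infsumI[OF fn_markov[of f x]]
      by (simp add: markov_op_def rshift_def mult.commute)
  next
    case False
    \<comment> \<open>Outside the carrier \<open>markov_op\<close> is 0 by definition;
      \<open>markov f\<close> vanishes there because the Laplacian preserves functions supported on
      the carrier.\<close>
    have "fn (laplace f) x = 0" using laplace_restr[of f, symmetric] f False by (simp add: restr_eq_iff)
    moreover have "fn f x = 0" using f False by (simp add: restr_eq_iff)
    ultimately show ?thesis using False fn_in_l2[OF f]
      by (simp add: markov_op_def laplace_def minus_ell2.rep_eq)
  qed
  show "laplace_op G \<mu> (fn f) = fn (laplace f)"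
    using fn_in_l2[OF f] m by (auto simp: laplace_op_def laplace_def minus_ell2.rep_eq)
qed

lemma delta_supported: "a \<in> X \<Longrightarrow> restr X (ell2_delta a) = ell2_delta a"
  by (auto simp: restr_eq_iff fn_delta)

definition spec :: "'a ell2 \<Rightarrow> real measure" where
  "spec f = spectral_measure (carrier G) (laplace_op G \<mu>) (fn f)"

lemma spec_spectral_at: "restr (carrier G) f = f \<Longrightarrow> laplace.spectral_at 2 f (spec f)"
  unfolding spec_def by (rule laplace.spectral_measure_spectral_at)

lemma spectral_distribution_eq: "spectral_distribution G \<mu> r = measure (spec (ell2_delta \<one>)) {..r}"
proof -
  have "fn (ell2_delta \<one>) = delta_fun \<one>" by (auto simp: fn_delta delta_fun_def)
  then show ?thesis
    using laplace.spectral_projection_inner[OF delta_supported[of "\<one>"], of r]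
    by (simp add: spectral_distribution_def vn_trace_def spec_def)
qed

end

section \<open>The isoperimetric profile and the lower bound\<close>

context random_walk
begin

abbreviation supp :: "'a ell2 \<Rightarrow> 'a set" where "supp f \<equiv> {x. fn f x \<noteq> 0}"

lemma first_eigenvalue_eq:
  assumes "\<Omega> \<subseteq> carrier G"
  shows "first_eigenvalue G \<mu> \<Omega> = Inf {inner (laplace f) f / (norm f)\<^sup>2 | f. f \<noteq> 0 \<and> supp f \<subseteq> \<Omega>}"
proof -
  have nz: "supp f \<noteq> {} \<longleftrightarrow> f \<noteq> 0" for f
    by (auto simp: Rep_ell2_inject[symmetric] zero_ell2.rep_eq fun_eq_iff)
  have val: "Re (l2_inner (carrier G) (laplace_op G \<mu> (fn f)) (fn f)) / (l2_norm (carrier G) (fn f))\<^sup>2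
      = inner (laplace f) f / (norm f)\<^sup>2" and l2: "fn f \<in> l2 (carrier G)" if "supp f \<subseteq> \<Omega>" for f
  proof -
    have f: "restr (carrier G) f = f" using that assms by (auto simp: restr_eq_iff)
    have "restr (carrier G) (laplace f) = laplace f" using laplace_restr[of f] f by simp
    then show "Re (l2_inner (carrier G) (laplace_op G \<mu> (fn f)) (fn f)) / (l2_norm (carrier G) (fn f))\<^sup>2
      = inner (laplace f) f / (norm f)\<^sup>2"
      by (simp add: laplace.A_eq[OF f] l2_inner_fn l2_norm_fn[OF f])
    show "fn f \<in> l2 (carrier G)" by (rule fn_in_l2[OF f])
  qed
  have "{Re (l2_inner (carrier G) (laplace_op G \<mu> f) f) / (l2_norm (carrier G) f)\<^sup>2 | f.
            f \<in> l2 (carrier G) \<and> {x. f x \<noteq> 0} \<noteq> {} \<and> {x. f x \<noteq> 0} \<subseteq> \<Omega>}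
     = {inner (laplace f) f / (norm f)\<^sup>2 | f. f \<noteq> 0 \<and> supp f \<subseteq> \<Omega>}" (is "?L = ?R")
  proof (intro equalityI subsetI)
    fix v assume "v \<in> ?L"
    then obtain f where f: "v = Re (l2_inner (carrier G) (laplace_op G \<mu> f) f) / (l2_norm (carrier G) f)\<^sup>2"
      "f \<in> l2 (carrier G)" "{x. f x \<noteq> 0} \<noteq> {}" "{x. f x \<noteq> 0} \<subseteq> \<Omega>" by blast
    define g where "g = Abs_ell2 f"
    have g: "fn g = f" unfolding g_def by (rule Abs_ell2_l2(1)[OF f(2)])
    have "v = inner (laplace g) g / (norm g)\<^sup>2" using val[of g] f g by simp
    moreover have "g \<noteq> 0" using nz[of g] f(3) g by simp
    ultimately show "v \<in> ?R" using f(4) g by blast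
  next
    fix v assume "v \<in> ?R"
    then obtain f where f: "v = inner (laplace f) f / (norm f)\<^sup>2" "f \<noteq> 0" "supp f \<subseteq> \<Omega>" by blast
    then show "v \<in> ?L" using val[OF f(3)] l2[OF f(3)] nz[of f] by (intro CollectI exI[of _ "fn f"]) auto
  qed
  then show ?thesis by (simp add: first_eigenvalue_def)
qed

abbreviation profile :: "real \<Rightarrow> real" where "profile \<equiv> l2_isoperimetric_profile G \<mu>"

lemma quotient_nonneg: "0 \<le> inner (laplace f) f / (norm f)\<^sup>2"
  using laplace.nonneg by simp

lemma delta_nz: "ell2_delta a \<noteq> 0" "supp (ell2_delta a) = {a}"
  by (auto simp: fn_delta zero_ell2.rep_eq dest!: arg_cong[of _ 0 "\<lambda>f. fn f a"])

lemma quotients_nonempty: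
  assumes "\<Omega> \<noteq> {}"
  shows "{inner (laplace f) f / (norm f)\<^sup>2 | f. f \<noteq> 0 \<and> supp f \<subseteq> \<Omega>} \<noteq> {}"
proof -
  obtain a where "a \<in> \<Omega>" using assms by auto
  then have "ell2_delta a \<noteq> 0 \<and> supp (ell2_delta a) \<subseteq> \<Omega>" using delta_nz[of a] by simp
  then have "inner (laplace (ell2_delta a)) (ell2_delta a) / (norm (ell2_delta a))\<^sup>2
      \<in> {inner (laplace f) f / (norm f)\<^sup>2 | f. f \<noteq> 0 \<and> supp f \<subseteq> \<Omega>}"
    by (intro CollectI exI[of _ "ell2_delta a"] conjI refl) simp_all
  then show ?thesis by (rule ex_in_conv[THEN iffD1, OF exI])
qed

lemma first_eigenvalue_le:
  assumes "\<Omega> \<subseteq> carrier G" "f \<noteq> 0" "supp f \<subseteq> \<Omega>"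
  shows "first_eigenvalue G \<mu> \<Omega> \<le> inner (laplace f) f / (norm f)\<^sup>2"
  unfolding first_eigenvalue_eq[OF assms(1)]
  by (rule cInf_lower) (use assms quotient_nonneg in \<open>auto intro!: bdd_belowI[of _ 0]\<close>)

lemma first_eigenvalue_ge:
  assumes "\<Omega> \<subseteq> carrier G" "\<Omega> \<noteq> {}" "\<And>f. supp f \<subseteq> \<Omega> \<Longrightarrow> \<kappa> * (norm f)\<^sup>2 \<le> inner (laplace f) f"
  shows "\<kappa> \<le> first_eigenvalue G \<mu> \<Omega>"
  unfolding first_eigenvalue_eq[OF assms(1)]
  by (rule cInf_greatest[OF quotients_nonempty]) (use assms in \<open>auto simp: le_divide_eq\<close>)

lemma first_eigenvalue_nonneg: "\<Omega> \<subseteq> carrier G \<Longrightarrow> \<Omega> \<noteq> {} \<Longrightarrow> 0 \<le> first_eigenvalue G \<mu> \<Omega>"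
  by (rule first_eigenvalue_ge) (use laplace.nonneg in auto)

lemma profile_le:
  assumes "\<Omega> \<subseteq> carrier G" "finite \<Omega>" "\<Omega> \<noteq> {}" "real (card \<Omega>) \<le> v"
  shows "profile v \<le> first_eigenvalue G \<mu> \<Omega>"
  unfolding l2_isoperimetric_profile_def
proof (rule cInf_lower)
  show "bdd_below {first_eigenvalue G \<mu> \<Omega> |\<Omega>. \<Omega> \<subseteq> carrier G \<and> finite \<Omega> \<and> 1 \<le> card \<Omega> \<and> real (card \<Omega>) \<le> v}"
    by (rule bdd_belowI[of _ 0]) (auto intro!: first_eigenvalue_nonneg)
  have "1 \<le> card \<Omega>" using assms by (simp add: Suc_le_eq card_gt_0_iff)
  then show "first_eigenvalue G \<mu> \<Omega> \<in> {first_eigenvalue G \<mu> \<Omega> |\<Omega>. \<Omega> \<subseteq> carrier G \<and> finite \<Omega> \<and> 1 \<le> card \<Omega> \<and> real (card \<Omega>) \<le> v}"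
    using assms by blast
qed

lemma eigenvalues_nonempty:
  "1 \<le> v \<Longrightarrow> {first_eigenvalue G \<mu> \<Omega> |\<Omega>. \<Omega> \<subseteq> carrier G \<and> finite \<Omega> \<and> 1 \<le> card \<Omega> \<and> real (card \<Omega>) \<le> v} \<noteq> {}"
  by (auto intro!: exI[of _ "{\<one>}"])

lemma profile_ge:
  assumes "1 \<le> v" "\<And>\<Omega>. \<Omega> \<subseteq> carrier G \<Longrightarrow> finite \<Omega> \<Longrightarrow> \<Omega> \<noteq> {} \<Longrightarrow> real (card \<Omega>) \<le> v \<Longrightarrow> \<kappa> \<le> first_eigenvalue G \<mu> \<Omega>"
  shows "\<kappa> \<le> profile v"
  unfolding l2_isoperimetric_profile_def
  by (rule cInf_greatest[OF eigenvalues_nonempty]) (use assms in \<open>auto simp: Suc_le_eq card_gt_0_iff\<close>)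

lemma profile_antimono:
  assumes "1 \<le> v" "v \<le> w"
  shows "profile w \<le> profile v"
  by (rule profile_ge) (use assms in \<open>auto intro!: profile_le\<close>)

lemma profile_mult_norm_le:
  assumes "finite (supp f)" "supp f \<subseteq> carrier G" "real (card (supp f)) \<le> v"
  shows "profile v * (norm f)\<^sup>2 \<le> inner (laplace f) f"
proof (cases "f = 0")
  case True
  then show ?thesis using laplace.nonneg[of f] by simp
next
  case False
  then have "supp f \<noteq> {}" by (auto simp: Rep_ell2_inject[symmetric] zero_ell2.rep_eq fun_eq_iff)
  then have "profile v \<le> inner (laplace f) f / (norm f)\<^sup>2"
    using profile_le[OF assms(2,1) _ assms(3)] first_eigenvalue_le[OF assms(2) False] by force
  then show ?thesis using False by (simp add: le_divide_eq)
qed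

lemma profile_test_function:
  assumes "1 \<le> v" "profile v < a"
  shows "\<exists>f. f \<noteq> 0 \<and> finite (supp f) \<and> supp f \<subseteq> carrier G \<and> real (card (supp f)) \<le> v \<and> inner (laplace f) f < a * (norm f)\<^sup>2"
proof -
  obtain \<Omega> where \<Omega>: "\<Omega> \<subseteq> carrier G" "finite \<Omega>" "1 \<le> card \<Omega>" "real (card \<Omega>) \<le> v" "first_eigenvalue G \<mu> \<Omega> < a"
    using cInf_lessD[OF eigenvalues_nonempty[OF assms(1)]] assms(2) unfolding l2_isoperimetric_profile_def by blast
  have ne: "\<Omega> \<noteq> {}" using \<Omega>(3) by auto
  obtain f where f: "f \<noteq> 0" "supp f \<subseteq> \<Omega>" "inner (laplace f) f / (norm f)\<^sup>2 < a"
    using cInf_lessD[OF quotients_nonempty[OF ne]] \<Omega>(5) unfolding first_eigenvalue_eq[OF \<Omega>(1)] by blast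
  have "card (supp f) \<le> card \<Omega>" using f(2) \<Omega>(2) by (rule card_mono[rotated])
  then show ?thesis using f \<Omega> finite_subset[OF f(2) \<Omega>(2)]
    by (intro exI[of _ f]) (auto simp: divide_less_eq)
qed

text \<open>Left translations commute with the Laplacian and carry one delta function to the other,
  so all moments agree. This is the invariance of the trace used in the lower bound.\<close>

lemma spec_translate:
  assumes x: "x \<in> carrier G"
  shows "spec (ell2_delta x) = spec (ell2_delta \<one>)"
proof -
  let ?L = "pull (lshift (inv x))"
  have d: "ell2_delta x = ?L (ell2_delta \<one>)"
  proof (rule ell2_eqI)
    fix y
    have "inv x \<otimes> y = \<one> \<longleftrightarrow> y = x" if "y \<in> carrier G"
      using inv_solve_left[of \<one> x y] that x by (auto simp: eq_commute[of \<one>])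
    then show "fn (ell2_delta x) y = fn (?L (ell2_delta \<one>)) y"
      using x by (auto simp: fn_pull bij_lshift fn_delta lshift_def)
  qed
  have "(laplace ^^ n) (?L f) = ?L ((laplace ^^ n) f)" for n f
    by (induction n) (auto simp: laplace_lshift x)
  then have mom: "inner ((laplace ^^ n) (ell2_delta x)) (ell2_delta x) = inner ((laplace ^^ n) (ell2_delta \<one>)) (ell2_delta \<one>)" for n
    unfolding d using x by (simp add: inner_pull bij_lshift)
  note s1 = spec_spectral_at[OF delta_supported[OF x]] and s2 = spec_spectral_at[OF delta_supported[OF one_closed]]
  show ?thesis
    by (rule moment_measure_unique[OF _ _ laplace.spectral_at_bounded[OF s1] _ _ laplace.spectral_at_bounded[OF s2]])
       (use s1 s2 mom in \<open>auto simp: laplace.spectral_at_def\<close>)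
qed

text \<open>Homogeneity of the norm of a spectral projection, read off from the polynomials, which
  commute with complex scalars.\<close>

lemma cscale_spectral_at:
  assumes "laplace.spectral_at 2 f \<nu>" "laplace.spectral_at 2 (cscale c f) \<nu>'"
  shows "sqrt (measure \<nu>' {..r}) = cmod c * sqrt (measure \<nu> {..r})"
proof -
  obtain p where p: "\<forall>x \<nu>. laplace.spectral_at 2 x \<nu> \<longrightarrow>
     (\<lambda>k. inner (poly_op laplace (p k) x) x) \<longlonglongrightarrow> measure \<nu> {..r} \<and>
     (\<lambda>k. norm (poly_op laplace (p k) x)) \<longlonglongrightarrow> sqrt (measure \<nu> {..r}) \<and>
     Cauchy (\<lambda>k. poly_op laplace (p k) x) \<and>
     (\<forall>k. norm (poly_op laplace (p k) x) \<le> 2 * norm x)"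
    using laplace.poly_op_approx_projection[of 2 r] by (rule exE)
  note q = p[rule_format, THEN conjunct2, THEN conjunct1]
  have "(\<lambda>k. cmod c * norm (poly_op laplace (p k) f)) \<longlonglongrightarrow> cmod c * sqrt (measure \<nu> {..r})"
    by (intro tendsto_mult_left q assms(1))
  moreover have "norm (poly_op laplace (p k) (cscale c f)) = cmod c * norm (poly_op laplace (p k) f)" for k
    by (simp add: laplace.poly_op_commute[OF bounded_linear.linear[OF bounded_linear_cscale] laplace.T_cscale] norm_cscale)
  ultimately show ?thesis using LIMSEQ_unique[OF q[OF assms(2)]] by simp
qed

text \<open>Expand \<open>f\<close> into delta functions. The triangle inequality for the projection
  and translation invariance bound the square root of the mass by the sum of |f x| times sqrt (N r);
  Cauchy-Schwarz on the support then trades that sum for the norm.\<close>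

lemma spec_le_card_trace:
  assumes fin: "finite (supp f)" and supp: "supp f \<subseteq> carrier G"
  shows "measure (spec f) {..r} \<le> real (card (supp f)) * (norm f)\<^sup>2 * spectral_distribution G \<mu> r"
proof -
  let ?S = "supp f" and ?N = "spectral_distribution G \<mu> r"
  have N0: "0 \<le> ?N" by (simp add: spectral_distribution_eq)
  have fn_sum: "fn (\<Sum>i\<in>I. h i) y = (\<Sum>i\<in>I. fn (h i) y)" for I y and h :: "'a \<Rightarrow> 'a ell2"
    by (induction I rule: infinite_finite_induct) (auto simp: zero_ell2.rep_eq plus_ell2.rep_eq)
  have f: "f = (\<Sum>x\<in>?S. cscale (fn f x) (ell2_delta x))"
    by (rule ell2_eqI) (use fin in \<open>auto simp: fn_sum cscale.rep_eq fn_delta sum.delta if_distrib[of "\<lambda>z. _ * z"] cong: if_cong\<close>)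
  have rf: "restr (carrier G) f = f" using supp by (auto simp: restr_eq_iff)
  have sx: "laplace.spectral_at 2 (cscale (fn f x) (ell2_delta x)) (spec (cscale (fn f x) (ell2_delta x)))" if "x \<in> ?S" for x
    using that supp by (intro spec_spectral_at) (auto simp: restr_eq_iff cscale.rep_eq fn_delta)
  have "sqrt (measure (spec f) {..r}) \<le> (\<Sum>x\<in>?S. sqrt (measure (spec (cscale (fn f x) (ell2_delta x))) {..r}))"
    by (rule laplace.sqrt_spectral_sum_le[where K=2]) (use f spec_spectral_at[OF rf] sx in auto)
  also have "\<dots> = (\<Sum>x\<in>?S. cmod (fn f x) * sqrt ?N)"
  proof (rule sum.cong)
    fix x assume x: "x \<in> ?S"
    then have xc: "x \<in> carrier G" using supp by auto
    show "sqrt (measure (spec (cscale (fn f x) (ell2_delta x))) {..r}) = cmod (fn f x) * sqrt ?N"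
      using cscale_spectral_at[OF spec_spectral_at[OF delta_supported[OF xc]] sx[OF x]]
      by (simp add: spectral_distribution_eq spec_translate[OF xc])
  qed simp
  finally have 1: "sqrt (measure (spec f) {..r}) \<le> (\<Sum>x\<in>?S. cmod (fn f x)) * sqrt ?N"
    by (simp add: sum_distrib_right)
  have 2: "(\<Sum>x\<in>?S. cmod (fn f x))\<^sup>2 \<le> real (card ?S) * (norm f)\<^sup>2"
  proof -
    have "(\<Sum>x\<in>?S. cmod (fn f x) * 1)\<^sup>2 \<le> (\<Sum>x\<in>?S. (cmod (fn f x))\<^sup>2) * (\<Sum>x\<in>?S. 1\<^sup>2)"
      by (rule Cauchy_Schwarz_ineq_sum)
    also have "\<dots> \<le> (norm f)\<^sup>2 * real (card ?S)"
      using sum_square_le_norm_square[OF fin, of f] by (simp add: mult_right_mono)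
    finally show ?thesis by (simp add: mult.commute)
  qed
  have "measure (spec f) {..r} = (sqrt (measure (spec f) {..r}))\<^sup>2" by simp
  also have "\<dots> \<le> ((\<Sum>x\<in>?S. cmod (fn f x)) * sqrt ?N)\<^sup>2" by (rule power_mono[OF 1]) simp
  also have "\<dots> = (\<Sum>x\<in>?S. cmod (fn f x))\<^sup>2 * ?N" using N0 by (simp add: power_mult_distrib)
  also have "\<dots> \<le> real (card ?S) * (norm f)\<^sup>2 * ?N" by (rule mult_right_mono[OF 2 N0])
  finally show ?thesis .
qed

text \<open>Markov's inequality for the spectral measure: its total mass is
  \<open>(norm f)\<^sup>2\<close>, its first moment is the energy, and it lives on nonnegative
  numbers.\<close>

lemma spec_markov_bound:
  assumes f: "restr (carrier G) f = f" and a: "0 < a"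
  shows "(norm f)\<^sup>2 - inner (laplace f) f / a \<le> measure (spec f) {..a}"
proof -
  note s = spec_spectral_at[OF f]
  interpret finite_measure "spec f" using s by (simp add: laplace.spectral_at_def)
  have sets: "sets (spec f) = sets borel" using s by (simp add: laplace.spectral_at_def)
  note [measurable_cong] = sets
  have sp: "space (spec f) = UNIV" using sets by (metis sets_eq_imp_space_eq space_borel)
  have int: "integrable (spec f) (\<lambda>t. t)"
  proof -
    have "poly [:0, 1:] = (\<lambda>t::real. t)" by auto
    then show ?thesis
      using integral_poly_moments(1)[OF sets finite_measure_axioms laplace.spectral_at_bounded[OF s], of "[:0,1:]"]
      by (simp only:)
  qed
  have "(\<integral>t. t ^ 1 \<partial>spec f) = inner ((laplace ^^ 1) f) f" using s unfolding laplace.spectral_at_def by blast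
  then have e: "(\<integral>t. t \<partial>spec f) = inner (laplace f) f" by simp
  have ind: "integrable (spec f) (indicator {..a} :: real \<Rightarrow> real)"
    by (rule integrable_const_bound[of _ 1]) (auto simp: indicator_def)
  have "(\<integral>t. a * (1 - indicator {..a} t) \<partial>spec f) \<le> (\<integral>t. t \<partial>spec f)"
  proof (rule integral_mono_AE[OF _ int])
    have "AE t in spec f. 0 \<le> t \<and> t \<le> 2" using s by (simp add: laplace.spectral_at_def)
    then show "AE t in spec f. a * (1 - indicator {..a} t) \<le> t"
      by eventually_elim (auto simp: indicator_def)
  qed (use ind in simp)
  also have "(\<integral>t. a * (1 - indicator {..a} t) \<partial>spec f) = a * ((norm f)\<^sup>2 - measure (spec f) {..a})"
    using laplace.spectral_at_mass[OF s] sp ind by simp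
  finally show ?thesis using a by (simp add: e field_simps)
qed

lemma distribution_lower_bound:
  assumes v: "1 \<le> v" and a: "0 < a" and p: "profile v < a"
  shows "1 / (2 * v) \<le> spectral_distribution G \<mu> (2 * a)"
proof -
  let ?N = "spectral_distribution G \<mu> (2 * a)"
  obtain f where f: "f \<noteq> 0" "finite (supp f)" "supp f \<subseteq> carrier G" "real (card (supp f)) \<le> v" "inner (laplace f) f < a * (norm f)\<^sup>2"
    using profile_test_function[OF v p] by blast
  have rf: "restr (carrier G) f = f" using f(3) by (auto simp: restr_eq_iff)
  have N0: "0 \<le> ?N" by (simp add: spectral_distribution_eq)
  have nf: "0 < (norm f)\<^sup>2" using f(1) by simp
  have "inner (laplace f) f / (2 * a) \<le> (norm f)\<^sup>2 / 2" using f(5) a by (simp add: field_simps)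
  then have "(norm f)\<^sup>2 / 2 \<le> measure (spec f) {..2 * a}" using spec_markov_bound[OF rf, of "2 * a"] a by simp
  also have "\<dots> \<le> real (card (supp f)) * (norm f)\<^sup>2 * ?N" by (rule spec_le_card_trace[OF f(2,3)])
  also have "\<dots> \<le> v * (norm f)\<^sup>2 * ?N" using f(4) N0 by (intro mult_right_mono) auto
  finally have "(norm f)\<^sup>2 * (1 / 2) \<le> (norm f)\<^sup>2 * (v * ?N)" by (simp add: mult_ac)
  then have "1 / 2 \<le> v * ?N" using nf by simp
  then show ?thesis using v by (simp add: field_simps)
qed

end

section \<open>The Nash inequality and the upper bound\<close>

context random_walk
begin

text \<open>Total mass at most 1 is put through finite partial sums. It is the l1 input that the
  Nash inequality balances against the l2 norm.\<close>

definition subprob :: "'a ell2 \<Rightarrow> bool" where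
  "subprob f \<longleftrightarrow> (\<forall>x. Im (fn f x) = 0 \<and> 0 \<le> Re (fn f x)) \<and> (\<forall>F. finite F \<longrightarrow> (\<Sum>x\<in>F. Re (fn f x)) \<le> 1)"

lemma subprob_norm_le:
  assumes "subprob f"
  shows "(norm f)\<^sup>2 \<le> 1"
proof (rule norm_square_ell2_leI)
  fix F :: "'a set" assume F: "finite F"
  have "(\<Sum>x\<in>F. (cmod (fn f x))\<^sup>2) \<le> (\<Sum>x\<in>F. Re (fn f x))"
  proof (rule sum_mono)
    fix x
    have "0 \<le> Re (fn f x)" "Im (fn f x) = 0" using assms by (auto simp: subprob_def)
    moreover have "Re (fn f x) \<le> 1" using assms[unfolded subprob_def, THEN conjunct2, rule_format, of "{x}"] by simp
    ultimately show "(cmod (fn f x))\<^sup>2 \<le> Re (fn f x)"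
      using mult_left_mono[of "Re (fn f x)" 1 "Re (fn f x)"] unfolding cmod_power2 by (simp add: power2_eq_square)
  qed
  also have "\<dots> \<le> 1" using assms F by (simp add: subprob_def)
  finally show "(\<Sum>x\<in>F. (cmod (fn f x))\<^sup>2) \<le> 1" .
qed

text \<open>Nash inequality: truncate at height \<open>s = \<parallel>f\<parallel>\<^sup>2 / 4\<close>; truncation does not increase the energy, loses at most
  half of the mass, and leaves a support of at most \<open>1 / s\<close> points.\<close>

lemma nash_inequality:
  assumes f: "subprob f" and sup: "restr (carrier G) f = f" and nz: "f \<noteq> 0"
  shows "(norm f)\<^sup>2 / 2 * profile (4 / (norm f)\<^sup>2) \<le> inner (laplace f) f"
proof -
  define u where "u = (norm f)\<^sup>2"
  define s where "s = u / 4"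
  have u: "0 < u" "u \<le> 1" using nz subprob_norm_le[OF f] by (auto simp: u_def)
  have s: "0 < s" using u by (simp add: s_def)
  have f0: "0 \<le> Re (fn f x)" "Im (fn f x) = 0" for x using f by (auto simp: subprob_def)
  have f1: "(\<Sum>x\<in>F. Re (fn f x)) \<le> 1" if "finite F" for F using f that by (auto simp: subprob_def)
  define g where "g = Abs_ell2 (\<lambda>x. complex_of_real (max 0 (Re (fn f x) - s)))"
  have g: "fn g x = complex_of_real (max 0 (Re (fn f x) - s))" for x
  proof -
    have "(\<lambda>x. (cmod (complex_of_real (max 0 (Re (fn f x) - s))))\<^sup>2) summable_on UNIV"
    proof (rule summable_on_comparison_test[OF fn_square_summable[of f]])
      fix x
      have "max 0 (Re (fn f x) - s) \<le> cmod (fn f x)" using complex_Re_le_cmod[of "fn f x"] s by auto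
      then show "(cmod (complex_of_real (max 0 (Re (fn f x) - s))))\<^sup>2 \<le> (cmod (fn f x))\<^sup>2"
        by (intro power_mono) auto
    qed auto
    then show ?thesis by (simp add: g_def Abs_ell2_inverse)
  qed
  have supp: "supp g = {x. s < Re (fn f x)}" by (auto simp: g max_def)
  \<comment> \<open>Chebyshev's argument: on the support of \<open>g\<close> the values of
    \<open>f\<close> exceed s, and they add up to at most 1.\<close>
  have "finite (supp g) \<and> card (supp g) \<le> nat \<lfloor>1 / s\<rfloor>"
  proof (rule finite_if_finite_subsets_card_bdd)
    fix F assume F: "F \<subseteq> supp g" "finite F"
    have "real (card F) * s \<le> (\<Sum>x\<in>F. Re (fn f x))"
      using F sum_bounded_below[of F s "\<lambda>x. Re (fn f x)"] by (force simp: supp)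
    also have "\<dots> \<le> 1" by (rule f1[OF F(2)])
    finally have "real (card F) \<le> 1 / s" using s by (simp add: field_simps)
    then show "card F \<le> nat \<lfloor>1 / s\<rfloor>" by (simp add: le_nat_floor)
  qed
  then have fin: "finite (supp g)" and "card (supp g) \<le> nat \<lfloor>1 / s\<rfloor>" by auto
  then have "real (card (supp g)) \<le> real (nat \<lfloor>1 / s\<rfloor>)" by linarith
  also have "\<dots> \<le> 1 / s" using s by (simp add: of_nat_floor)
  finally have card: "real (card (supp g)) \<le> 4 / u" by (simp add: s_def)
  have "x \<in> carrier G" if "s < Re (fn f x)" for x
    using sup that s by (auto simp: restr_eq_iff dest!: spec[of _ x])
  then have "supp g \<subseteq> carrier G" using supp by auto
  then have 1: "profile (4 / u) * (norm g)\<^sup>2 \<le> inner (laplace g) g"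
    by (intro profile_mult_norm_le fin card)
  have 2: "inner (laplace g) g \<le> inner (laplace f) f"
  proof (rule has_sum_mono[OF dirichlet_form dirichlet_form])
    fix \<gamma> assume \<gamma>: "\<gamma> \<in> carrier G"
    \<comment> \<open>Subtracting s and cutting at 0 is a 1-Lipschitz operation, so every difference
      in the Dirichlet form shrinks pointwise.\<close>
    have "norm (g - rtrans \<gamma> g) \<le> norm (f - rtrans \<gamma> f)"
    proof (rule norm_square_ell2_mono)
      fix x
      let ?a = "Re (fn f x)" and ?b = "Re (fn f (rshift \<gamma> x))"
      have "cmod (fn (g - rtrans \<gamma> g) x) = \<bar>max 0 (?a - s) - max 0 (?b - s)\<bar>"
        using \<gamma> by (simp add: minus_ell2.rep_eq fn_pull bij_rshift g flip: of_real_diff)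
      also have "\<dots> \<le> \<bar>?a - ?b\<bar>" by (auto simp: max_def abs_if)
      also have "\<dots> = \<bar>Re (fn f x - fn f (rshift \<gamma> x))\<bar>" by simp
      also have "\<dots> \<le> cmod (fn f x - fn f (rshift \<gamma> x))" by (rule abs_Re_le_cmod)
      finally show "cmod (fn (g - rtrans \<gamma> g) x) \<le> cmod (fn (f - rtrans \<gamma> f) x)"
        using \<gamma> by (simp add: minus_ell2.rep_eq fn_pull bij_rshift)
    qed
    then show "pmf \<mu> \<gamma> * ((norm (g - rtrans \<gamma> g))\<^sup>2 / 2) \<le> pmf \<mu> \<gamma> * ((norm (f - rtrans \<gamma> f))\<^sup>2 / 2)"
      by (intro mult_left_mono divide_right_mono power_mono) auto
  qed
  have "u \<le> (norm g)\<^sup>2 + 2 * s"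
    unfolding u_def
  proof (rule norm_square_ell2_leI)
    fix F :: "'a set" assume F: "finite F"
    \<comment> \<open>Since the total mass of \<open>f\<close> is at most 1, summing this inequality
      loses at most 2 s = u / 2.\<close>
    have pt: "(cmod (fn f x))\<^sup>2 \<le> (cmod (fn g x))\<^sup>2 + 2 * s * Re (fn f x)" for x
    proof -
      let ?a = "Re (fn f x)"
      have "?a\<^sup>2 \<le> (max 0 (?a - s))\<^sup>2 + 2 * s * ?a"
      proof (cases "s \<le> ?a")
        case True
        then show ?thesis by (simp add: power2_diff)
      next
        case False
        then show ?thesis using f0(1)[of x] mult_right_mono[of ?a "2 * s" ?a] s by (simp add: power2_eq_square)
      qed
      then show ?thesis using f0[of x] by (simp add: g cmod_power2)
    qed
    have "(\<Sum>x\<in>F. (cmod (fn f x))\<^sup>2) \<le> (\<Sum>x\<in>F. (cmod (fn g x))\<^sup>2) + 2 * s * (\<Sum>x\<in>F. Re (fn f x))"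
      using sum_mono[of F, OF pt] by (simp add: sum.distrib sum_distrib_left)
    also have "\<dots> \<le> (norm g)\<^sup>2 + 2 * s * 1"
      using s by (intro add_mono sum_square_le_norm_square F mult_left_mono f1) auto
    finally show "(\<Sum>x\<in>F. (cmod (fn f x))\<^sup>2) \<le> (norm g)\<^sup>2 + 2 * s" by simp
  qed
  then have 3: "u / 2 \<le> (norm g)\<^sup>2" by (simp add: s_def)
  have "1 \<le> 4 / u" using u by (simp add: le_divide_eq)
  then have "0 \<le> profile (4 / u)" by (rule profile_ge) (auto intro: first_eigenvalue_nonneg)
  then have "u / 2 * profile (4 / u) \<le> (norm g)\<^sup>2 * profile (4 / u)" using 3 by (intro mult_right_mono)
  then show ?thesis using 1 2 unfolding u_def by (simp add: mult.commute)
qed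

section \<open>Decay of the lazy walk\<close>

lemma subprob_markov:
  assumes f: "subprob f"
  shows "subprob (markov f)"
  unfolding subprob_def
proof (intro conjI allI impI)
  fix x
  note e = fn_markov[of f x]
  have "((\<lambda>\<gamma>. Re (complex_of_real (pmf \<mu> \<gamma>) * fn f (rshift \<gamma> x))) has_sum Re (fn (markov f) x)) (carrier G)"
    by (rule has_sum_Re[OF e])
  then show "0 \<le> Re (fn (markov f) x)"
    by (rule has_sum_nonneg) (use f in \<open>auto simp: subprob_def\<close>)
  have "((\<lambda>\<gamma>. Im (complex_of_real (pmf \<mu> \<gamma>) * fn f (rshift \<gamma> x))) has_sum Im (fn (markov f) x)) (carrier G)"
    by (rule has_sum_Im[OF e])
  moreover have "(\<lambda>\<gamma>. Im (complex_of_real (pmf \<mu> \<gamma>) * fn f (rshift \<gamma> x))) = (\<lambda>_. 0)"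
    using f by (auto simp: subprob_def)
  ultimately show "Im (fn (markov f) x) = 0" using has_sum_unique[OF _ has_sum_0_simp] by force
next
  fix F :: "'a set" assume F: "finite F"
  \<comment> \<open>Summation over \<open>F\<close> is a bounded functional, so it passes through
    the norm-convergent sum; on a translate it sums \<open>f\<close> over the shifted set, hence is
    at most 1.\<close>
  define \<phi> where "\<phi> h = (\<Sum>x\<in>F. Re (fn h x))" for h :: "'a ell2"
  have bl: "bounded_linear \<phi>"
    unfolding \<phi>_def by (intro bounded_linear_sum bounded_linear_compose[OF bounded_linear_Re bounded_linear_fn])
  have "((\<lambda>\<gamma>. \<phi> (pmf \<mu> \<gamma> *\<^sub>R rtrans \<gamma> f)) has_sum \<phi> (markov f)) (carrier G)"
    using has_sum_bounded_linear[OF bl markov_has_sum[of f]] by (simp add: comp_def)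
  then have "\<phi> (markov f) \<le> 1"
  proof (rule has_sum_mono[OF _ pmf_sum])
    fix \<gamma> assume \<gamma>: "\<gamma> \<in> carrier G"
    have inj: "inj_on (rshift \<gamma>) F" using bij_rshift[OF \<gamma>] by (meson bij_is_inj inj_on_subset subset_UNIV)
    have "\<phi> (rtrans \<gamma> f) = (\<Sum>y\<in>rshift \<gamma> ` F. Re (fn f y))"
      using \<gamma> by (simp add: \<phi>_def fn_pull bij_rshift sum.reindex[OF inj])
    also have "\<dots> \<le> 1" using f F by (simp add: subprob_def)
    finally have "\<phi> (rtrans \<gamma> f) \<le> 1" .
    moreover have "\<phi> (pmf \<mu> \<gamma> *\<^sub>R rtrans \<gamma> f) = pmf \<mu> \<gamma> * \<phi> (rtrans \<gamma> f)"
      by (simp add: \<phi>_def scaleR_ell2.rep_eq sum_distrib_left)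
    ultimately show "\<phi> (pmf \<mu> \<gamma> *\<^sub>R rtrans \<gamma> f) \<le> pmf \<mu> \<gamma>"
      using mult_left_mono[of "\<phi> (rtrans \<gamma> f)" 1 "pmf \<mu> \<gamma>"] by simp
  qed
  then show "(\<Sum>x\<in>F. Re (fn (markov f) x)) \<le> 1" by (simp add: \<phi>_def)
qed

text \<open>The lazy walk \<open>1 - \<Delta> / 2\<close> is used instead of the Markov operator because it is positive.\<close>

definition lazy :: "'a ell2 \<Rightarrow> 'a ell2" where "lazy f = f - (1 / 2) *\<^sub>R laplace f"

lemma subprob_lazy:
  assumes f: "subprob f"
  shows "subprob (lazy f)"
proof -
  have e: "fn (lazy f) x = (fn f x + fn (markov f) x) / 2" for x
    unfolding lazy_def laplace_def minus_ell2.rep_eq scaleR_ell2.rep_eq by (simp add: field_simps)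
  note m = subprob_markov[OF f]
  have "(\<Sum>x\<in>F. Re (fn (lazy f) x)) \<le> 1" if "finite F" for F
  proof -
    have "(\<Sum>x\<in>F. Re (fn (lazy f) x)) = ((\<Sum>x\<in>F. Re (fn f x)) + (\<Sum>x\<in>F. Re (fn (markov f) x))) / 2"
      by (simp add: e sum.distrib flip: sum_divide_distrib)
    also have "\<dots> \<le> (1 + 1) / 2"
      using f m that by (intro divide_right_mono add_mono) (auto simp: subprob_def)
    finally show ?thesis by simp
  qed
  then show ?thesis using f m by (auto simp: subprob_def e)
qed

text \<open>With P = 1 - \<Delta> / 2 the left side is \<langle>P f, f\<rangle> minus \<langle>P
  (\<Delta> / 2) f, f\<rangle>, and the subtracted term is nonnegative because P (\<Delta> / 2) is
  the Bernstein polynomial Y (1 - Y).\<close>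

lemma norm_lazy_le: "(norm (lazy f))\<^sup>2 \<le> (norm f)\<^sup>2 - inner (laplace f) f / 2"
proof -
  have "0 \<le> inner (poly_op laplace (laplace.Y * (1 - laplace.Y)) f) f"
    using laplace.bernstein_nonneg[of 1 1 f] by simp
  also have "poly_op laplace (laplace.Y * (1 - laplace.Y)) f = (1/2) *\<^sub>R laplace (lazy f)"
    by (simp add: laplace.poly_op_mult laplace.poly_Y laplace.poly_op_diff lazy_def)
  finally have 1: "0 \<le> inner (lazy f) (laplace f)" by (simp add: laplace.symmetric)
  have "(norm (lazy f))\<^sup>2 = inner (lazy f) f - inner (lazy f) (laplace f) / 2"
    by (simp add: power2_norm_eq_inner) (simp add: lazy_def[of f] inner_diff_right)
  also have "inner (lazy f) f = (norm f)\<^sup>2 - inner (laplace f) f / 2"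
    by (simp add: lazy_def inner_diff_left power2_norm_eq_inner)
  finally show ?thesis using 1 by linarith
qed

definition lazy_walk :: "nat \<Rightarrow> 'a ell2" where "lazy_walk n = (lazy ^^ n) (ell2_delta \<one>)"

lemma lazy_walk_subprob: "subprob (lazy_walk n)"
proof (induction n)
  case 0
  show ?case unfolding lazy_walk_def subprob_def
    by (auto simp: fn_delta if_distrib[of Re] sum.delta cong: if_cong)
next
  case (Suc n)
  then show ?case by (simp add: lazy_walk_def subprob_lazy)
qed

lemma lazy_walk_supp: "restr (carrier G) (lazy_walk n) = lazy_walk n"
proof (induction n)
  case 0
  show ?case by (simp add: lazy_walk_def delta_supported)
next
  case (Suc n)
  note r = bounded_linear.linear[OF bounded_linear_restr[of "carrier G"]]
  have "restr (carrier G) (lazy (lazy_walk n)) = lazy (restr (carrier G) (lazy_walk n))"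
    by (simp add: lazy_def linear_diff[OF r] linear_scale[OF r] laplace_restr)
  then show ?case using Suc by (simp add: lazy_walk_def)
qed

text \<open>Two regimes. Once the squared norm u is at most 4 / V it stays there, since norms do not
  increase. Before that, 4 / u lies in [1, V), so the Nash inequality contracts u by the factor 1 -
  a / 4 \<le> exp (- a / 4).\<close>

lemma lazy_walk_decay:
  assumes V: "0 < V" and a: "0 \<le> a" and prof: "\<And>v. 1 \<le> v \<Longrightarrow> v < V \<Longrightarrow> a \<le> profile v"
  shows "(norm (lazy_walk n))\<^sup>2 \<le> max (4 / V) (exp (- (a * real n / 4)))"
proof (induction n)
  case 0
  show ?case using subprob_norm_le[OF lazy_walk_subprob[of 0]] by simp
next
  case (Suc n)
  let ?f = "lazy_walk n"
  define u where "u = (norm ?f)\<^sup>2"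
  have S: "lazy_walk (Suc n) = lazy ?f" by (simp add: lazy_walk_def)
  have le: "(norm (lazy ?f))\<^sup>2 \<le> u - inner (laplace ?f) ?f / 2" using norm_lazy_le[of ?f] by (simp add: u_def)
  show ?case
  proof (cases "u \<le> 4 / V")
    case True
    then show ?thesis using le laplace.nonneg[of ?f] unfolding S by simp
  next
    case False
    then have u: "4 / V < u" by simp
    have u0: "0 < u" using u V by (meson divide_pos_pos less_trans zero_less_numeral)
    have u1: "u \<le> 1" unfolding u_def by (rule subprob_norm_le[OF lazy_walk_subprob])
    have "?f \<noteq> 0" using u0 by (auto simp: u_def)
    then have nash: "u / 2 * profile (4 / u) \<le> inner (laplace ?f) ?f"
      unfolding u_def by (rule nash_inequality[OF lazy_walk_subprob lazy_walk_supp])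
    have "a \<le> profile (4 / u)"
      using u u0 u1 V by (intro prof) (auto simp: field_simps)
    then have "u / 2 * a \<le> u / 2 * profile (4 / u)" using u0 by (intro mult_left_mono) auto
    then have "(norm (lazy ?f))\<^sup>2 \<le> u * (1 - a / 4)" using le nash by (simp add: algebra_simps)
    also have "\<dots> \<le> u * exp (- (a / 4))"
      using exp_ge_add_one_self[of "- (a / 4)"] u0 by (intro mult_left_mono) auto
    also have "\<dots> \<le> exp (- (a * real n / 4)) * exp (- (a / 4))"
      using Suc.IH u by (intro mult_right_mono) (auto simp: u_def)
    also have "\<dots> = exp (- (a * real (Suc n) / 4))"
      by (simp add: exp_add[symmetric] field_simps)
    finally show ?thesis unfolding S by simp
  qed
qed

text \<open>The squared norm is the spectral integral of (1 - t / 2)^(2 n), which is at least exp (-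
  2 n r) on \<open>{..r}\<close> and nonnegative elsewhere.\<close>

lemma distribution_le_lazy_walk:
  assumes r: "0 \<le> r" "r \<le> 1"
  shows "spectral_distribution G \<mu> r \<le> exp (2 * real n * r) * (norm (lazy_walk n))\<^sup>2"
proof -
  let ?d = "ell2_delta \<one>" and ?\<nu> = "spec (ell2_delta \<one>)"
  define p :: "real poly" where "p = [:1, - (1 / 2):] ^ n"
  have lw: "lazy_walk n = poly_op laplace p ?d"
  proof -
    have "lazy = (\<lambda>y. 1 *\<^sub>R y + (- (1 / 2)) *\<^sub>R laplace y)" by (auto simp: lazy_def)
    then show ?thesis unfolding p_def laplace.poly_op_power lazy_walk_def by simp
  qed
  note s = spec_spectral_at[OF delta_supported[OF one_closed]]
  interpret finite_measure ?\<nu> using s by (simp add: laplace.spectral_at_def)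
  have sets: "sets ?\<nu> = sets borel" using s by (simp add: laplace.spectral_at_def)
  note [measurable_cong] = sets
  have sp: "space ?\<nu> = UNIV" using sets by (metis sets_eq_imp_space_eq space_borel)
  have "(norm (lazy_walk n))\<^sup>2 = (\<integral>t. poly (p * p) t \<partial>?\<nu>)"
    unfolding lw by (simp add: laplace.inner_poly_op_square[symmetric] laplace.integral_poly_spectral[OF s] del: poly_mult)
  also have "\<dots> \<ge> (\<integral>t. exp (- (2 * real n * r)) * indicator {..r} t \<partial>?\<nu>)"
  proof (rule integral_mono)
    show "integrable ?\<nu> (poly (p * p))"
      by (rule integral_poly_moments(1)[OF sets finite_measure_axioms laplace.spectral_at_bounded[OF s]])
    show "integrable ?\<nu> (\<lambda>t. exp (- (2 * real n * r)) * indicator {..r} t)"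
      using r by (intro integrable_const_bound[of _ 1]) (auto simp: indicator_def)
    fix t
    have pp: "poly (p * p) t = ((1 - t / 2) ^ n)\<^sup>2" by (simp add: p_def poly_power power2_eq_square)
    \<comment> \<open>As exp r \<ge> 1 + r, it suffices that 1 \<le> (1 - r / 2) (1 + r), which
      amounts to r^2 \<le> r; hence the restriction r \<le> 1.\<close>
    have e: "exp (- r) \<le> 1 - r / 2"
    proof -
      have "r * r \<le> r * 1" using r by (intro mult_left_mono) auto
      then have "1 \<le> (1 - r / 2) * (1 + r)" by (simp add: algebra_simps)
      also have "\<dots> \<le> (1 - r / 2) * exp r" using r by (intro mult_left_mono) (auto simp: exp_ge_add_one_self)
      finally show ?thesis by (simp add: exp_minus field_simps)
    qed
    show "exp (- (2 * real n * r)) * indicator {..r} t \<le> poly (p * p) t"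
    proof (cases "t \<le> r")
      case True
      then have "exp (- r) \<le> 1 - t / 2" using e by simp
      then have "exp (- r) ^ (n * 2) \<le> (1 - t / 2) ^ (n * 2)" by (intro power_mono) auto
      moreover have "exp (- r) ^ (n * 2) = exp (- (2 * real n * r))"
        by (simp add: exp_of_nat_mult[symmetric] mult_ac)
      ultimately show ?thesis using True unfolding pp by (simp add: power_mult)
    next
      case False
      then show ?thesis unfolding pp by simp
    qed
  qed
  finally have "exp (- (2 * real n * r)) * spectral_distribution G \<mu> r \<le> (norm (lazy_walk n))\<^sup>2"
    using sp by (simp add: spectral_distribution_eq)
  then show ?thesis by (simp add: exp_minus field_simps)
qed

lemma distribution_upper_bound:
  assumes r: "0 < r" "r \<le> 1" and V: "1 \<le> V" and prof: "\<And>v. 1 \<le> v \<Longrightarrow> v < V \<Longrightarrow> 32 * r \<le> profile v"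
  shows "spectral_distribution G \<mu> r \<le> 4 * exp 2 * V powr (- 3 / 4)"
proof -
  \<comment> \<open>With the profile at least 32 r, the decay rate is 8 r per step, so this n brings
    exp (- 8 r n) below 1 / V. Rounding up adds at most 2 r \<le> 2 to the exponent of exp (2 n r),
    hence the factor exp 2.\<close>
  define n where "n = nat \<lceil>ln V / (8 * r)\<rceil>"
  have lnV: "0 \<le> ln V" using V by simp
  have n1: "ln V / (8 * r) \<le> real n" unfolding n_def by linarith
  have n2: "real n \<le> ln V / (8 * r) + 1" unfolding n_def using lnV r by (simp add: nat_le_iff)
  have "exp (- (32 * r * real n / 4)) \<le> exp (- ln V)"
    using n1 r by (simp add: field_simps)
  also have "\<dots> \<le> 4 / V" using V by (simp add: exp_minus divide_inverse)
  finally have "(norm (lazy_walk n))\<^sup>2 \<le> 4 / V"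
    using lazy_walk_decay[of V "32 * r" n] V r prof by simp
  moreover have "exp (2 * real n * r) \<le> exp (ln V / 4 + 2)"
  proof -
    have "2 * real n * r \<le> 2 * (ln V / (8 * r) + 1) * r" using n2 r by (intro mult_right_mono) auto
    also have "\<dots> = ln V / 4 + 2 * r" using r by (simp add: field_simps)
    also have "\<dots> \<le> ln V / 4 + 2" using r by simp
    finally show ?thesis by simp
  qed
  ultimately have "exp (2 * real n * r) * (norm (lazy_walk n))\<^sup>2 \<le> exp (ln V / 4 + 2) * (4 / V)"
    by (intro mult_mono) auto
  also have "\<dots> = 4 * exp 2 * V powr (- 3 / 4)"
  proof -
    have "4 / V = 4 * exp (- ln V)" using V by (simp add: exp_minus divide_inverse)
    moreover have "V powr (- 3 / 4) = exp (- 3 / 4 * ln V)" using V by (simp add: powr_def)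
    moreover have "exp (ln V / 4 + 2) * exp (- ln V) = exp 2 * exp (- 3 / 4 * ln V)"
      unfolding exp_add[symmetric] by simp
    ultimately show ?thesis by simp
  qed
  finally show ?thesis using distribution_le_lazy_walk[of r n] r by simp
qed

end

section \<open>Amenability and positivity of the profile\<close>

lemma finitely_additive_sum:
  fixes m :: "'a set \<Rightarrow> real"
  assumes add: "\<And>A B. A \<subseteq> X \<Longrightarrow> B \<subseteq> X \<Longrightarrow> A \<inter> B = {} \<Longrightarrow> m (A \<union> B) = m A + m B"
    and J: "finite J" "\<And>j. j \<in> J \<Longrightarrow> A j \<subseteq> X" "disjoint_family_on A J"
  shows "m (\<Union>j\<in>J. A j) = (\<Sum>j\<in>J. m (A j))"
  using J
proof (induction J)
  case empty
  have "m ({} \<union> {}) = m {} + m {}" by (rule add) auto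
  then show ?case by simp
next
  case (insert j J)
  have "A j \<inter> (\<Union>i\<in>J. A i) = {}" using insert.prems(2) insert.hyps by (force simp: disjoint_family_on_def)
  then have "m (A j \<union> (\<Union>i\<in>J. A i)) = m (A j) + m (\<Union>i\<in>J. A i)"
    using insert.prems by (intro add) auto
  then show ?case using insert by (simp add: disjoint_family_on_def)
qed

context group
begin

text \<open>Hall's theorem turns doubling of all finite sets into a paradoxical decomposition, which an
  invariant mean excludes.\<close>

lemma amenable_not_doubling:
  assumes am: "amenable_group G" and D: "finite D" "D \<subseteq> carrier G"
  shows "\<exists>\<Omega>. \<Omega> \<subseteq> carrier G \<and> finite \<Omega> \<and> card (\<Omega> <#> D) < 2 * card \<Omega>"
proof (rule ccontr)
  assume "\<nexists>\<Omega>. \<Omega> \<subseteq> carrier G \<and> finite \<Omega> \<and> card (\<Omega> <#> D) < 2 * card \<Omega>"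
  then have dbl: "2 * card \<Omega> \<le> card (\<Omega> <#> D)" if "\<Omega> \<subseteq> carrier G" "finite \<Omega>" for \<Omega>
    using that by (auto simp: not_less)
  \<comment> \<open>Two copies of the group. Matching each copy of x injectively to some x d with d
    in \<open>D\<close> embeds both copies into one group by piecewise right translation; doubling
    of finite sets is Hall's condition for this matching.\<close>
  define I where "I = carrier G \<times> (UNIV :: bool set)"
  have "\<exists>h. inj_on h I \<and> (\<forall>i\<in>I. h i \<in> (\<lambda>(x, b). {x} <#> D) i)"
  proof (rule hall_injection)
    show "finite ((\<lambda>(x, b). {x} <#> D) i)" for i :: "'a \<times> bool"
      using D by (auto simp: set_mult_def split: prod.split)
    fix F assume F: "finite F" "F \<subseteq> I"
    have "card F \<le> card (fst ` F \<times> (UNIV :: bool set))"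
      using F by (intro card_mono) (force simp: image_iff)+
    also have "\<dots> = 2 * card (fst ` F)" by (simp add: card_cartesian_product)
    also have "\<dots> \<le> card (fst ` F <#> D)" using F by (intro dbl) (auto simp: I_def)
    also have "fst ` F <#> D = (\<Union>i\<in>F. (\<lambda>(x, b). {x} <#> D) i)" by (force simp: set_mult_def)
    finally show "card F \<le> card (\<Union>i\<in>F. (\<lambda>(x, b). {x} <#> D) i)" .
  qed
  then obtain h where inj: "inj_on h I" and h: "\<And>x b. x \<in> carrier G \<Longrightarrow> \<exists>d\<in>D. h (x, b) = x \<otimes> d"
    unfolding I_def set_mult_def by force
  obtain m :: "'a set \<Rightarrow> real" where m: "\<forall>A. A \<subseteq> carrier G \<longrightarrow> 0 \<le> m A" "m (carrier G) = 1"
      "\<forall>A B. A \<subseteq> carrier G \<longrightarrow> B \<subseteq> carrier G \<longrightarrow> A \<inter> B = {} \<longrightarrow> m (A \<union> B) = m A + m B"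
      "\<forall>g\<in>carrier G. \<forall>A. A \<subseteq> carrier G \<longrightarrow> m (g <# A) = m A"
    using am unfolding amenable_group_def by (elim exE conjE) (rule that; assumption)
  note m0 = m(1)[rule_format] and m1 = m(2) and madd = m(3)[rule_format] and minv = m(4)[rule_format]
  \<comment> \<open>inversion makes the left-invariant mean right-invariant\<close>
  define M where "M A = m (m_inv G ` A)" for A
  have invim: "m_inv G ` A \<subseteq> carrier G" if "A \<subseteq> carrier G" for A using that by auto
  have M0: "0 \<le> M A" if "A \<subseteq> carrier G" for A using m0[OF invim[OF that]] by (simp add: M_def)
  have "m_inv G ` carrier G = carrier G"
  proof
    show "carrier G \<subseteq> m_inv G ` carrier G"
      by (metis image_eqI inv_closed inv_inv subsetI)
  qed auto
  then have M1: "M (carrier G) = 1" by (simp add: M_def m1)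
  have Madd: "M (A \<union> B) = M A + M B" if "A \<subseteq> carrier G" "B \<subseteq> carrier G" "A \<inter> B = {}" for A B
  proof -
    have "m_inv G ` A \<inter> m_inv G ` B = {}" using that inv_inj unfolding inj_on_def by blast
    then show ?thesis unfolding M_def image_Un using that by (intro madd invim)
  qed
  have Minv: "M ((\<lambda>x. x \<otimes> d) ` A) = M A" if "d \<in> carrier G" "A \<subseteq> carrier G" for d A
  proof -
    have "m_inv G ` (\<lambda>x. x \<otimes> d) ` A = inv d <# (m_inv G ` A)"
      using that by (force simp: l_coset_def inv_mult_group image_iff)
    then show ?thesis unfolding M_def using that minv[OF inv_closed invim] by simp
  qed
  \<comment> \<open>The part of copy b that the matching moves by d. For fixed b these parts
    partition the group; after translation all of them, over both copies, are still disjoint because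
    \<open>h\<close> is injective, so a mean of mass 1 would have to hold mass 2.\<close>
  define A where "A b d = {x \<in> carrier G. h (x, b) = x \<otimes> d}" for b d
  have Asub: "A b d \<subseteq> carrier G" for b d by (auto simp: A_def)
  have Apart: "(\<Sum>d\<in>D. M (A b d)) = 1" for b
  proof -
    have "disjoint_family_on (A b) D" using D by (auto simp: disjoint_family_on_def A_def subset_iff)
    then have "M (\<Union>d\<in>D. A b d) = (\<Sum>d\<in>D. M (A b d))"
      by (intro finitely_additive_sum[of "carrier G"] Madd D Asub)
    moreover have "(\<Union>d\<in>D. A b d) = carrier G" using h[of _ b] by (auto simp: A_def)
    ultimately show ?thesis by (simp add: M1)
  qed
  define T where "T = (\<lambda>(b, d). (\<lambda>x. x \<otimes> d) ` A b d)"
  have Tsub: "T j \<subseteq> carrier G" if "j \<in> UNIV \<times> D" for j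
    using that D by (auto simp: T_def A_def)
  have Th: "T (b, d) = h ` (A b d \<times> {b})" for b d
    by (force simp: T_def A_def)
  have "disjoint_family_on T (UNIV \<times> D)"
    unfolding disjoint_family_on_def
  proof (intro ballI impI)
    fix i j :: "bool \<times> 'a" assume ij: "i \<in> UNIV \<times> D" "j \<in> UNIV \<times> D" "i \<noteq> j"
    obtain b d b' d' where e: "i = (b, d)" "j = (b', d')" by (metis surj_pair)
    have "d \<in> carrier G" "d' \<in> carrier G" using ij e D by auto
    then have "(A b d \<times> {b}) \<inter> (A b' d' \<times> {b'}) = {}" using ij e by (auto simp: A_def)
    moreover have "A b d \<times> {b} \<subseteq> I" "A b' d' \<times> {b'} \<subseteq> I" by (auto simp: A_def I_def)
    ultimately show "T i \<inter> T j = {}"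
      unfolding e Th using inj_on_image_Int[OF inj] by (metis image_empty)
  qed
  then have "M (\<Union>j\<in>UNIV \<times> D. T j) = (\<Sum>j\<in>UNIV \<times> D. M (T j))"
    using D by (intro finitely_additive_sum[of "carrier G"] Madd Tsub) auto
  also have "\<dots> = (\<Sum>b\<in>UNIV. \<Sum>d\<in>D. M (T (b, d)))" by (simp add: sum.cartesian_product)
  also have "\<dots> = (\<Sum>b\<in>(UNIV::bool set). \<Sum>d\<in>D. M (A b d))"
    using D by (intro sum.cong refl) (auto simp: T_def intro!: Minv Asub)
  also have "\<dots> = 2" by (simp add: Apart)
  finally have 2: "M (\<Union>j\<in>UNIV \<times> D. T j) = 2" .
  let ?U = "\<Union>j\<in>UNIV \<times> D. T j"
  have U: "?U \<subseteq> carrier G" using Tsub by blast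
  have "M (?U \<union> (carrier G - ?U)) = M ?U + M (carrier G - ?U)" using U by (intro Madd) auto
  moreover have "?U \<union> (carrier G - ?U) = carrier G" using U by blast
  ultimately show False using 2 M1 M0[of "carrier G - ?U"] by auto
qed

text \<open>If every finite set had boundary ratio at least \<epsilon>, each multiplication by
  \<open>K\<close> with the unit added would enlarge sets by the factor 1 + \<epsilon>. Iterating
  until the factor exceeds 2 makes the m-th power of that set a doubling set, which amenability
  excludes.\<close>

lemma amenable_folner:
  assumes am: "amenable_group G" and K: "finite K" "K \<subseteq> carrier G" and \<epsilon>: "0 < \<epsilon>"
  shows "\<exists>\<Omega>. \<Omega> \<subseteq> carrier G \<and> finite \<Omega> \<and> \<Omega> \<noteq> {} \<and> real (card ((\<Omega> <#> K) - \<Omega>)) < \<epsilon> * real (card \<Omega>)"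
proof (rule ccontr)
  assume contr: "\<not> ?thesis"
  define K' where "K' = insert \<one> K"
  have K': "finite K'" "K' \<subseteq> carrier G" using K by (auto simp: K'_def)
  have fin: "finite (\<Omega> <#> E)" if "finite \<Omega>" "finite E" for \<Omega> E
    using that by (auto simp: set_mult_def)
  have grow: "(1 + \<epsilon>) * real (card \<Omega>) \<le> real (card (\<Omega> <#> K'))" if \<Omega>: "\<Omega> \<subseteq> carrier G" "finite \<Omega>" for \<Omega>
  proof (cases "\<Omega> = {}")
    case False
    have "\<epsilon> * real (card \<Omega>) \<le> real (card ((\<Omega> <#> K) - \<Omega>))" using contr \<Omega> False by (auto simp: not_less)
    moreover have "card \<Omega> + card ((\<Omega> <#> K) - \<Omega>) = card (\<Omega> <#> K')"
    proof -
      have "\<Omega> <#> K' = \<Omega> \<union> ((\<Omega> <#> K) - \<Omega>)"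
        using \<Omega> by (force simp: set_mult_def K'_def)
      moreover have "card (\<Omega> \<union> ((\<Omega> <#> K) - \<Omega>)) = card \<Omega> + card ((\<Omega> <#> K) - \<Omega>)"
        using \<Omega> fin[OF \<Omega>(2) K(1)] by (intro card_Un_disjoint) auto
      ultimately show ?thesis by (simp only:)
    qed
    ultimately show ?thesis by (simp add: distrib_right)
  qed simp
  define D where "D m = ((\<lambda>E. E <#> K') ^^ m) {\<one>}" for m
  have Dsub: "D m \<subseteq> carrier G \<and> finite (D m)" for m
  proof (induction m)
    case (Suc m)
    have "D (Suc m) = D m <#> K'" by (simp add: D_def)
    then show ?case using Suc K' fin set_mult_closed by metis
  qed (simp add: D_def)
  have iter: "(1 + \<epsilon>) ^ m * real (card \<Omega>) \<le> real (card (\<Omega> <#> D m))" if \<Omega>: "\<Omega> \<subseteq> carrier G" "finite \<Omega>" for \<Omega> m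
  proof (induction m)
    case 0
    have "\<Omega> <#> {\<one>} = \<Omega>" using \<Omega> by (force simp: set_mult_def)
    then show ?case by (simp add: D_def)
  next
    case (Suc m)
    have "(1 + \<epsilon>) ^ Suc m * real (card \<Omega>) \<le> (1 + \<epsilon>) * real (card (\<Omega> <#> D m))"
      using Suc.IH \<epsilon> mult_left_mono[of _ _ "1 + \<epsilon>"] by (simp add: mult.assoc)
    also have "\<dots> \<le> real (card ((\<Omega> <#> D m) <#> K'))"
      using \<Omega> Dsub[of m] by (intro grow set_mult_closed fin) auto
    also have "(\<Omega> <#> D m) <#> K' = \<Omega> <#> D (Suc m)"
      using \<Omega> Dsub[of m] K' by (simp add: D_def set_mult_assoc)
    finally show ?case .
  qed
  obtain m where m: "2 < (1 + \<epsilon>) ^ m" using real_arch_pow[of "1 + \<epsilon>" 2] \<epsilon> by auto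
  obtain \<Omega> where \<Omega>: "\<Omega> \<subseteq> carrier G" "finite \<Omega>" "card (\<Omega> <#> D m) < 2 * card \<Omega>"
    using amenable_not_doubling[OF am, of "D m"] Dsub[of m] by blast
  have "2 * real (card \<Omega>) \<le> (1 + \<epsilon>) ^ m * real (card \<Omega>)" using m by (intro mult_right_mono) auto
  also have "\<dots> \<le> real (card (\<Omega> <#> D m))" by (rule iter[OF \<Omega>(1,2)])
  finally show False using \<Omega>(3) by linarith
qed

end

section \<open>Vanishing infimum and strict positivity of the profile\<close>

context random_walk
begin

text \<open>The test function is the indicator of a Folner set. Group elements in a finite set
  carrying \<mu>-mass at least 1 - \<epsilon> / 2 contribute at most the size of the boundary, the
  others at most the size of the whole set.\<close>

lemma profile_small:
  assumes am: "amenable_group G" and \<epsilon>: "0 < \<epsilon>"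
  shows "\<exists>v\<ge>1. profile v \<le> \<epsilon>"
proof -
  have "\<exists>K. finite K \<and> K \<subseteq> carrier G \<and> dist (sum (pmf \<mu>) K) 1 \<le> \<epsilon> / 2"
    using has_sum_finite_approximation[OF pmf_sum, of "\<epsilon> / 2"] \<epsilon> by auto
  then obtain K where fK: "finite K" "K \<subseteq> carrier G" and dK: "dist (sum (pmf \<mu>) K) 1 \<le> \<epsilon> / 2" by blast
  have "1 - \<epsilon> / 2 \<le> sum (pmf \<mu>) K" using dK unfolding dist_real_def by linarith
  note K = fK this
  \<comment> \<open>Inverses appear because translation by \<gamma> multiplies the argument by the
    inverse of \<gamma>.\<close>
  have "finite (m_inv G ` K)" "m_inv G ` K \<subseteq> carrier G" using K by auto
  then obtain \<Omega> where \<Omega>: "\<Omega> \<subseteq> carrier G" "finite \<Omega>" "\<Omega> \<noteq> {}"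
      and bd: "real (card ((\<Omega> <#> m_inv G ` K) - \<Omega>)) < \<epsilon> / 2 * real (card \<Omega>)"
    using amenable_folner[OF am, of "m_inv G ` K" "\<epsilon> / 2"] \<epsilon> by auto
  let ?c = "real (card \<Omega>)" and ?b = "real (card ((\<Omega> <#> m_inv G ` K) - \<Omega>))"
  define f where "f = Abs_ell2 (\<lambda>x. if x \<in> \<Omega> then 1 else 0 :: complex)"
  have f: "fn f x = (if x \<in> \<Omega> then 1 else 0)" for x
  proof -
    have "(\<lambda>x. (cmod (if x \<in> \<Omega> then 1 else 0))\<^sup>2) summable_on UNIV"
      using \<Omega>(2) by (intro finite_nonzero_values_imp_summable_on) (auto elim!: finite_subset[rotated] split: if_splits)
    then show ?thesis by (simp add: f_def Abs_ell2_inverse)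
  qed
  have supp: "supp f = \<Omega>" by (auto simp: f)
  have fin_inner: "inner g f = (\<Sum>x\<in>\<Omega>. Re (fn g x))" for g
  proof -
    have "(\<Sum>\<^sub>\<infinity>x. fn g x * cnj (fn f x)) = (\<Sum>\<^sub>\<infinity>x\<in>\<Omega>. fn g x)"
      by (rule infsum_cong_neutral) (auto simp: f)
    then show ?thesis using \<Omega>(2) by (simp add: inner_ell2.rep_eq Re_sum)
  qed
  have ff: "inner f f = ?c" by (simp add: fin_inner f)
  have e: "(norm (f - rtrans \<gamma> f))\<^sup>2 / 2 = real (card {x \<in> \<Omega>. x \<otimes> inv \<gamma> \<notin> \<Omega>})" if \<gamma>: "\<gamma> \<in> carrier G" for \<gamma>
  proof -
    have "(norm (f - rtrans \<gamma> f))\<^sup>2 = 2 * inner f f - 2 * inner (rtrans \<gamma> f) f"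
      using \<gamma> by (simp add: power2_norm_eq_inner inner_diff_left inner_diff_right inner_pull bij_rshift inner_commute)
    moreover have "inner (rtrans \<gamma> f) f = (\<Sum>x\<in>\<Omega>. if x \<otimes> inv \<gamma> \<in> \<Omega> then 1 else 0)"
      unfolding fin_inner using \<Omega>(1) \<gamma> by (intro sum.cong) (auto simp: fn_pull bij_rshift f rshift_def)
    moreover have "\<dots> = real (card {x \<in> \<Omega>. x \<otimes> inv \<gamma> \<in> \<Omega>})"
      using \<Omega>(2) by (simp add: sum.If_cases Int_def)
    moreover have "card \<Omega> = card {x \<in> \<Omega>. x \<otimes> inv \<gamma> \<in> \<Omega>} + card {x \<in> \<Omega>. x \<otimes> inv \<gamma> \<notin> \<Omega>}"
      using \<Omega>(2) by (subst card_Un_disjoint[symmetric]) (auto intro!: arg_cong[of _ _ card])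
    ultimately show ?thesis by (simp add: ff)
  qed
  have e1: "(norm (f - rtrans \<gamma> f))\<^sup>2 / 2 \<le> ?c" if "\<gamma> \<in> carrier G" for \<gamma>
    unfolding e[OF that] using \<Omega>(2) by (simp add: card_mono)
  have e2: "(norm (f - rtrans \<gamma> f))\<^sup>2 / 2 \<le> ?b" if "\<gamma> \<in> K" for \<gamma>
  proof -
    have \<gamma>: "\<gamma> \<in> carrier G" using that K by auto
    have inj: "inj_on (\<lambda>x. x \<otimes> inv \<gamma>) {x \<in> \<Omega>. x \<otimes> inv \<gamma> \<notin> \<Omega>}"
      using \<Omega>(1) \<gamma> by (auto simp: inj_on_def subset_iff)
    have "card {x \<in> \<Omega>. x \<otimes> inv \<gamma> \<notin> \<Omega>} = card ((\<lambda>x. x \<otimes> inv \<gamma>) ` {x \<in> \<Omega>. x \<otimes> inv \<gamma> \<notin> \<Omega>})"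
      by (rule card_image[OF inj, symmetric])
    also have "\<dots> \<le> card ((\<Omega> <#> m_inv G ` K) - \<Omega>)"
      using \<Omega>(2) K(1) that by (intro card_mono) (auto simp: set_mult_def)
    finally show ?thesis unfolding e[OF \<gamma>] by simp
  qed
  have "inner (laplace f) f \<le> ?b + \<epsilon> / 2 * ?c"
  proof -
    have "((\<lambda>\<gamma>. pmf \<mu> \<gamma> * ?c) has_sum 1 * ?c) (carrier G)" by (intro has_sum_cmult_left pmf_sum)
    \<comment> \<open>The majorant is the size of \<Omega> on the whole group, corrected on the
      finite set \<open>K\<close> to the boundary size; so it splits into a multiple of \<mu> and a
      finite sum.\<close>
    moreover have "((\<lambda>\<gamma>. if \<gamma> \<in> K then pmf \<mu> \<gamma> * (?b - ?c) else 0) has_sum (\<Sum>\<gamma>\<in>K. pmf \<mu> \<gamma> * (?b - ?c))) (carrier G)"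
      by (rule has_sum_finite_neutralI[OF K(1,2)]) (auto intro!: sum.cong)
    ultimately have hs: "((\<lambda>\<gamma>. pmf \<mu> \<gamma> * ?c + (if \<gamma> \<in> K then pmf \<mu> \<gamma> * (?b - ?c) else 0)) has_sum
        1 * ?c + (\<Sum>\<gamma>\<in>K. pmf \<mu> \<gamma> * (?b - ?c))) (carrier G)"
      by (rule has_sum_add)
    have "inner (laplace f) f \<le> 1 * ?c + (\<Sum>\<gamma>\<in>K. pmf \<mu> \<gamma> * (?b - ?c))"
    proof (rule has_sum_mono[OF dirichlet_form hs])
      fix \<gamma> assume \<gamma>: "\<gamma> \<in> carrier G"
      show "pmf \<mu> \<gamma> * ((norm (f - rtrans \<gamma> f))\<^sup>2 / 2) \<le> pmf \<mu> \<gamma> * ?c + (if \<gamma> \<in> K then pmf \<mu> \<gamma> * (?b - ?c) else 0)"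
      proof (cases "\<gamma> \<in> K")
        case True
        then show ?thesis using mult_left_mono[OF e2[OF True], of "pmf \<mu> \<gamma>"] by (simp add: right_diff_distrib)
      next
        case False
        then show ?thesis using mult_left_mono[OF e1[OF \<gamma>], of "pmf \<mu> \<gamma>"] by simp
      qed
    qed
    also have "\<dots> = (1 - sum (pmf \<mu>) K) * ?c + sum (pmf \<mu>) K * ?b"
      unfolding sum_distrib_right[symmetric] by (simp add: algebra_simps)
    also have "\<dots> \<le> \<epsilon> / 2 * ?c + 1 * ?b"
    proof (intro add_mono mult_right_mono)
      show "sum (pmf \<mu>) K \<le> 1" using finite_sum_le_has_sum[OF pmf_sum K(1,2)] by simp
    qed (use K(3) in auto)
    finally show ?thesis by simp
  qed
  then have le: "inner (laplace f) f \<le> \<epsilon> * ?c" using bd by (simp add: algebra_simps)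
  have cpos: "0 < ?c" using \<Omega> by (simp add: card_gt_0_iff)
  have "profile ?c * (norm f)\<^sup>2 \<le> inner (laplace f) f"
    by (rule profile_mult_norm_le) (use \<Omega> supp in auto)
  then have "profile ?c * ?c \<le> \<epsilon> * ?c" using le by (simp add: power2_norm_eq_inner ff)
  then have "profile ?c \<le> \<epsilon>" using cpos by simp
  moreover have "1 \<le> ?c" using cpos by simp
  ultimately show ?thesis by blast
qed

text \<open>For a single generator the energy dominates its own term of the Dirichlet form, which
  has positive weight; words follow by the triangle inequality. The constant depends on
  \<open>w\<close> only, not on the function or the point.\<close>

lemma pointwise_difference_bound:
  assumes S: "S \<subseteq> carrier G" "S \<subseteq> set_pmf \<mu>" and w: "w \<in> generate G S"
  shows "\<exists>C\<ge>0. \<forall>f. \<forall>x\<in>carrier G. cmod (fn f x - fn f (x \<otimes> w)) \<le> C * sqrt (inner (laplace f) f)"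
  using w
proof (induction rule: generate.induct)
  case one
  then show ?case by (intro exI[of _ 0]) auto
next
  have step: "cmod (fn f x - fn f (rshift h x)) \<le> sqrt (2 / pmf \<mu> h) * sqrt (inner (laplace f) f)"
    if "h \<in> S" for f h x
  proof -
    have h: "h \<in> carrier G" "0 < pmf \<mu> h" using that S by (auto simp: pmf_positive)
    have "pmf \<mu> h * ((norm (f - rtrans h f))\<^sup>2 / 2) \<le> inner (laplace f) f"
      using finite_sum_le_has_sum[OF dirichlet_form[of f], of "{h}"] h by auto
    then have "(norm (f - rtrans h f))\<^sup>2 \<le> 2 / pmf \<mu> h * inner (laplace f) f" using h by (simp add: field_simps)
    then have "norm (f - rtrans h f) \<le> sqrt (2 / pmf \<mu> h) * sqrt (inner (laplace f) f)"
      unfolding real_sqrt_mult[symmetric] by (rule real_le_rsqrt)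
    moreover have "cmod (fn f x - fn f (rshift h x)) \<le> norm (f - rtrans h f)"
      using norm_fn_le[of "f - rtrans h f" x] h by (simp add: minus_ell2.rep_eq fn_pull bij_rshift)
    ultimately show ?thesis by linarith
  qed
  {
    case (incl h)
    have h: "h \<in> carrier G" using incl S by auto
    show ?case
    proof (intro exI[of _ "sqrt (2 / pmf \<mu> h)"] conjI allI ballI)
      fix f x assume x: "x \<in> carrier G"
      \<comment> \<open>\<open>rshift h\<close> multiplies by the inverse, so the step starts at x h
        and leads back to x.\<close>
      have "rshift h (x \<otimes> h) = x" using x h by (simp add: rshift_def m_assoc)
      then show "cmod (fn f x - fn f (x \<otimes> h)) \<le> sqrt (2 / pmf \<mu> h) * sqrt (inner (laplace f) f)"
        using step[OF incl, of f "x \<otimes> h"] by (simp add: norm_minus_commute)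
    qed simp
  next
    case (inv h)
    show ?case
    proof (intro exI[of _ "sqrt (2 / pmf \<mu> h)"] conjI allI ballI)
      fix f x assume x: "x \<in> carrier G"
      then show "cmod (fn f x - fn f (x \<otimes> inv h)) \<le> sqrt (2 / pmf \<mu> h) * sqrt (inner (laplace f) f)"
        using step[OF inv, of f x] by (simp add: rshift_def)
    qed simp
  }
next
  case (eng h1 h2)
  have h: "h1 \<in> carrier G" "h2 \<in> carrier G" using eng.hyps generate_in_carrier[OF S(1)] by auto
  obtain C1 where C1: "0 \<le> C1" "\<And>f x. x \<in> carrier G \<Longrightarrow> cmod (fn f x - fn f (x \<otimes> h1)) \<le> C1 * sqrt (inner (laplace f) f)"
    using eng.IH(1) by blast
  obtain C2 where C2: "0 \<le> C2" "\<And>f x. x \<in> carrier G \<Longrightarrow> cmod (fn f x - fn f (x \<otimes> h2)) \<le> C2 * sqrt (inner (laplace f) f)"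
    using eng.IH(2) by blast
  show ?case
  proof (intro exI[of _ "C1 + C2"] conjI allI ballI)
    fix f x assume x: "x \<in> carrier G"
    have "cmod (fn f x - fn f (x \<otimes> (h1 \<otimes> h2))) \<le> cmod (fn f x - fn f (x \<otimes> h1)) + cmod (fn f (x \<otimes> h1) - fn f (x \<otimes> h1 \<otimes> h2))"
      using norm_triangle_ineq[of "fn f x - fn f (x \<otimes> h1)" "fn f (x \<otimes> h1) - fn f (x \<otimes> h1 \<otimes> h2)"] x h
      by (simp add: m_assoc)
    also have "\<dots> \<le> (C1 + C2) * sqrt (inner (laplace f) f)"
      using C1(2)[OF x, of f] C2(2)[of "x \<otimes> h1" f] x h by (simp add: distrib_right)
    finally show "cmod (fn f x - fn f (x \<otimes> (h1 \<otimes> h2))) \<le> (C1 + C2) * sqrt (inner (laplace f) f)" .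
  qed (use C1 C2 in simp)
qed

text \<open>With more than v displacements available, every point can be moved out of a set of at
  most v points, where the function vanishes; this bounds its values by the energy. The constant is
  uniform over all such sets, so it survives the infimum.\<close>

lemma profile_positive:
  assumes inf: "infinite (carrier G)" and S: "S \<subseteq> carrier G" "S \<subseteq> set_pmf \<mu>" "generate G S = carrier G"
    and v: "1 \<le> v"
  shows "0 < profile v"
proof -
  obtain F where F: "finite F" "card F = nat \<lfloor>v\<rfloor> + 1" "F \<subseteq> carrier G"
    using infinite_arbitrarily_large[OF inf] by blast
  have "\<exists>C. \<forall>w\<in>carrier G. 0 \<le> C w \<and> (\<forall>f. \<forall>x\<in>carrier G. cmod (fn f x - fn f (x \<otimes> w)) \<le> C w * sqrt (inner (laplace f) f))"
    using pointwise_difference_bound[OF S(1,2)] S(3) by (intro bchoice) auto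
  then obtain C where C0: "\<And>w. w \<in> carrier G \<Longrightarrow> 0 \<le> C w"
    and C: "\<And>w f x. w \<in> carrier G \<Longrightarrow> x \<in> carrier G \<Longrightarrow> cmod (fn f x - fn f (x \<otimes> w)) \<le> C w * sqrt (inner (laplace f) f)"
    by blast
  define B where "B = (\<Sum>w\<in>F. C w)"
  have B0: "0 \<le> B" unfolding B_def using C0 F by (intro sum_nonneg) auto
  have CB: "C w \<le> B" if "w \<in> F" for w
    unfolding B_def using that F C0 by (intro member_le_sum) auto
  \<comment> \<open>Adding 1 keeps the denominator positive even if B = 0.\<close>
  define \<kappa> where "\<kappa> = 1 / (v * (B\<^sup>2 + 1))"
  have den: "0 < v * (B\<^sup>2 + 1)" using v by (intro mult_pos_pos) (auto simp: add_nonneg_pos)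
  have "\<kappa> \<le> profile v"
  proof (rule profile_ge[OF v], rule first_eigenvalue_ge)
    fix \<Omega> f assume \<Omega>: "\<Omega> \<subseteq> carrier G" "finite \<Omega>" "\<Omega> \<noteq> {}" "real (card \<Omega>) \<le> v" and f: "supp f \<subseteq> \<Omega>"
    let ?E = "inner (laplace f) f"
    have E0: "0 \<le> ?E" by (rule laplace.nonneg)
    have pt: "(cmod (fn f x))\<^sup>2 \<le> B\<^sup>2 * ?E" if x: "x \<in> carrier G" for x
    proof -
      have "inj_on (\<lambda>w. x \<otimes> w) F" using x F(3) by (auto simp: inj_on_def subset_iff)
      then have "card ((\<lambda>w. x \<otimes> w) ` F) = card F" by (rule card_image)
      moreover have "card \<Omega> < card F" using \<Omega>(4) v F(2) by linarith
      ultimately have "\<not> (\<lambda>w. x \<otimes> w) ` F \<subseteq> \<Omega>"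
        using card_mono[OF \<Omega>(2), of "(\<lambda>w. x \<otimes> w) ` F"] by linarith
      then obtain w where w: "w \<in> F" "x \<otimes> w \<notin> \<Omega>" by auto
      then have "fn f (x \<otimes> w) = 0" using f by auto
      then have "cmod (fn f x) \<le> C w * sqrt ?E" using C[of w x f] w F x by auto
      also have "\<dots> \<le> B * sqrt ?E" using CB[OF w(1)] E0 by (intro mult_right_mono) auto
      finally have "(cmod (fn f x))\<^sup>2 \<le> (B * sqrt ?E)\<^sup>2" by (intro power_mono) auto
      then show ?thesis using E0 by (simp add: power_mult_distrib)
    qed
    have "(norm f)\<^sup>2 \<le> v * (B\<^sup>2 + 1) * ?E"
    proof (rule norm_square_ell2_leI)
      fix Z :: "'a set" assume Z: "finite Z"
      have "(\<Sum>x\<in>Z. (cmod (fn f x))\<^sup>2) = (\<Sum>x\<in>Z \<inter> \<Omega>. (cmod (fn f x))\<^sup>2)"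
        using f Z by (intro sum.mono_neutral_right) auto
      also have "\<dots> \<le> real (card (Z \<inter> \<Omega>)) * (B\<^sup>2 * ?E)"
        using \<Omega>(1) by (intro sum_bounded_above pt) auto
      also have "\<dots> \<le> v * ((B\<^sup>2 + 1) * ?E)"
      proof (intro mult_mono)
        have "card (Z \<inter> \<Omega>) \<le> card \<Omega>" using \<Omega>(2) by (intro card_mono) auto
        then show "real (card (Z \<inter> \<Omega>)) \<le> v" using \<Omega>(4) by linarith
      qed (use v E0 in auto)
      finally show "(\<Sum>x\<in>Z. (cmod (fn f x))\<^sup>2) \<le> v * (B\<^sup>2 + 1) * ?E" by (simp add: mult.assoc)
    qed
    then show "\<kappa> * (norm f)\<^sup>2 \<le> ?E" unfolding \<kappa>_def using den by (simp add: divide_le_eq mult.commute)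
  qed
  moreover have "0 < \<kappa>" unfolding \<kappa>_def using den by simp
  ultimately show ?thesis by linarith
qed

end

section \<open>Comparison\<close>

text \<open>What the comparison retains of the group. By \<open>small\<close> the infimum of
  \<open>L\<close> is 0, so the inverse is meaningful at every positive argument.\<close>

locale decreasing_profile =
  fixes L :: "real \<Rightarrow> real"
  assumes antimono: "1 \<le> v \<Longrightarrow> v \<le> w \<Longrightarrow> L w \<le> L v"
    and positive: "1 \<le> v \<Longrightarrow> 0 < L v"
    and small: "0 < \<epsilon> \<Longrightarrow> \<exists>v\<ge>1. L v \<le> \<epsilon>"
begin

abbreviation I :: "real \<Rightarrow> real" where "I \<equiv> generalized_inverse {1..} L"

lemma sublevel_nonempty: "0 < x \<Longrightarrow> {v \<in> {1..}. L v \<le> x} \<noteq> {}"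
  using small by fastforce

lemma inverse_le: "1 \<le> v \<Longrightarrow> L v \<le> x \<Longrightarrow> I x \<le> v"
  unfolding generalized_inverse_def by (rule cInf_lower) (auto intro: bdd_belowI[of _ 1])

lemma inverse_geI: "0 < x \<Longrightarrow> (\<And>v. 1 \<le> v \<Longrightarrow> L v \<le> x \<Longrightarrow> a \<le> v) \<Longrightarrow> a \<le> I x"
  unfolding generalized_inverse_def by (rule cInf_greatest[OF sublevel_nonempty]) auto

lemma inverse_ge_1: "0 < x \<Longrightarrow> 1 \<le> I x"
  by (rule inverse_geI)

lemma below_inverse: "1 \<le> v \<Longrightarrow> v < I x \<Longrightarrow> x < L v"
  using inverse_le[of v x] by linarith

lemma inverse_large:
  assumes "1 \<le> M" "0 < x" "x < L M"
  shows "M \<le> I x"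
proof (rule inverse_geI[OF assms(2)])
  fix v assume "1 \<le> v" "L v \<le> x"
  then show "M \<le> v" using antimono[of v M] assms(3) by (cases "M \<le> v") auto
qed

text \<open>The infimum defining the inverse need not be attained; as it is at least 1, a factor 2
  leaves room for a point of the sublevel set.\<close>

lemma inverse_approx:
  assumes "0 < x"
  shows "\<exists>v\<ge>1. L v \<le> x \<and> v \<le> 2 * I x"
proof -
  have "I x < 2 * I x" using inverse_ge_1[OF assms] by linarith
  then obtain v where "v \<in> {v \<in> {1..}. L v \<le> x}" "v < 2 * I x"
    using cInf_lessD[OF sublevel_nonempty[OF assms], of "2 * I x"] unfolding generalized_inverse_def by blast
  then show ?thesis by auto
qed

text \<open>Doubling of \<open>L \<circ> exp\<close> means \<open>L (v\<^sup>2) \<ge> c L v\<close>, so dilating the argument squares the inverse.\<close>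

lemma doubling_inverse:
  assumes "doubling_near_infinity (L \<circ> exp)"
  shows "\<exists>c>0. \<exists>\<epsilon>>0. \<forall>x. 0 < x \<longrightarrow> x < \<epsilon> \<longrightarrow> (I x)\<^sup>2 \<le> I (c * x)"
proof -
  obtain c x0 where c: "0 < c" and d: "\<And>x. x0 \<le> x \<Longrightarrow> c * L (exp x) \<le> L (exp (2 * x))"
    using assms unfolding doubling_near_infinity_def by auto
  define M where "M = exp (max 0 x0)"
  have M1: "1 \<le> M" by (simp add: M_def)
  have M2: "1 \<le> M\<^sup>2" using M1 by (simp add: one_le_power)
  \<comment> \<open>Doubling is available only from M on. For x below this threshold, c x < L (M^2),
    which rules out any v \<le> M^2 in the sublevel set.\<close>
  define \<epsilon> where "\<epsilon> = L (M\<^sup>2) / c"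
  have "0 < \<epsilon>" unfolding \<epsilon>_def using positive[OF M2] c by simp
  moreover have "(I x)\<^sup>2 \<le> I (c * x)" if x: "0 < x" "x < \<epsilon>" for x
  proof (rule inverse_geI)
    show "0 < c * x" using c x by simp
    fix v assume v: "1 \<le> v" "L v \<le> c * x"
    show "(I x)\<^sup>2 \<le> v"
    proof (rule ccontr)
      assume "\<not> (I x)\<^sup>2 \<le> v"
      then have lt: "sqrt v < I x" using inverse_ge_1[OF x(1)] by (simp add: real_less_lsqrt)
      have s1: "1 \<le> sqrt v" using v by simp
      have Ls: "x < L (sqrt v)" by (rule below_inverse[OF s1 lt])
      show False
      proof (cases "M \<le> sqrt v")
        case True
        have "exp x0 \<le> M" by (simp add: M_def)
        then have "x0 \<le> ln (sqrt v)" using True s1 by (subst ln_ge_iff) auto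
        then have "c * L (exp (ln (sqrt v))) \<le> L (exp (2 * ln (sqrt v)))" by (rule d)
        moreover have "exp (2 * ln (sqrt v)) = v" using v by (simp add: ln_sqrt)
        ultimately have "c * L (sqrt v) \<le> L v" using s1 by simp
        moreover have "c * x < c * L (sqrt v)" using Ls c by simp
        ultimately show False using v(2) by linarith
      next
        case False
        then have "(sqrt v)\<^sup>2 \<le> M\<^sup>2" using s1 by (intro power_mono) auto
        then have "v \<le> M\<^sup>2" using v by simp
        then have "L (M\<^sup>2) \<le> L v" by (rule antimono[OF v(1)])
        moreover have "c * x < L (M\<^sup>2)" using x(2) c by (simp add: \<epsilon>_def field_simps)
        ultimately show False using v(2) by linarith
      qed
    qed
  qed
  ultimately show ?thesis using c by blast
qed

end

theorem theorem1p3: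
  fixes G :: "('a, 'b) monoid_scheme" and \<mu> :: "'a pmf"
  assumes "group G"
    and "infinite (carrier G)"
    and "finitely_generated_group G"
    and "amenable_group G"
    and "admissible G \<mu>"
    and "doubling_near_infinity (l2_isoperimetric_profile G \<mu> \<circ> exp)"
  shows "dil_equiv (spectral_distribution G \<mu>)
    (\<lambda>r. if r = 0 then 0
         else 1 / generalized_inverse {1..} (l2_isoperimetric_profile G \<mu>) r)"
proof -
  interpret random_walk G \<mu>
  proof (intro random_walk.intro random_walk_axioms.intro assms(1))
    note adm = assms(5)[unfolded admissible_def]
    show "set_pmf \<mu> \<subseteq> carrier G" by (rule adm[THEN conjunct1])
    show "pmf \<mu> (inv\<^bsub>G\<^esub> \<gamma>) = pmf \<mu> \<gamma>" if "\<gamma> \<in> carrier G" for \<gamma>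
      by (rule adm[THEN conjunct2, THEN conjunct1, rule_format, OF that, symmetric])
  qed
  obtain S where S: "S \<subseteq> carrier G" "S \<subseteq> set_pmf \<mu>" "generate G S = carrier G"
    using assms(5) unfolding admissible_def finite_generating_set_def by blast
  interpret decreasing_profile profile
  proof
    show "profile w \<le> profile v" if "1 \<le> v" "v \<le> w" for v w by (rule profile_antimono[OF that])
    show "0 < profile v" if "1 \<le> v" for v by (rule profile_positive[OF assms(2) S that])
    show "\<exists>v\<ge>1. profile v \<le> \<epsilon>" if "0 < \<epsilon>" for \<epsilon> by (rule profile_small[OF assms(4) that])
  qed
  obtain c \<epsilon> where c: "0 < c" and \<epsilon>: "0 < \<epsilon>" and sq: "\<And>x. 0 < x \<Longrightarrow> x < \<epsilon> \<Longrightarrow> (I x)\<^sup>2 \<le> I (c * x)"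
    using doubling_inverse[OF assms(6)] by blast
  let ?N = "spectral_distribution G \<mu>" and ?g = "\<lambda>r. if r = 0 then 0 else 1 / I r"
  have N0: "0 \<le> ?N r" for r by (simp add: spectral_distribution_eq)
  have upper: "\<exists>\<delta>>0. \<forall>r. 0 < r \<longrightarrow> r < \<delta> \<longrightarrow> ?N r \<le> 1 / I (32 / c * r)"
  proof -
    \<comment> \<open>From V \<ge> W on, the constant 4 exp 2 of the upper bound is at most V powr
      (1/4), leaving V powr (-1/2).\<close>
    define W :: real where "W = (4 * exp 2) ^ 4"
    have W1: "1 \<le> W" unfolding W_def by (intro one_le_power) (use exp_ge_add_one_self[of 2] in linarith)
    \<comment> \<open>The three terms ensure r \<le> 1 for the exponential estimate, 32 r / c <
      \<epsilon> for the squaring property, and 32 r below the profile at W, so that V \<ge>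
      W.\<close>
    define \<delta> where "\<delta> = min 1 (min (\<epsilon> * c / 32) (profile W / 32))"
    have "0 < \<delta>" using \<epsilon> c positive[OF W1] by (simp add: \<delta>_def)
    moreover have "?N r \<le> 1 / I (32 / c * r)" if r: "0 < r" "r < \<delta>" for r
    proof -
      define V where "V = I (32 * r)"
      have VW: "W \<le> V" unfolding V_def using r by (intro inverse_large W1) (auto simp: \<delta>_def)
      have V1: "1 \<le> V" using VW W1 by linarith
      have "?N r \<le> 4 * exp 2 * V powr (- 3 / 4)"
        using r below_inverse[of _ "32 * r"]
        by (intro distribution_upper_bound) (auto simp: V_def[symmetric] V1 \<delta>_def intro: less_imp_le)
      also have "\<dots> \<le> V powr (1 / 4) * V powr (- 3 / 4)"
      proof (rule mult_right_mono)
        have "b ^ 4 = b powr 4" if "0 < b" for b :: real using powr_realpow[OF that, of 4] by simp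
        then have "W powr (1 / 4) = ((4 * exp 2) powr 4) powr (1 / 4)" by (simp only: W_def) simp
        then have "W powr (1 / 4) = 4 * exp 2" by (simp only: powr_powr) simp
        moreover have "W powr (1 / 4) \<le> V powr (1 / 4)" using VW W1 by (intro powr_mono2) auto
        ultimately show "4 * exp 2 \<le> V powr (1 / 4)" by simp
      qed simp
      also have "\<dots> = V powr (- (1 / 2))" by (simp only: powr_add[symmetric]) simp
      also have "\<dots> = 1 / sqrt V" using V1 by (simp only: powr_minus_divide powr_half_sqrt)
      also have "\<dots> \<le> 1 / I (32 / c * r)"
      proof -
        have x: "0 < 32 / c * r" "32 / c * r < \<epsilon>" using r c by (auto simp: \<delta>_def field_simps)
        have "(I (32 / c * r))\<^sup>2 \<le> V" using sq[OF x] c by (simp add: V_def)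
        then have "I (32 / c * r) \<le> sqrt V" by (rule real_le_rsqrt)
        then show ?thesis using inverse_ge_1[OF x(1)] by (intro frac_le) auto
      qed
      finally show ?thesis .
    qed
    ultimately show ?thesis by blast
  qed
  then obtain \<delta> where \<delta>: "0 < \<delta>" and up: "\<And>r. 0 < r \<Longrightarrow> r < \<delta> \<Longrightarrow> ?N r \<le> 1 / I (32 / c * r)" by blast
  have mono: "?N 0 \<le> ?N r" if "0 \<le> r" for r
    unfolding spectral_distribution_eq
  proof (rule finite_measure.finite_measure_mono)
    note s = spec_spectral_at[OF delta_supported[OF one_closed]]
    show "finite_measure (spec (ell2_delta \<one>\<^bsub>G\<^esub>))" using s by (simp add: laplace.spectral_at_def)
    show "{..r} \<in> sets (spec (ell2_delta \<one>\<^bsub>G\<^esub>))" using s by (simp add: laplace.spectral_at_def)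
  qed (use that in auto)
  \<comment> \<open>The comparison at r = 0 demands this. Monotonicity gives N 0 \<le> N r for small
    r > 0, and the upper bound tends to 0 since the inverse is unbounded.\<close>
  have N_zero: "?N 0 = 0"
  proof (rule ccontr)
    assume "?N 0 \<noteq> 0"
    then have pos: "0 < ?N 0" using N0[of 0] by linarith
    \<comment> \<open>An inverse of at least 2 / N 0 would force N 0 \<le> N 0 / 2.\<close>
    define M where "M = max 1 (2 / ?N 0)"
    have M1: "1 \<le> M" by (simp add: M_def)
    define r where "r = min (\<delta> / 2) (c * profile M / 64)"
    have r: "0 < r" "r < \<delta>" "32 / c * r < profile M"
    proof -
      show "0 < r" "r < \<delta>" using \<delta> c positive[OF M1] by (auto simp: r_def)
      have "32 / c * r \<le> 32 / c * (c * profile M / 64)" using c by (intro mult_left_mono) (auto simp: r_def)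
      also have "\<dots> < profile M" using c positive[OF M1] by simp
      finally show "32 / c * r < profile M" .
    qed
    have "?N 0 \<le> 1 / I (32 / c * r)" using mono[of r] up[of r] r by linarith
    also have "\<dots> \<le> 1 / M"
      using inverse_large[OF M1, of "32 / c * r"] r c M1 by (intro frac_le) auto
    also have "\<dots> \<le> 1 / (2 / ?N 0)" using pos by (intro frac_le) (auto simp: M_def)
    finally show False using pos by simp
  qed
  have "dil_le ?N ?g"
  proof -
    have "?N r \<le> ?g (32 / c * r)" if r: "r \<in> {0..<\<delta>}" for r
      using r up[of r] c N_zero by (cases "r = 0") auto
    moreover have "0 < 32 / c" using c by simp
    ultimately show ?thesis unfolding dil_le_def using \<delta> by blast
  qed
  moreover have "dil_le ?g ?N"
  proof -
    \<comment> \<open>For x = r / c the first term permits squaring; the second gives I x \<ge> 4,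
      so that (I x)^2 \<ge> 4 I x \<ge> 2 v absorbs both the factor 2 lost in approximating the
      inverse and the 2 in the lower bound.\<close>
    define \<eta> where "\<eta> = min (\<epsilon> * c) (c * profile 4)"
    have "0 < \<eta>" using \<epsilon> c positive[of 4] by (simp add: \<eta>_def)
    moreover have "?g r \<le> ?N (4 / c * r)" if r: "r \<in> {0..<\<eta>}" for r
    proof (cases "r = 0")
      case True
      then show ?thesis using N0 by simp
    next
      case False
      define x where "x = r / c"
      have x: "0 < x" "x < \<epsilon>" "x < profile 4" and rx: "r = c * x"
        using False r c by (auto simp: x_def \<eta>_def field_simps)
      have I4: "4 \<le> I x" using x by (intro inverse_large) auto
      obtain v where v: "1 \<le> v" "profile v \<le> x" "v \<le> 2 * I x" using inverse_approx[OF x(1)] by blast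
      have "1 / I r \<le> 1 / (I x)\<^sup>2"
        unfolding rx using sq[OF x(1,2)] I4 by (intro frac_le) auto
      also have "\<dots> \<le> 1 / (2 * v)"
      proof (rule frac_le)
        have "4 * I x \<le> I x * I x" using I4 by (intro mult_right_mono) auto
        then show "2 * v \<le> (I x)\<^sup>2" using v(3) unfolding power2_eq_square by linarith
      qed (use v I4 in auto)
      also have "\<dots> \<le> ?N (2 * (2 * x))" using v x by (intro distribution_lower_bound) auto
      finally show ?thesis using False c by (simp add: rx)
    qed
    moreover have "0 < 4 / c" using c by simp
    ultimately show ?thesis unfolding dil_le_def by blast
  qed
  ultimately show ?thesis unfolding dil_equiv_def by blast
qed

end
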